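(* Let $\sigma\in[-1,1]$, let $g\in H_0^2(\mathbb R)$ be real valued and compactly supported, let $E=2$, let $0<a<2/3$, and set $f(x):=g(N^a(x-2))$. Then the quantities $V_{\mathrm{tr}}^1,V_{\mathrm{tr}}^2,V_{\mathrm d}^1,V_{\mathrm d}^2,E_{\mathrm{tr}}$ and $C_N=C_N^{a,2}$ defined in the context satisfy the scaling asymptotics $$V_{\mathrm{tr}}^1(f)=\frac{\|g(-x^2)\|_{\dot H^{1/2}}^2}{8\pi^2}+\mathcal O(N^{-a/2}),\qquad V_{\mathrm{tr}}^2(f,\sigma)=\mathbf 1(\sigma=1)\frac{\|g(-x^2)\|_{\dot H^{1/2}}^2}{8\pi^2}+\mathcal O(N^{-a/2}),$$ $$C_NV_{\mathrm d}^1(f)=\frac{\|g(-x^2)x\|_{L^2}^2}{\pi}+\mathcal O(N^{-a/2}),\qquad C_NV_{\mathrm d}^2(f,\sigma)=\mathbf 1(\sigma=1)\frac{\|g(-x^2)x\|_{L^2}^2}{\pi}+\mathcal O(N^{-a/2}),$$ $$E_{\mathrm{tr}}(f,\sigma)=\mathbf 1(\sigma=1)\frac{g(0)}4+\mathcal O(N^{-a/2}).$$ The implicit constants in the error terms depend only on $a$, $\|g\|_{H_0^2}$, $|\operatorname{supp}g|$, on the moment constants $C_p$, and on $\sigma$ in the following sense: in the formulas containing $\mathbf 1(\sigma=1)$ the error is, when $\sigma\ne1$, uniform in $\sigma\le1-\epsilon$ for any fixed $\epsilon>0$. The case of the left edge $E=-2$ is completely analogous.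
   Context: $W$ is an $N\times N$ Wigner matrix: its entries are independent up to the Hermitian symmetry $w_{ab}=\overline{w_{ba}}$, with $w_{ab}\overset d=N^{-1/2}\chi_{\mathrm{od}}$ for $a<b$ and $w_{aa}\overset d=N^{-1/2}\chi_{\mathrm d}$, where $\chi_{\mathrm d}$ is real, $\chi_{\mathrm{od}}$ is real or complex, $\mathbf E\chi_{\mathrm{od}}=\mathbf E\chi_{\mathrm d}=0$, $\mathbf E|\chi_{\mathrm{od}}|^2=1$, $\sigma:=\mathbf E\chi_{\mathrm{od}}^2\in\mathbb R$ (hence $\sigma\in[-1,1]$), and for every $p\in\mathbb N$ there is a constant $C_p$ with $\mathbf E|\chi_{\mathrm d}|^p+\mathbf E|\chi_{\mathrm{od}}|^p\le C_p$. The quantities below are deterministic and depend on the matrix only through $N$ and $\sigma$. The asymptotics are for large $N$. $m(z):=\int_{-2}^2\frac{\sqrt{4-x^2}}{2\pi(x-z)}dx$, $\rho(z):=\frac1\pi|\operatorname{Im}m(z)|$, and $C_N=C_N^{a,E}:=N^a/\rho(E+\mathrm iN^{-a})$ for $a>0$. Moreover $\langle h\rangle_{\mathrm{sc}}:=\int_{-2}^2h(x)\frac{\sqrt{4-x^2}}{2\pi}dx$ and $\langle h\rangle_{1/\mathrm{sc}}:=\int_{-2}^2\frac{h(x)}{\pi\sqrt{4-x^2}}dx$. Set $V_{\mathrm{tr}}^1(f):=\frac1{4\pi^2}\iint_{-2}^2\Big(\frac{f(x)-f(y)}{x-y}\Big)^2\frac{4-xy}{\sqrt{(4-x^2)(4-y^2)}}\,dx\,dy$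 and $V_{\mathrm d}^1(f):=\langle f^2\rangle_{\mathrm{sc}}-\langle f\rangle_{\mathrm{sc}}^2$. For $|\sigma|<1$ set $V_{\mathrm{tr}}^2(f,\sigma):=\frac1{4\pi^2}\iint_{-2}^2f(x)f(y)\,\partial_x\partial_y\log\Big[\frac{(x-\sigma y)^2+(\sqrt{4-x^2}+\sigma\sqrt{4-y^2})^2}{(x-\sigma y)^2+(\sqrt{4-x^2}-\sigma\sqrt{4-y^2})^2}\Big]dx\,dy$, $V_{\mathrm d}^2(f,\sigma):=\frac1{4\pi^2}\iint_{-2}^2f(x)f(y)\frac{(1-\sigma^2)\sqrt{(4-x^2)(4-y^2)}}{\sigma^2(x^2+y^2)+(1-\sigma^2)^2-xy\sigma(1+\sigma^2)}\,dx\,dy-\langle f\rangle_{\mathrm{sc}}^2$, $E_{\mathrm{tr}}(f,\sigma):=\Big\langle f\Big(1-\frac{1-\sigma^2}{(1+\sigma)^2-\sigma x^2}\Big)\Big\rangle_{1/\mathrm{sc}}$; for $\sigma=\pm1$, the quantities $V_{\mathrm{tr}}^2,V_{\mathrm d}^2,E_{\mathrm{tr}}$ are defined as the limits $\sigma\to\pm1$ of these expressions. Norms of functions of $x\in\mathbb R$: $\|h\|_{L^2}^2:=\int_{\mathbb R}h(x)^2dx$, $\|h\|_{\dot H^{1/2}}^2:=\int_{\mathbb R^2}\big(\frac{h(x)-h(y)}{x-y}\big)^2dx\,dy$; $g(-x^2)$ denotes the function $x\mapsto g(-x^2)$ and $g(-x^2)x$ the function $x\mapsto x\,g(-x^2)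$.
   Formalization: With the given definitions two printed constants are false and are corrected: C_N V_d has leading constant sqrt 2 instead of 1/pi, and E_tr has -g(0)/2 instead of g(0)/4; dependence on |supp g| is read as dependence on R with supp g in [-R,R], since uniformity over translates fails. *)

theory Defs
  imports "HOL-Analysis.Analysis"
begin

definition m_sc :: "complex \<Rightarrow> complex" where
  "m_sc z = (LINT x:{-2..2}|lborel.
     complex_of_real (sqrt (4 - x^2)) / (2 * of_real pi * (complex_of_real x - z)))"

definition rho_sc :: "complex \<Rightarrow> real" where
  "rho_sc z = \<bar>Im (m_sc z)\<bar> / pi"

(* At the edges rho_sc (Complex E \<eta>) is asymptotic to sqrt (\<eta> / 2) / pi as \<eta> tends to 0,
   so that there C_scale a E N is asymptotic to sqrt 2 * pi * N powr (3 * a / 2). *)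
definition C_scale :: "real \<Rightarrow> real \<Rightarrow> nat \<Rightarrow> real" where
  "C_scale a E N = real N powr a / rho_sc (Complex E (real N powr (- a)))"

definition avg_sc :: "(real \<Rightarrow> real) \<Rightarrow> real" where
  "avg_sc h = (LINT x:{-2..2}|lborel. h x * (sqrt (4 - x^2) / (2 * pi)))"

definition avg_inv_sc :: "(real \<Rightarrow> real) \<Rightarrow> real" where
  "avg_inv_sc h = (LINT x:{-2..2}|lborel. h x / (pi * sqrt (4 - x^2)))"

(* Division by zero on the diagonal and on the boundary of the square, as well as the value of
   the derivatives in V_tr2_open on that boundary, only concern null sets. *)

definition V_tr1 :: "(real \<Rightarrow> real) \<Rightarrow> real" where
  "V_tr1 f = 1 / (4 * pi^2) * (LINT (x, y):{-2..2} \<times> {-2..2}|lborel.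
     ((f x - f y) / (x - y))^2 * ((4 - x * y) / sqrt ((4 - x^2) * (4 - y^2))))"

definition V_d1 :: "(real \<Rightarrow> real) \<Rightarrow> real" where
  "V_d1 f = avg_sc (\<lambda>x. (f x)^2) - (avg_sc f)^2"

definition V_tr2_log :: "real \<Rightarrow> real \<Rightarrow> real \<Rightarrow> real" where
  "V_tr2_log \<sigma> x y =
     ln (((x - \<sigma> * y)^2 + (sqrt (4 - x^2) + \<sigma> * sqrt (4 - y^2))^2) /
         ((x - \<sigma> * y)^2 + (sqrt (4 - x^2) - \<sigma> * sqrt (4 - y^2))^2))"

definition V_tr2_open :: "(real \<Rightarrow> real) \<Rightarrow> real \<Rightarrow> real" where
  "V_tr2_open f \<sigma> = 1 / (4 * pi^2) * (LINT (x, y):{-2..2} \<times> {-2..2}|lborel.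
     f x * f y * deriv (\<lambda>x'. deriv (\<lambda>y'. V_tr2_log \<sigma> x' y') y) x)"

definition V_d2_open :: "(real \<Rightarrow> real) \<Rightarrow> real \<Rightarrow> real" where
  "V_d2_open f \<sigma> = 1 / (4 * pi^2) * (LINT (x, y):{-2..2} \<times> {-2..2}|lborel.
     f x * f y * ((1 - \<sigma>^2) * sqrt ((4 - x^2) * (4 - y^2)) /
       (\<sigma>^2 * (x^2 + y^2) + (1 - \<sigma>^2)^2 - x * y * \<sigma> * (1 + \<sigma>^2)))) - (avg_sc f)^2"

definition E_tr_open :: "(real \<Rightarrow> real) \<Rightarrow> real \<Rightarrow> real" where
  "E_tr_open f \<sigma> =
     avg_inv_sc (\<lambda>x. f x * (1 - (1 - \<sigma>^2) / ((1 + \<sigma>)^2 - \<sigma> * x^2)))"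

definition extend_to_pm1 :: "(real \<Rightarrow> real) \<Rightarrow> real \<Rightarrow> real" where
  "extend_to_pm1 F \<sigma> =
     (if \<sigma> = 1 then Lim (at_left 1) F else if \<sigma> = -1 then Lim (at_right (-1)) F else F \<sigma>)"

definition V_tr2 :: "(real \<Rightarrow> real) \<Rightarrow> real \<Rightarrow> real" where
  "V_tr2 f = extend_to_pm1 (V_tr2_open f)"

definition V_d2 :: "(real \<Rightarrow> real) \<Rightarrow> real \<Rightarrow> real" where
  "V_d2 f = extend_to_pm1 (V_d2_open f)"

(* E_tr f 1 = avg_inv_sc f - (f 2 + f (-2)) / 2 for continuous f: with x = 2 * cos \<theta> the quotient
   in E_tr_open is the Poisson kernel at angle 2 * \<theta>, and it concentrates at x = 2 and x = -2. *)
definition E_tr :: "(real \<Rightarrow> real) \<Rightarrow> real \<Rightarrow> real" where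
  "E_tr f = extend_to_pm1 (E_tr_open f)"

definition L2_norm :: "(real \<Rightarrow> real) \<Rightarrow> real" where
  "L2_norm h = sqrt (LINT x|lborel. (h x)^2)"

definition H_half_norm :: "(real \<Rightarrow> real) \<Rightarrow> real" where
  "H_half_norm h = sqrt (LINT (x, y)|lborel. ((h x - h y) / (x - y))^2)"

definition L2 :: "(real \<Rightarrow> real) set" where
  "L2 = {h \<in> borel_measurable borel. integrable lborel (\<lambda>x. (h x)^2)}"

definition test_function :: "(real \<Rightarrow> real) \<Rightarrow> bool" where
  "test_function \<phi> \<longleftrightarrow>
     (\<forall>n x. (deriv ^^ n) \<phi> field_differentiable at x) \<and> compact (closure {x. \<phi> x \<noteq> 0})"

definition has_weak_deriv :: "(real \<Rightarrow> real) \<Rightarrow> (real \<Rightarrow> real) \<Rightarrow> bool" where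
  "has_weak_deriv g u \<longleftrightarrow>
     (\<forall>\<phi>. test_function \<phi> \<longrightarrow>
        (LINT x|lborel. g x * deriv \<phi> x) = - (LINT x|lborel. u x * \<phi> x))"

(* unique up to null sets, which is all that the norm below depends on *)
definition weak_deriv :: "(real \<Rightarrow> real) \<Rightarrow> real \<Rightarrow> real" where
  "weak_deriv g = (SOME u. u \<in> L2 \<and> has_weak_deriv g u)"

definition H2 :: "(real \<Rightarrow> real) set" where
  "H2 = {g \<in> L2. \<exists>u\<in>L2. \<exists>v\<in>L2. has_weak_deriv g u \<and> has_weak_deriv u v}"

definition H2_norm :: "(real \<Rightarrow> real) \<Rightarrow> real" where
  "H2_norm g = sqrt ((L2_norm g)^2 + (L2_norm (weak_deriv g))^2
     + (L2_norm (weak_deriv (weak_deriv g)))^2)"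

definition H2_0 :: "(real \<Rightarrow> real) set" where
  "H2_0 = {g \<in> H2. \<exists>\<phi>. (\<forall>n. test_function (\<phi> n)) \<and>
     (\<lambda>n::nat. H2_norm (\<lambda>x. g x - \<phi> n x)) \<longlonglongrightarrow> 0}"

end

theory Submission
  imports Defs "HOL-Computational_Algebra.Polynomial"
begin

text \<open>
  With \<open>x = 2 cos \<theta>\<close> and \<open>y = 2 cos \<phi>\<close> the kernels of \<open>V_tr2\<close>, \<open>V_d2\<close> and \<open>E_tr\<close> are built from
  \<open>1 + \<sigma>\<^sup>2 - 2 \<sigma> cos (\<theta> \<plusminus> \<phi>)\<close>. For \<open>\<sigma> \<le> 1 - \<epsilon>\<close> they are bounded near the edge, so that these quantities
  are small with the support of the test function, an interval of length of order \<open>N\<^sup>-\<^sup>a\<close>. At \<open>\<sigma> = 1\<close> they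
  concentrate on the diagonal: polarization,
  \<open>2 f(x) f(y) = f(x)\<^sup>2 + f(y)\<^sup>2 - (f(x) - f(y))\<^sup>2\<close>, together with the explicit marginals of the kernels and
  dominated convergence identifies the limits \<open>\<sigma> \<rightarrow> 1\<close> with \<open>V_tr1 f\<close>, \<open>V_d1 f\<close> and
  \<open>avg_inv_sc f - (f(2) + f(-2)) / 2\<close>.

  For the latter, put \<open>x = s (2 - \<alpha>)\<close> and \<open>\<alpha> = N\<^sup>-\<^sup>a u\<^sup>2\<close>: this turns \<open>f\<close> into \<open>u \<mapsto> g (- s u\<^sup>2)\<close>, and the
  \<open>H\<^sup>1\<^sup>/\<^sup>2\<close>-seminorm is an integral over \<open>\<alpha>, \<beta> > 0\<close> of
  \<open>((f(\<alpha>) - f(\<beta>)) / (\<alpha> - \<beta>))\<^sup>2 (\<alpha> + \<beta>) / \<surd>(\<alpha> \<beta>)\<close>, which is compared pointwise with the integrand of \<open>V_tr1\<close>. All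
  that is used of \<open>g\<close> is that it is Lipschitz with a constant depending on its \<open>H\<^sup>2\<close>-norm and its support.
\<close>

section \<open>Smooth functions and weak derivatives\<close>

text \<open>Two difficulties shape the proof. At \<sigma> = 1 and \<sigma> = -1 the quantities are
  values of \<open>Lim\<close>, which say nothing until convergence is proved; towards \<sigma> = 1
  the kernels become singular on the diagonal, and the factor (f(x) - f(y))^2 left by polarization
  absorbs that singularity before the limit is taken. Moreover \<open>deriv\<close> and the integral
  are total, so the integrand of \<open>V_tr2_open\<close> must be shown measurable even where the
  derivative does not exist. The constants come from the square-root edge. Im m(2 + i \<eta>) is
  sqrt(\<eta>/2) up to O(\<eta>), hence C_N is close to sqrt 2 \<pi> N^(3a/2), whereas V_d1(f) is
  close to N^(-3a/2) / \<pi> times the squared norm of x g(-x^2): the product has the factor sqrt 2.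
  At \<sigma> = 1 the part \<open>avg_inv_sc f\<close> of E_tr is O(N^(-a/2)), so what remains is
  -(f(2) + f(-2)) / 2 = -g(0) / 2. The rate N^(-a/2) is the square root of the length of the
  support.\<close>

definition smooth :: "(real \<Rightarrow> real) \<Rightarrow> bool" where
  "smooth f \<longleftrightarrow> (\<forall>n x. (deriv ^^ n) f field_differentiable at x)"

text \<open>Higher derivatives are never computed. It is enough to exhibit a class of differentiable
  functions that is closed under \<open>deriv\<close>; products, affine substitutions and exp(-1/x)
  are all treated by choosing such a class.\<close>

lemma smoothI_closed_class:
  assumes "f \<in> S"
    and "\<And>h x. h \<in> S \<Longrightarrow> h field_differentiable at x"
    and "\<And>h. h \<in> S \<Longrightarrow> deriv h \<in> S"
  shows "smooth f"
proof -
  have "(deriv ^^ n) f \<in> S" for n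
    by (induction n) (auto simp: assms)
  then show ?thesis
    using assms(2) by (auto simp: smooth_def)
qed

lemma smooth_differentiable: "smooth f \<Longrightarrow> f field_differentiable at x"
  unfolding smooth_def by (metis funpow_0)

lemma smooth_deriv: "smooth f \<Longrightarrow> smooth (deriv f)"
  unfolding smooth_def by (metis comp_apply funpow_Suc_right)

lemma smooth_DERIV: "smooth f \<Longrightarrow> (f has_real_derivative deriv f x) (at x)"
  using smooth_differentiable field_differentiable_derivI by blast

lemma smooth_continuous: "smooth f \<Longrightarrow> continuous_on A f"
  using smooth_DERIV DERIV_isCont continuous_at_imp_continuous_on by blast

lemma smooth_antideriv:
  assumes "smooth f" and "\<And>x. (F has_real_derivative f x) (at x)"
  shows "smooth F"
proof -
  have d: "deriv F = f"
    using assms(2) by (auto simp: fun_eq_iff DERIV_imp_deriv)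
  have "(deriv ^^ n) F field_differentiable at x" for n x
  proof (cases n)
    case 0
    then show ?thesis
      using assms(2) by (auto simp: field_differentiable_def)
  next
    case (Suc k)
    then show ?thesis
      using assms(1) d unfolding smooth_def by (simp add: funpow_Suc_right del: funpow.simps)
  qed
  then show ?thesis by (simp add: smooth_def)
qed

text \<open>Products of two smooth functions are not closed under \<open>deriv\<close>, but finite
  sums of them are, by the Leibniz rule. With one factor equal to 1 this also covers sums of smooth
  functions.\<close>

inductive_set sum_of_products :: "(real \<Rightarrow> real) set" where
  prod: "smooth f \<Longrightarrow> smooth g \<Longrightarrow> (\<lambda>x. f x * g x) \<in> sum_of_products"
| sum: "h \<in> sum_of_products \<Longrightarrow> k \<in> sum_of_products \<Longrightarrow> (\<lambda>x. h x + k x) \<in> sum_of_products"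

lemma sum_of_products_differentiable:
  "f \<in> sum_of_products \<Longrightarrow> f field_differentiable at x"
  by (induction rule: sum_of_products.induct)
    (simp_all add: field_differentiable_mult field_differentiable_add smooth_differentiable)

lemma smooth_sum_of_products:
  assumes "f \<in> sum_of_products"
  shows "smooth f"
proof (rule smoothI_closed_class[OF assms])
  fix h assume "h \<in> sum_of_products"
  then show "deriv h \<in> sum_of_products"
  proof induction
    case (prod f g)
    have "deriv (\<lambda>x. f x * g x) = (\<lambda>x. f x * deriv g x + deriv f x * g x)"
      using prod by (simp add: fun_eq_iff smooth_differentiable)
    then show ?case
      using sum_of_products.sum[OF sum_of_products.prod[OF prod(1) smooth_deriv[OF prod(2)]]
          sum_of_products.prod[OF smooth_deriv[OF prod(1)] prod(2)]] by simp
  next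
    case (sum h k)
    then have "deriv (\<lambda>x. h x + k x) = (\<lambda>x. deriv h x + deriv k x)"
      by (simp add: fun_eq_iff sum_of_products_differentiable)
    then show ?case
      using sum_of_products.sum[OF sum.IH] by simp
  qed
qed (rule sum_of_products_differentiable)

lemma smooth_mult: "smooth f \<Longrightarrow> smooth g \<Longrightarrow> smooth (\<lambda>x. f x * g x)"
  by (rule smooth_sum_of_products[OF sum_of_products.prod])

lemma smooth_const: "smooth (\<lambda>x. c)"
  by (rule smoothI_closed_class[where S = "range (\<lambda>c x. c)"]) auto

lemma smooth_add:
  assumes "smooth f" "smooth g"
  shows "smooth (\<lambda>x. f x + g x)"
proof -
  have "(\<lambda>x. f x * 1 + g x * 1) \<in> sum_of_products"
    using sum_of_products.sum[OF sum_of_products.prod[OF assms(1) smooth_const[of 1]]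
        sum_of_products.prod[OF assms(2) smooth_const[of 1]]] .
  then show ?thesis
    using smooth_sum_of_products by simp
qed

lemma smooth_diff: "smooth f \<Longrightarrow> smooth g \<Longrightarrow> smooth (\<lambda>x. f x - g x)"
  using smooth_add[of f "\<lambda>x. (-1) * g x"] smooth_mult[OF smooth_const[of "-1"], of g] by simp

lemma smooth_cmult: "smooth f \<Longrightarrow> smooth (\<lambda>x. c * f x)"
  by (intro smooth_mult smooth_const)

lemma smooth_affine:
  assumes "smooth f"
  shows "smooth (\<lambda>x. f (c * x + d))"
\<comment> \<open>The prefactor \<open>b\<close> collects the factors \<open>c\<close> produced by
  the chain rule, so that the class is closed under \<open>deriv\<close>.\<close>
proof (rule smoothI_closed_class[where S = "{\<lambda>x. b * h (c * x + d) | b h. smooth h}"])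
  show "(\<lambda>x. f (c * x + d)) \<in> {\<lambda>x. b * h (c * x + d) | b h. smooth h}"
    using assms by (auto intro!: exI[of _ 1] exI[of _ f])
next
  fix h x assume "h \<in> {\<lambda>x. b * h (c * x + d) | b h. smooth h}"
  then obtain b k where k: "smooth k" and h: "h = (\<lambda>x. b * k (c * x + d))" by auto
  have D: "(h has_real_derivative (b * c) * deriv k (c * x + d)) (at x)" for x
    unfolding h by (auto intro!: derivative_eq_intros DERIV_chain2[OF smooth_DERIV[OF k]])
  then show "h field_differentiable at x"
    using field_differentiable_def by blast
next
  fix h assume "h \<in> {\<lambda>x. b * h (c * x + d) | b h. smooth h}"
  then obtain b k where k: "smooth k" and h: "h = (\<lambda>x. b * k (c * x + d))" by auto
  have D: "(h has_real_derivative (b * c) * deriv k (c * x + d)) (at x)" for x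
    unfolding h by (auto intro!: derivative_eq_intros DERIV_chain2[OF smooth_DERIV[OF k]])
  then have "deriv h = (\<lambda>x. (b * c) * deriv k (c * x + d))"
    by (auto simp: fun_eq_iff DERIV_imp_deriv)
  then show "deriv h \<in> {\<lambda>x. b * h (c * x + d) | b h. smooth h}"
    using smooth_deriv[OF k] by blast
qed

section \<open>Smooth bumps, steps and ramps from exp(-1/x)\<close>

definition exp_inv_poly :: "real poly \<Rightarrow> real \<Rightarrow> real" where
  "exp_inv_poly p x = (if x \<le> 0 then 0 else poly p (1 / x) * exp (- (1 / x)))"

lemma poly_exp_decay: "((\<lambda>t::real. poly p t * exp (- t)) \<longlongrightarrow> 0) at_top"
proof (induction p rule: pCons_induct)
  case 0
  then show ?case by simp
next
  case (pCons c p)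
  \<comment> \<open>The power t^k has to be carried along: splitting off the constant coefficient
    leaves t times the remaining polynomial.\<close>
  have "((\<lambda>t::real. poly p t * t ^ k * exp (- t)) \<longlongrightarrow> 0) at_top" for k
  proof (induction p arbitrary: k rule: pCons_induct)
    case 0
    then show ?case by simp
  next
    case (pCons c p)
    have "((\<lambda>t::real. c * (t ^ k / exp t) + poly p t * t ^ Suc k * exp (- t)) \<longlongrightarrow> c * 0 + 0) at_top"
      by (intro tendsto_intros tendsto_power_div_exp_0 pCons.IH)
    then show ?case
      by (simp add: algebra_simps exp_minus divide_inverse)
  qed
  from this[of 1] have "((\<lambda>t::real. c * (t ^ 0 / exp t) + poly p t * t ^ 1 * exp (- t)) \<longlongrightarrow> c * 0 + 0) at_top"
    by (intro tendsto_intros tendsto_power_div_exp_0)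
  then show ?case
    by (simp add: algebra_simps exp_minus divide_inverse)
qed

text \<open>With t = 1/x one has d/dx = - t^2 d/dt, so p(t) exp(-t) becomes t^2 (p - p')(t) exp(-t);
  allowing every polynomial closes the family under \<open>deriv\<close>. At 0 the difference
  quotient from the right is again such a function, with polynomial t p(t), and tends to 0 by
  \<open>poly_exp_decay\<close>.\<close>

lemma exp_inv_poly_DERIV:
  "(exp_inv_poly p has_real_derivative exp_inv_poly ([:0, 0, 1:] * (p - pderiv p)) x) (at x)"
proof -
  consider "x < 0" | "x = 0" | "x > 0" by linarith
  then show ?thesis
  proof cases
    case 1
    have "((\<lambda>x::real. 0) has_real_derivative 0) (at x)" by simp
    then show ?thesis
      using 1 by (subst DERIV_cong_ev[OF refl _ refl, where g = "\<lambda>x. 0"])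
        (auto simp: exp_inv_poly_def intro!: eventually_mono[OF eventually_nhds_in_open[of "{..<0}"]])
  next
    case 3
    have "((\<lambda>x. poly p (1 / x) * exp (- (1 / x))) has_real_derivative
        exp_inv_poly ([:0, 0, 1:] * (p - pderiv p)) x) (at x)"
      using 3 by (auto intro!: derivative_eq_intros DERIV_chain2[OF poly_DERIV]
          simp: exp_inv_poly_def field_simps power2_eq_square)
    then show ?thesis
      using 3 by (subst DERIV_cong_ev[OF refl _ refl, where g = "\<lambda>x. poly p (1 / x) * exp (- (1 / x))"])
        (auto simp: exp_inv_poly_def intro!: eventually_mono[OF eventually_nhds_in_open[of "{0<..}"]])
  next
    case 2
    have "((\<lambda>y. poly ([:0, 1:] * p) (1 / y) * exp (- (1 / y))) \<longlongrightarrow> 0) (at_right (0::real))"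
      using filterlim_compose[OF poly_exp_decay[of "[:0, 1:] * p"] filterlim_inverse_at_top_right]
      by (simp add: inverse_eq_divide)
    then have "((\<lambda>y. exp_inv_poly p y / y) \<longlongrightarrow> 0) (at_right 0)"
      by (rule Lim_transform_eventually)
        (auto simp: eventually_at_right_field exp_inv_poly_def intro!: exI[of _ 1])
    moreover have "((\<lambda>y. exp_inv_poly p y / y) \<longlongrightarrow> 0) (at_left 0)"
      by (rule Lim_transform_eventually[OF tendsto_const])
        (auto simp: eventually_at_left_field exp_inv_poly_def intro!: exI[of _ "-1"])
    ultimately have "((\<lambda>y. exp_inv_poly p y / y) \<longlongrightarrow> 0) (at 0)"
      using filterlim_split_at by blast
    then show ?thesis
      unfolding 2 has_field_derivative_iff by (simp add: exp_inv_poly_def)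
  qed
qed

lemma smooth_exp_inv_poly: "smooth (exp_inv_poly p)"
proof (rule smoothI_closed_class[where S = "range exp_inv_poly"])
  fix h x assume "h \<in> range exp_inv_poly"
  then show "h field_differentiable at x"
    using exp_inv_poly_DERIV field_differentiable_def by blast
next
  fix h assume "h \<in> range exp_inv_poly"
  then obtain p where "h = exp_inv_poly p" by auto
  then have "deriv h = exp_inv_poly ([:0, 0, 1:] * (p - pderiv p))"
    using exp_inv_poly_DERIV DERIV_imp_deriv by blast
  then show "deriv h \<in> range exp_inv_poly" by auto
qed auto

lemma DERIV_zero_eq:
  fixes f :: "real \<Rightarrow> real"
  assumes "x \<le> y" and "\<And>z. (f has_real_derivative f' z) (at z)"
    and "\<And>z. x < z \<Longrightarrow> z < y \<Longrightarrow> f' z = 0"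
  shows "f y = f x"
proof (cases "x < y")
  case True
  show ?thesis
  proof (rule DERIV_isconst_end[OF True])
    show "continuous_on {x..y} f"
      using assms(2) DERIV_isCont by (intro continuous_at_imp_continuous_on) blast
    show "(f has_real_derivative 0) (at z)" if "x < z" "z < y" for z
      using assms(2)[of z] assms(3)[OF that] by simp
  qed
next
  case False
  then show ?thesis using assms(1) by simp
qed

lemma antiderivative_real:
  fixes f :: "real \<Rightarrow> real"
  assumes "continuous_on UNIV f"
  obtains F where "\<And>x. (F has_real_derivative f x) (at x)" and "F c = 0"
proof -
  define F where "F u = (LBINT y=c..u. f y)" for u :: real
  have "(F has_real_derivative f x) (at x)" for x
  proof -
    \<comment> \<open>The interval contains c and has x in its interior, so that the derivative
      within it is a two-sided one.\<close>
    let ?a = "min c x - 1" and ?b = "max c x + 1"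
    have "(F has_vector_derivative f x) (at x within {?a..?b})"
      unfolding F_def
      by (rule interval_integral_FTC2) (auto intro: continuous_on_subset[OF assms])
    then have "(F has_vector_derivative f x) (at x within {?a<..<?b})"
      by (rule has_vector_derivative_within_subset) auto
    then show ?thesis
      by (subst (asm) at_within_open) (auto simp: has_real_derivative_iff_has_vector_derivative)
  qed
  moreover have "F c = 0" by (simp add: F_def)
  ultimately show thesis by (rule that)
qed

text \<open>A bump of mass one, its primitive and the primitive of that. The bump approximates a
  point evaluation, the difference of two translated steps approximates the indicator of an
  interval, and the difference of two translated ramps is a primitive of the latter; there the
  constant \<open>k\<close> cancels.\<close>

lemma bump_step_ramp:
  obtains b B B2 :: "real \<Rightarrow> real" and k :: real
  where "smooth b" "smooth B" "smooth B2"
    and "\<And>x. 0 \<le> b x" "\<And>x. \<bar>x\<bar> \<ge> 1 \<Longrightarrow> b x = 0"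
    and "\<And>x. (B has_real_derivative b x) (at x)" "\<And>x. 0 \<le> B x" "\<And>x. B x \<le> 1"
    and "\<And>x. x \<le> -1 \<Longrightarrow> B x = 0" "\<And>x. x \<ge> 1 \<Longrightarrow> B x = 1"
    and "\<And>x. (B2 has_real_derivative B x) (at x)"
    and "\<And>x. x \<le> -1 \<Longrightarrow> B2 x = 0" "\<And>x. x \<ge> 1 \<Longrightarrow> B2 x = x + k"
proof -
  define e where "e = exp_inv_poly 1"
  \<comment> \<open>The arguments are spelled as \<open>c * x + d\<close> to fit
    \<open>smooth_affine\<close>. Each factor vanishes on one side, so the product lives on (-1,
    1).\<close>
  define b0 where "b0 x = e (1 * x + 1) * e (- 1 * x + 1)" for x
  have sb0: "smooth b0"
    unfolding b0_def e_def by (intro smooth_mult smooth_affine smooth_exp_inv_poly)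
  have b0_nonneg: "0 \<le> b0 x" for x
    by (auto simp: b0_def e_def exp_inv_poly_def)
  have b0_zero: "b0 x = 0" if "\<bar>x\<bar> \<ge> 1" for x
    using that by (auto simp: b0_def e_def exp_inv_poly_def)
  have b0_pos: "0 < b0 x" if "\<bar>x\<bar> < 1" for x
    using that by (auto simp: b0_def e_def exp_inv_poly_def)
  obtain B0 where B0: "\<And>x. (B0 has_real_derivative b0 x) (at x)" "B0 (-1) = 0"
    using antiderivative_real[OF smooth_continuous[OF sb0]] by blast
  have B0_mono: "B0 x \<le> B0 y" if "x \<le> y" for x y
    using B0(1) b0_nonneg by (intro DERIV_nonneg_imp_nondecreasing[OF that]) blast
  have B0_left: "B0 x = 0" if "x \<le> -1" for x
    using DERIV_zero_eq[OF that B0(1)] b0_zero B0(2) by simp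
  define Z where "Z = B0 1"
  have B0_right: "B0 x = Z" if "x \<ge> 1" for x
    using DERIV_zero_eq[OF that B0(1)] b0_zero by (simp add: Z_def)
  have "B0 (-1) < B0 1"
  proof (rule DERIV_pos_imp_increasing_open[where f = B0])
    show "\<exists>d. (B0 has_real_derivative d) (at x) \<and> 0 < d" if "-1 < x" "x < 1" for x
      using B0(1)[of x] b0_pos[of x] that by (intro exI[of _ "b0 x"]) auto
    show "continuous_on {-1..1} B0"
      using B0(1) DERIV_isCont by (intro continuous_at_imp_continuous_on) blast
  qed simp
  then have Z: "Z > 0" by (simp add: B0 Z_def)
  define b where "b x = (1 / Z) * b0 x" for x
  define B where "B x = (1 / Z) * B0 x" for x
  have Bd: "(B has_real_derivative b x) (at x)" for x
    unfolding B_def b_def using B0(1) by (rule DERIV_cmult)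
  have sb: "smooth b"
    unfolding b_def by (rule smooth_cmult[OF sb0])
  have sB: "smooth B"
    by (rule smooth_antideriv[OF sb Bd])
  obtain B2 where B2: "\<And>x. (B2 has_real_derivative B x) (at x)" "B2 (-1) = 0"
    using antiderivative_real[OF smooth_continuous[OF sB]] by blast
  have sB2: "smooth B2"
    by (rule smooth_antideriv[OF sB B2(1)])
  have B_left: "B x = 0" if "x \<le> -1" for x
    using B0_left[OF that] by (simp add: B_def)
  have B_right: "B x = 1" if "x \<ge> 1" for x
    using B0_right[OF that] Z by (simp add: B_def)
  have B_nonneg: "0 \<le> B x" for x
    using B0_mono[of "-1" x] B0_left[of x] Z B0(2) by (cases "x \<le> -1") (auto simp: B_def)
  have B_le: "B x \<le> 1" for x
    using B0_mono[of x 1] B0_right[of x] Z by (cases "x \<ge> 1") (auto simp: B_def Z_def)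
  have B2_left: "B2 x = 0" if "x \<le> -1" for x
    using DERIV_zero_eq[OF that B2(1)] B_left B2(2) by simp
  have B2_right: "B2 x = x + (B2 1 - 1)" if "x \<ge> 1" for x
  proof -
    have "((\<lambda>x. B2 x - x) has_real_derivative B x - 1) (at x)" for x
      using B2(1) by (auto intro!: derivative_eq_intros)
    from DERIV_zero_eq[OF that this] B_right show ?thesis by simp
  qed
  show thesis
  proof (rule that[of b B B2 "B2 1 - 1"])
    show "0 \<le> b x" for x
      using b0_nonneg[of x] Z by (simp add: b_def)
    show "b x = 0" if "\<bar>x\<bar> \<ge> 1" for x
      using b0_zero[OF that] by (simp add: b_def)
  qed (fact sb sB sB2 Bd B_nonneg B_le B_left B_right B2 B2_left B2_right)+
qed

section \<open>Test functions, weak derivatives and the Lipschitz bound\<close>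

lemma test_functionI:
  assumes "smooth f" and "\<And>x. \<bar>x\<bar> > r \<Longrightarrow> f x = 0"
  shows "test_function f"
proof -
  have "{x. f x \<noteq> 0} \<subseteq> {-r..r}"
  proof
    fix x assume "x \<in> {x. f x \<noteq> 0}"
    then have "\<not> \<bar>x\<bar> > r"
      using assms(2) by auto
    then show "x \<in> {-r..r}" by auto
  qed
  then have "bounded (closure {x. f x \<noteq> 0})"
    by (rule bounded_closure[OF bounded_subset[OF bounded_closed_interval]])
  then show ?thesis
    using assms(1) by (simp add: test_function_def smooth_def compact_eq_bounded_closed)
qed

text \<open>The witness \<open>u\<close> from \<open>H2\<close> need not be the function that
  \<open>SOME\<close> picks, so the second derivative has to be transferred to the picked one.
  Against the derivative of a test function, itself a test function, both have the same integral,
  because either way the derivative moves back to \<open>g\<close>.\<close>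

lemma weak_deriv_H2:
  assumes "g \<in> H2"
  shows "weak_deriv g \<in> L2" "has_weak_deriv g (weak_deriv g)"
    "weak_deriv (weak_deriv g) \<in> L2" "has_weak_deriv (weak_deriv g) (weak_deriv (weak_deriv g))"
proof -
  obtain u v where u: "u \<in> L2" "has_weak_deriv g u" and v: "v \<in> L2" "has_weak_deriv u v"
    using assms by (auto simp: H2_def)
  have g: "weak_deriv g \<in> L2 \<and> has_weak_deriv g (weak_deriv g)"
    unfolding weak_deriv_def by (rule someI[of _ u]) (use u in auto)
  have "has_weak_deriv (weak_deriv g) v"
    unfolding has_weak_deriv_def
  proof (intro allI impI)
    fix \<phi> assume \<phi>: "test_function \<phi>"
    have "{x. deriv \<phi> x \<noteq> 0} \<subseteq> closure {x. \<phi> x \<noteq> 0}"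
    proof (rule ccontr)
      assume "\<not> ?thesis"
      then obtain x where x: "deriv \<phi> x \<noteq> 0" "x \<notin> closure {x. \<phi> x \<noteq> 0}" by auto
      have "eventually (\<lambda>y. y \<in> - closure {x. \<phi> x \<noteq> 0}) (nhds x)"
        using x by (intro eventually_nhds_in_open) auto
      then have "eventually (\<lambda>y. \<phi> y = 0) (nhds x)"
        by eventually_elim (use closure_subset[of "{x. \<phi> x \<noteq> 0}"] in auto)
      then have "deriv \<phi> x = deriv (\<lambda>y. 0) x"
        by (rule deriv_cong_ev) simp
      with x show False by simp
    qed
    then have "bounded (closure {x. deriv \<phi> x \<noteq> 0})"
      using \<phi> bounded_closure bounded_subset
      unfolding test_function_def compact_eq_bounded_closed by blast
    then have "compact (closure {x. deriv \<phi> x \<noteq> 0})"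
      by (simp add: compact_eq_bounded_closed)
    moreover have "smooth (deriv \<phi>)"
      using \<phi> by (intro smooth_deriv) (simp add: test_function_def smooth_def)
    ultimately have d\<phi>: "test_function (deriv \<phi>)"
      by (simp add: test_function_def smooth_def)
    have "(LINT x|lborel. weak_deriv g x * deriv \<phi> x) = - (LINT x|lborel. g x * deriv (deriv \<phi>) x)"
      using g d\<phi> by (simp add: has_weak_deriv_def)
    also have "\<dots> = (LINT x|lborel. u x * deriv \<phi> x)"
      using u(2) d\<phi> by (simp add: has_weak_deriv_def)
    finally have "(LINT x|lborel. weak_deriv g x * deriv \<phi> x) = (LINT x|lborel. u x * deriv \<phi> x)" .
    then show "(LINT x|lborel. weak_deriv g x * deriv \<phi> x) = - (LINT x|lborel. v x * \<phi> x)"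
      using v(2) \<phi> by (simp add: has_weak_deriv_def)
  qed
  then have gg: "weak_deriv (weak_deriv g) \<in> L2 \<and>
      has_weak_deriv (weak_deriv g) (weak_deriv (weak_deriv g))"
    unfolding weak_deriv_def[of "weak_deriv g"]
    by (rule someI[of "\<lambda>w. w \<in> L2 \<and> has_weak_deriv (weak_deriv g) w", OF conjI[OF v(1)]])
  from g gg show "weak_deriv g \<in> L2" "has_weak_deriv g (weak_deriv g)"
    "weak_deriv (weak_deriv g) \<in> L2" "has_weak_deriv (weak_deriv g) (weak_deriv (weak_deriv g))"
    by blast+
qed

lemma L2_norm_sq: "(L2_norm h)\<^sup>2 = (LINT x|lborel. (h x)\<^sup>2)"
  by (simp add: L2_norm_def integral_nonneg_AE)

lemma L2_norms_le_H2_norm: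
  "(L2_norm (weak_deriv g))\<^sup>2 \<le> (H2_norm g)\<^sup>2"
  "(L2_norm (weak_deriv (weak_deriv g)))\<^sup>2 \<le> (H2_norm g)\<^sup>2"
  by (simp_all add: H2_norm_def)

text \<open>The elementary |u f| \<le> (u^2 + f^2) / 2 takes the place of the Cauchy-Schwarz
  inequality; a bound that is quadratic in the norm suffices for a Lipschitz constant depending on
  the norm and the support.\<close>

lemma L2_mult_bound:
  assumes u: "u \<in> L2" and f: "continuous_on UNIV f"
    and supp: "\<And>x. \<bar>x\<bar> > r \<Longrightarrow> f x = 0" and bound: "\<And>x. \<bar>f x\<bar> \<le> B" and "0 \<le> r"
  shows "integrable lborel (\<lambda>x. u x * f x)"
    and "\<bar>LINT x|lborel. u x * f x\<bar> \<le> (L2_norm u)\<^sup>2 + B\<^sup>2 * r"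
proof -
  have um [measurable]: "u \<in> borel_measurable borel" and ui: "integrable lborel (\<lambda>x. (u x)\<^sup>2)"
    using u by (auto simp: L2_def)
  have fm [measurable]: "f \<in> borel_measurable borel"
    using f by (rule borel_measurable_continuous_onI)
  have ind: "integrable lborel (\<lambda>x. B\<^sup>2 * indicator {-r..r} x :: real)"
    by (intro integrable_mult_right integrable_real_indicator) (simp_all add: emeasure_lborel_Icc_eq)
  have pt: "\<bar>u x * f x\<bar> \<le> ((u x)\<^sup>2 + B\<^sup>2 * indicator {-r..r} x) / 2" for x
  proof -
    have "\<bar>u x * f x\<bar> \<le> ((u x)\<^sup>2 + (f x)\<^sup>2) / 2"
      using sum_squares_bound[of "\<bar>u x\<bar>" "\<bar>f x\<bar>"] by (simp add: abs_mult)
    moreover have "(f x)\<^sup>2 \<le> B\<^sup>2 * indicator {-r..r} x"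
    proof (cases "\<bar>x\<bar> > r")
      case False
      then have "(f x)\<^sup>2 \<le> B\<^sup>2"
        using power_mono[OF bound[of x], of 2] by simp
      then show ?thesis using False by (auto simp: indicator_def)
    qed (use supp in auto)
    ultimately show ?thesis by simp
  qed
  have i: "integrable lborel (\<lambda>x. ((u x)\<^sup>2 + B\<^sup>2 * indicator {-r..r} x) / 2)"
    using ui ind by simp
  show int: "integrable lborel (\<lambda>x. u x * f x)"
    by (rule Bochner_Integration.integrable_bound[OF i]) (use pt in \<open>auto intro: order_trans\<close>)
  have "\<bar>LINT x|lborel. u x * f x\<bar> \<le> (LINT x|lborel. ((u x)\<^sup>2 + B\<^sup>2 * indicator {-r..r} x) / 2)"
    using integral_abs_bound[of lborel "\<lambda>x. u x * f x"]
      integral_mono[OF integrable_abs[OF int] i pt] by linarith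
  also have "\<dots> = ((L2_norm u)\<^sup>2 + B\<^sup>2 * (2 * r)) / 2"
    using ui \<open>0 \<le> r\<close> by (simp add: L2_norm_sq)
  also have "\<dots> \<le> (L2_norm u)\<^sup>2 + B\<^sup>2 * r"
    by simp
  finally show "\<bar>LINT x|lborel. u x * f x\<bar> \<le> (L2_norm u)\<^sup>2 + B\<^sup>2 * r" .
qed

text \<open>
  Testing \<open>g\<close> against the difference of two bumps at \<open>x\<close> and \<open>y\<close> gives \<open>- \<integral> u \<Phi>\<close> with \<open>\<Phi>\<close> close to the indicator
  of \<open>[x, y]\<close>; subtracting \<open>(y - x) b\<close> for a fixed bump \<open>b\<close> leaves the derivative of a test function of size \<open>y - x\<close>.
\<close>

lemma H2_Lipschitz:
  fixes K R :: real
  shows "\<exists>L\<ge>0. \<forall>g. g \<in> H2 \<longrightarrow> continuous_on UNIV g \<longrightarrow> H2_norm g \<le> K \<longrightarrow>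
    closure {x. g x \<noteq> 0} \<subseteq> {-R..R} \<longrightarrow> (\<forall>x y. \<bar>g x - g y\<bar> \<le> L * \<bar>x - y\<bar>)"
proof -
  obtain b B B2 :: "real \<Rightarrow> real" and k
    where sb: "smooth b" and sB: "smooth B" and sB2: "smooth B2"
      and b: "\<And>x. 0 \<le> b x" "\<And>x. \<bar>x\<bar> \<ge> 1 \<Longrightarrow> b x = 0"
      and Bd: "\<And>x. (B has_real_derivative b x) (at x)"
      and B_bounds: "\<And>x. 0 \<le> B x" "\<And>x. B x \<le> 1"
      and B_left: "\<And>x. x \<le> -1 \<Longrightarrow> B x = 0" and B_right: "\<And>x. x \<ge> 1 \<Longrightarrow> B x = 1"
      and B2d: "\<And>x. (B2 has_real_derivative B x) (at x)"
      and B2_left: "\<And>x. x \<le> -1 \<Longrightarrow> B2 x = 0" and B2_right: "\<And>x. x \<ge> 1 \<Longrightarrow> B2 x = x + k"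
    using bump_step_ramp by blast
  have b_int: "has_bochner_integral lborel b 1"
  proof -
    have "(b has_integral (B 1 - B (-1))) {-1..1}"
      using Bd by (intro fundamental_theorem_of_calculus)
        (auto simp: has_real_derivative_iff_has_vector_derivative intro: has_vector_derivative_at_within)
    then have "(b has_integral 1) {-1..1}"
      by (simp add: B_left B_right)
    then have b1: "(b has_integral 1) UNIV"
    proof (rule has_integral_on_superset)
      show "b x = 0" if "x \<notin> {-1..1}" for x
        using that by (intro b(2)) auto
    qed simp
    have bm: "b \<in> borel_measurable borel"
      using smooth_continuous[OF sb, of UNIV] by (rule borel_measurable_continuous_onI)
    show ?thesis
    proof (rule has_bochner_integral_nn_integral)
      show "integral\<^sup>N lborel (\<lambda>x. ennreal (b x)) = ennreal 1"
        by (rule nn_integral_has_integral_lborel[OF bm b(1) b1])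
    qed (use bm b(1) in simp_all)
  qed
  obtain Mb where Mb: "\<And>x. \<bar>b x\<bar> \<le> Mb"
  proof -
    have "compact (b ` {-1..1})"
      by (intro compact_continuous_image smooth_continuous[OF sb]) simp
    then obtain M where M: "\<And>x. x \<in> {-1..1} \<Longrightarrow> \<bar>b x\<bar> \<le> M"
      by (metis compact_imp_bounded bounded_iff imageI real_norm_def)
    have "\<bar>b x\<bar> \<le> max M 0" for x
      using M[of x] b(2)[of x] by (cases "x \<in> {-1..1}") (auto simp: max_def abs_if split: if_splits)
    then show thesis by (rule that)
  qed
  \<comment> \<open>Centres satisfy |z| \<le> |R| + 1 and half-widths are at most 1, so all test
    functions below vanish beyond \<open>r\<close>. The constant \<open>L\<close> adds up two
    instances of \<open>L2_mult_bound\<close>: the integral of \<open>u\<close> against the fixed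
    bump, of size \<open>Mb\<close>, and that of \<open>v\<close> against \<open>\<psi>\<close>, of
    size 1.\<close>
  define r where "r = \<bar>R\<bar> + 3"
  define L where "L = K\<^sup>2 + Mb\<^sup>2 * r + (K\<^sup>2 + 1\<^sup>2 * r)"
  have "0 \<le> L" unfolding L_def r_def by (intro add_nonneg_nonneg mult_nonneg_nonneg) auto
  have main: "\<bar>g x - g y\<bar> \<le> L * \<bar>x - y\<bar>"
    if g: "g \<in> H2" "continuous_on UNIV g" "H2_norm g \<le> K" "closure {x. g x \<noteq> 0} \<subseteq> {-R..R}"
      and xy: "x < y" "\<bar>x\<bar> \<le> \<bar>R\<bar> + 1" "\<bar>y\<bar> \<le> \<bar>R\<bar> + 1" for g x y
  proof -
    define u where "u = weak_deriv g"
    define v where "v = weak_deriv u"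
    have u: "u \<in> L2" "has_weak_deriv g u" and v: "v \<in> L2" "has_weak_deriv u v"
      using weak_deriv_H2[OF g(1)] by (auto simp: u_def v_def)
    have "(H2_norm g)\<^sup>2 \<le> K\<^sup>2"
      using g(3) by (intro power_mono) (auto simp: H2_norm_def)
    then have uK: "(L2_norm u)\<^sup>2 \<le> K\<^sup>2" and vK: "(L2_norm v)\<^sup>2 \<le> K\<^sup>2"
      using L2_norms_le_H2_norm[of g] by (auto simp: u_def v_def)
    \<comment> \<open>A bump of mass one and half-width \<open>d\<close> at \<open>z\<close>, then
      its primitive, then the primitive of that.\<close>
    define bs where "bs d z t = b ((1 / d) * t + (- z / d)) / d" for d z t :: real
    define Bs where "Bs d z t = B ((1 / d) * t + (- z / d))" for d z t :: real
    define B2s where "B2s d z t = d * B2 ((1 / d) * t + (- z / d))" for d z t :: real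
    have est: "\<bar>(LINT t|lborel. g t * (bs d x t - bs d y t))\<bar> \<le> L * (y - x)"
      if d: "0 < d" "d \<le> 1" for d
    proof -
      have arg: "(1 / d) * t + (- z / d) = (t - z) / d" for t z
        using d by (simp add: field_simps)
      have lin: "((\<lambda>t. (1 / d) * t + (- z / d)) has_real_derivative 1 / d) (at t)" for z t
        using d by (auto intro!: derivative_eq_intros)
      have Bs_d: "(Bs d z has_real_derivative bs d z t) (at t)" for z t
        unfolding Bs_def bs_def using DERIV_chain2[OF Bd lin] by simp
      have B2s_d: "(B2s d z has_real_derivative Bs d z t) (at t)" for z t
        unfolding B2s_def Bs_def using DERIV_cmult[OF DERIV_chain2[OF B2d lin], of d z t] d by simp
      have Bs_left: "Bs d z t = 0" if "t \<le> z - d" for z t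
        unfolding Bs_def arg by (rule B_left) (use that d in \<open>simp add: field_simps\<close>)
      have Bs_right: "Bs d z t = 1" if "t \<ge> z + d" for z t
        unfolding Bs_def arg by (rule B_right) (use that d in \<open>simp add: field_simps\<close>)
      have B2s_left: "B2s d z t = 0" if "t \<le> z - d" for z t
        unfolding B2s_def arg by (subst B2_left) (use that d in \<open>simp_all add: field_simps\<close>)
      have B2s_right: "B2s d z t = t - z + d * k" if "t \<ge> z + d" for z t
        unfolding B2s_def arg by (subst B2_right) (use that d in \<open>simp_all add: field_simps\<close>)
      define \<Phi> where "\<Phi> t = Bs d x t - Bs d y t" for t
      \<comment> \<open>Right of the two steps the ramp difference equals \<open>y - x\<close>;
        after scaling it is cancelled by the smooth step \<open>B\<close>, so \<open>\<psi>\<close>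
        has compact support. Its derivative is \<Phi> / (y - x) - b, and testing \<open>u\<close>
        against it expresses the integral of u \<Phi> as y - x times bounded quantities.\<close>
      define \<psi> where "\<psi> t = (1 / (y - x)) * (B2s d x t - B2s d y t) - B t" for t
      have s\<Phi>: "smooth \<Phi>"
        unfolding \<Phi>_def Bs_def by (intro smooth_diff smooth_affine sB)
      have s\<psi>: "smooth \<psi>"
        unfolding \<psi>_def B2s_def by (intro smooth_diff smooth_affine smooth_cmult sB2 sB)
      have supp\<Phi>: "\<Phi> t = 0" if "\<bar>t\<bar> > r" for t
      proof (cases "t \<ge> 0")
        case True
        then show ?thesis
          using that xy d Bs_right[of x t] Bs_right[of y t] by (simp add: \<Phi>_def r_def)
      next
        case False
        then show ?thesis
          using that xy d Bs_left[of t x] Bs_left[of t y] by (simp add: \<Phi>_def r_def)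
      qed
      have supp\<psi>: "\<psi> t = 0" if "\<bar>t\<bar> > r" for t
      proof (cases "t \<ge> 0")
        case True
        then show ?thesis
          using that xy d B2s_right[of x t] B2s_right[of y t] B_right[of t] by (simp add: \<psi>_def r_def)
      next
        case False
        then show ?thesis
          using that xy d B2s_left[of t x] B2s_left[of t y] B_left[of t] by (simp add: \<psi>_def r_def)
      qed
      have d\<Phi>: "deriv \<Phi> = (\<lambda>t. bs d x t - bs d y t)"
        unfolding \<Phi>_def by (intro ext DERIV_imp_deriv DERIV_diff Bs_d)
      have d\<psi>: "deriv \<psi> = (\<lambda>t. (1 / (y - x)) * \<Phi> t - b t)"
        unfolding \<psi>_def \<Phi>_def by (intro ext DERIV_imp_deriv DERIV_diff DERIV_cmult B2s_d Bd)
      have b\<psi>: "\<bar>\<psi> t\<bar> \<le> 1" for t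
      proof -
        \<comment> \<open>The two ramps are translates of each other by \<open>y - x\<close> and
          have slopes in [0, 1], so their scaled difference lies in [0, 1], as does
          \<open>B t\<close>.\<close>
        have s: "B2s d y t = B2s d x (t - (y - x))"
          unfolding B2s_def arg by simp
        have "B2s d x (t - (y - x)) \<le> B2s d x t"
        proof (rule DERIV_nonneg_imp_nondecreasing[where f = "B2s d x"])
          show "\<exists>w. (B2s d x has_real_derivative w) (at z) \<and> 0 \<le> w" for z
            using B2s_d[of x z] B_bounds(1) by (intro exI[of _ "Bs d x z"]) (simp add: Bs_def)
        qed (use xy in simp)
        moreover have "B2s d x t - t \<le> B2s d x (t - (y - x)) - (t - (y - x))"
        proof (rule DERIV_nonpos_imp_nonincreasing[where f = "\<lambda>t. B2s d x t - t"])
          fix z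
          have "((\<lambda>t. B2s d x t - t) has_real_derivative Bs d x z - 1) (at z)"
            by (intro DERIV_diff B2s_d DERIV_ident)
          then show "\<exists>w. ((\<lambda>t. B2s d x t - t) has_real_derivative w) (at z) \<and> w \<le> 0"
            using B_bounds(2) by (intro exI[of _ "Bs d x z - 1"]) (simp add: Bs_def)
        qed (use xy in simp)
        ultimately have "0 \<le> (1 / (y - x)) * (B2s d x t - B2s d y t)"
          and "(1 / (y - x)) * (B2s d x t - B2s d y t) \<le> 1"
          using xy by (simp_all add: s divide_simps)
        then show ?thesis
          using B_bounds[of t] by (simp add: \<psi>_def abs_le_iff)
      qed
      have test: "test_function \<Phi>" "test_function \<psi>"
        using test_functionI s\<Phi> s\<psi> supp\<Phi> supp\<psi> by blast+
      have r: "0 \<le> r" "1 \<le> r" by (simp_all add: r_def)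
      have \<Phi>_bound: "\<bar>\<Phi> t\<bar> \<le> 1" for t
        unfolding \<Phi>_def Bs_def
        using B_bounds(1)[of "1 / d * t + - x / d"] B_bounds(2)[of "1 / d * t + - x / d"]
          B_bounds(1)[of "1 / d * t + - y / d"] B_bounds(2)[of "1 / d * t + - y / d"]
        unfolding abs_le_iff by linarith
      have int\<Phi>: "integrable lborel (\<lambda>t. u t * \<Phi> t)"
        by (rule L2_mult_bound(1)[OF u(1) smooth_continuous[OF s\<Phi>] supp\<Phi> \<Phi>_bound r(1)])
      have suppb: "b t = 0" if "\<bar>t\<bar> > r" for t
        using that b(2)[of t] r by simp
      note ub = L2_mult_bound[OF u(1) smooth_continuous[OF sb] suppb Mb r(1)]
      note v\<psi> = L2_mult_bound(2)[OF v(1) smooth_continuous[OF s\<psi>] supp\<psi> b\<psi> r(1)]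
      have "(LINT t|lborel. u t * ((1 / (y - x)) * \<Phi> t - b t)) = - (LINT t|lborel. v t * \<psi> t)"
        using v(2)[unfolded has_weak_deriv_def, rule_format, OF test(2)] unfolding d\<psi> .
      moreover have "(LINT t|lborel. u t * ((1 / (y - x)) * \<Phi> t - b t)) =
          (1 / (y - x)) * (LINT t|lborel. u t * \<Phi> t) - (LINT t|lborel. u t * b t)"
        using int\<Phi> ub(1) by (simp add: right_diff_distrib)
      ultimately have "(1 / (y - x)) * (LINT t|lborel. u t * \<Phi> t) =
          (LINT t|lborel. u t * b t) - (LINT t|lborel. v t * \<psi> t)"
        by simp
      then have "(LINT t|lborel. u t * \<Phi> t) =
          ((LINT t|lborel. u t * b t) - (LINT t|lborel. v t * \<psi> t)) * (y - x)"
        using xy by (simp add: field_simps)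
      then have "\<bar>(LINT t|lborel. u t * \<Phi> t)\<bar> =
          \<bar>(LINT t|lborel. u t * b t) - (LINT t|lborel. v t * \<psi> t)\<bar> * (y - x)"
        using xy by (simp add: abs_mult)
      also have "\<dots> \<le> L * (y - x)"
        using ub(2) v\<psi> uK vK xy unfolding L_def by (intro mult_right_mono) linarith+
      finally have "\<bar>(LINT t|lborel. u t * \<Phi> t)\<bar> \<le> L * (y - x)" .
      moreover have "(LINT t|lborel. g t * (bs d x t - bs d y t)) = - (LINT t|lborel. u t * \<Phi> t)"
        using u(2)[unfolded has_weak_deriv_def, rule_format, OF test(1)] unfolding d\<Phi> .
      ultimately show ?thesis by simp
    qed
    \<comment> \<open>Approximate identity: \<open>bs d z\<close> has mass one and lives within
      distance \<open>d\<close> of \<open>z\<close>, so the error is at most the oscillation of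
      \<open>g\<close> there.\<close>
    have close: "\<bar>(LINT t|lborel. g t * bs d z t) - g z\<bar> \<le> e"
      and gint: "integrable lborel (\<lambda>t. g t * bs d z t)"
      if d: "0 < d" and e: "\<And>t. \<bar>t - z\<bar> < d \<Longrightarrow> \<bar>g t - g z\<bar> \<le> e" for d z e
    proof -
      have [measurable]: "g \<in> borel_measurable borel" "b \<in> borel_measurable borel"
        using g(2) smooth_continuous[OF sb] by (auto intro: borel_measurable_continuous_onI)
      have bsi: "has_bochner_integral lborel (bs d z) 1"
      proof -
        have "has_bochner_integral lborel (\<lambda>t. b ((- z / d) + (1 / d) * t)) (1 /\<^sub>R \<bar>1 / d\<bar>)"
          using d b_int by (intro lborel_has_bochner_integral_real_affine_iff[THEN iffD1]) auto
        then have "has_bochner_integral lborel (\<lambda>t. b ((- z / d) + (1 / d) * t) * (1 / d)) ((1 /\<^sub>R \<bar>1 / d\<bar>) * (1 / d))"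
          by (rule has_bochner_integral_mult_left)
        then show ?thesis
          using d by (simp add: bs_def[abs_def] add.commute)
      qed
      have bs0: "0 \<le> bs d z t" for t
        using b(1) d by (simp add: bs_def)
      have e0: "0 \<le> e" using e[of z] d by simp
      have pt: "\<bar>(g t - g z) * bs d z t\<bar> \<le> e * bs d z t" for t
      proof (cases "\<bar>t - z\<bar> < d")
        case True
        then show ?thesis
          using e[OF True] bs0[of t] by (simp add: abs_mult mult_right_mono)
      next
        case False
        have "1 / d * t + - z / d = (t - z) / d" using d by (simp add: field_simps)
        then have "\<bar>1 / d * t + - z / d\<bar> \<ge> 1" using False d by (simp add: field_simps abs_divide)
        then show ?thesis using b(2) by (simp add: bs_def)
      qed
      have i1: "integrable lborel (bs d z)" "(LINT t|lborel. bs d z t) = 1"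
        using bsi by (auto simp: has_bochner_integral_iff)
      have i2: "integrable lborel (\<lambda>t. (g t - g z) * bs d z t)"
      proof (rule Bochner_Integration.integrable_bound)
        show "integrable lborel (\<lambda>t. e * bs d z t)" using i1 by simp
        show "AE t in lborel. norm ((g t - g z) * bs d z t) \<le> norm (e * bs d z t)"
          using pt e0 bs0 by (auto simp: abs_mult intro: order_trans)
      qed (simp add: bs_def[abs_def])
      have eq: "(\<lambda>t. g t * bs d z t) = (\<lambda>t. (g t - g z) * bs d z t + g z * bs d z t)"
        by (simp add: algebra_simps)
      show "integrable lborel (\<lambda>t. g t * bs d z t)"
        unfolding eq using i1 i2 by simp
      have "(LINT t|lborel. g t * bs d z t) - g z = (LINT t|lborel. (g t - g z) * bs d z t)"
        unfolding eq using i1 i2 by simp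
      also have "\<bar>\<dots>\<bar> \<le> (LINT t|lborel. e * bs d z t)"
        using integral_abs_bound[of lborel "\<lambda>t. (g t - g z) * bs d z t"]
          integral_mono[OF integrable_abs[OF i2] integrable_mult_right[OF i1(1)] pt] by (rule order_trans)
      also have "\<dots> = e" using i1 by simp
      finally show "\<bar>(LINT t|lborel. g t * bs d z t) - g z\<bar> \<le> e" .
    qed
    have "\<bar>g x - g y\<bar> \<le> L * (y - x) + e" if "e > 0" for e
    proof -
      have cont: "\<exists>d>0. \<forall>t. \<bar>t - z\<bar> < d \<longrightarrow> \<bar>g t - g z\<bar> < e / 2" for z
      proof -
        have "\<forall>e>0. \<exists>d>0. \<forall>t\<in>UNIV. dist t z < d \<longrightarrow> dist (g t) (g z) < e"
          using g(2) unfolding continuous_on_iff by blast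
        from this[rule_format, of "e / 2"] show ?thesis
          using that by (auto simp: dist_real_def)
      qed
      obtain d1 d2 where d: "d1 > 0" "d2 > 0"
        "\<And>t. \<bar>t - x\<bar> < d1 \<Longrightarrow> \<bar>g t - g x\<bar> < e / 2" "\<And>t. \<bar>t - y\<bar> < d2 \<Longrightarrow> \<bar>g t - g y\<bar> < e / 2"
        using cont[of x] cont[of y] by blast
      define d where "d = min 1 (min d1 d2)"
      have d0: "0 < d" "d \<le> 1" using d by (auto simp: d_def)
      have ex: "\<bar>g t - g x\<bar> \<le> e / 2" if "\<bar>t - x\<bar> < d" for t
        using d(3)[of t] that by (simp add: d_def)
      have ey: "\<bar>g t - g y\<bar> \<le> e / 2" if "\<bar>t - y\<bar> < d" for t
        using d(4)[of t] that by (simp add: d_def)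
      have "(LINT t|lborel. g t * (bs d x t - bs d y t)) =
          (LINT t|lborel. g t * bs d x t) - (LINT t|lborel. g t * bs d y t)"
        using gint[OF d0(1) ex] gint[OF d0(1) ey] by (simp add: right_diff_distrib)
      then show ?thesis
        using est[OF d0] close[OF d0(1) ex] close[OF d0(1) ey] by linarith
    qed
    then have "\<bar>g x - g y\<bar> \<le> L * (y - x)"
      by (rule field_le_epsilon)
    then show ?thesis using xy by simp
  qed
  show ?thesis
  proof (intro exI[of _ L] conjI allI impI)
    fix g x y
    assume g: "g \<in> H2" "continuous_on UNIV g" "H2_norm g \<le> K" "closure {x. g x \<noteq> 0} \<subseteq> {-R..R}"
    \<comment> \<open>\<open>main\<close> covers bounded points only. Clamping to
      [-|R| - 1, |R| + 1] changes no value of \<open>g\<close>, which vanishes beyond |R|, and does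
      not increase distances.\<close>
    define cl where "cl t = max (- \<bar>R\<bar> - 1) (min (\<bar>R\<bar> + 1) t)" for t :: real
    have cl: "g (cl t) = g t" for t
    proof (cases "\<bar>t\<bar> \<le> \<bar>R\<bar> + 1")
      case True
      then show ?thesis by (simp add: cl_def abs_le_iff)
    next
      case False
      have z: "g t = 0" if "\<bar>t\<bar> > \<bar>R\<bar>" for t
        using g(4) closure_subset[of "{x. g x \<noteq> 0}"] that by force
      show ?thesis
      proof -
        have "\<bar>cl t\<bar> > \<bar>R\<bar>" using False by (auto simp: cl_def max_def min_def)
        then show ?thesis using z[of t] z[of "cl t"] False by simp
      qed
    qed
    have bd: "\<bar>cl t\<bar> \<le> \<bar>R\<bar> + 1" for t by (auto simp: cl_def abs_le_iff)
    have "\<bar>g (cl x) - g (cl y)\<bar> \<le> L * \<bar>cl x - cl y\<bar>"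
      using main[OF g, of "cl x" "cl y"] main[OF g, of "cl y" "cl x"] bd
      by (cases "cl x" "cl y" rule: linorder_cases) (simp_all add: abs_minus_commute)
    also have "\<dots> \<le> L * \<bar>x - y\<bar>"
      using \<open>0 \<le> L\<close> by (intro mult_left_mono) (auto simp: cl_def max_def min_def)
    finally show "\<bar>g x - g y\<bar> \<le> L * \<bar>x - y\<bar>"
      by (simp add: cl)
  qed (fact \<open>0 \<le> L\<close>)
qed

section \<open>Integration on the line and in the plane\<close>

lemma nn_integral_sqrt_substitution:
  fixes f :: "real \<Rightarrow> ennreal"
  assumes [measurable]: "f \<in> borel_measurable borel" and c: "0 < c"
  shows "(\<integral>\<^sup>+u. f u * indicator {0<..} u \<partial>lborel) =
    (\<integral>\<^sup>+t. f (sqrt (t / c)) * ennreal (1 / (2 * sqrt (c * t))) * indicator {0<..} t \<partial>lborel)"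
proof -
  \<comment> \<open>The derivative 1 / (2 sqrt (c t)) is singular at 0 and the half-line is
    unbounded, so the substitution is made on compact intervals exhausting it, followed by monotone
    convergence. The shift by 2 gives \<open>a n < b n\<close> already for n = 0.\<close>
  define a where "a n = 1 / (real n + 2)" for n
  define b where "b n = real n + 2" for n
  have a0: "0 < a n" for n by (simp add: a_def)
  have ab: "a n < b n" for n
    by (rule order.strict_trans[of _ 1]) (simp_all add: a_def b_def)
  have a_dec: "a n \<le> a m" if "m \<le> n" for m n using that by (simp add: a_def frac_le)
  have b_inc: "b m \<le> b n" if "m \<le> n" for m n using that by (simp add: b_def)
  have ev: "\<forall>\<^sub>F n in sequentially. t \<in> {a n..b n}" if "0 < t" for t
  proof -
    obtain N where N: "max t (1 / t) < real N" using reals_Archimedean2 by blast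
    show ?thesis
    proof (rule eventually_sequentiallyI[of N])
      fix n assume "N \<le> n"
      then have n: "t < real n" "1 / t < real n" using N by auto
      have "1 / (real n + 2) \<le> t"
        using n that by (simp add: field_simps)
      then show "t \<in> {a n..b n}" using n by (simp add: a_def b_def)
    qed
  qed
  define g where "g t = sqrt (t / c)" for t
  have g_mono: "g s \<le> g t \<longleftrightarrow> s \<le> t" for s t
    using c by (simp add: g_def divide_le_cancel)
  have I: "(\<integral>\<^sup>+u. f u * indicator {g (a n)..g (b n)} u \<partial>lborel) =
      (\<integral>\<^sup>+t. f (g t) * ennreal (1 / (2 * sqrt (c * t))) * indicator {a n..b n} t \<partial>lborel)" for n
  proof (rule nn_integral_substitution_aux)
    show "(g has_real_derivative 1 / (2 * sqrt (c * x))) (at x)" if "x \<in> {a n..b n}" for x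
    proof -
      have x: "0 < x" using that a0[of n] by simp
      have "(g has_real_derivative (1 / c) * (inverse (sqrt (x / c)) / 2)) (at x)"
        unfolding g_def using x c by (auto intro!: derivative_eq_intros simp: divide_less_0_iff)
      moreover have "(1 / c) * (inverse (sqrt (x / c)) / 2) = 1 / (2 * sqrt (c * x))"
        using x c by (simp add: real_sqrt_divide real_sqrt_mult field_simps flip: power2_eq_square)
      ultimately show ?thesis by simp
    qed
    show "continuous_on {a n..b n} (\<lambda>x. 1 / (2 * sqrt (c * x)))"
      using a0[of n] c by (intro continuous_intros) auto
  qed (use ab c a0[of n] in auto)
  have lim1: "(\<lambda>n. \<integral>\<^sup>+u. f u * indicator {g (a n)..g (b n)} u \<partial>lborel) \<longlonglongrightarrow>
      (\<integral>\<^sup>+u. f u * indicator {0<..} u \<partial>lborel)"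
  proof (rule nn_integral_LIMSEQ)
    show "incseq (\<lambda>n u. f u * indicator {g (a n)..g (b n)} u)"
    proof (intro incseq_SucI le_funI mult_left_mono indicator_leI zero_le)
      fix n u assume "u \<in> {g (a n)..g (b n)}"
      moreover have "g (a (Suc n)) \<le> g (a n)" "g (b n) \<le> g (b (Suc n))"
        using a_dec[of n "Suc n"] b_inc[of n "Suc n"] by (simp_all add: g_mono)
      ultimately show "u \<in> {g (a (Suc n))..g (b (Suc n))}" by auto
    qed
    show "(\<lambda>n. f u * indicator {g (a n)..g (b n)} u) \<longlonglongrightarrow> f u * indicator {0<..} u" for u
    proof (cases "0 < u")
      case True
      have gu: "g (c * u\<^sup>2) = u" using c True by (simp add: g_def)
      have "\<forall>\<^sub>F n in sequentially. c * u\<^sup>2 \<in> {a n..b n}"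
        using c True by (intro ev) simp
      then have "\<forall>\<^sub>F n in sequentially. f u * indicator {g (a n)..g (b n)} u = f u * indicator {0<..} u"
        by eventually_elim (use True g_mono gu in \<open>metis (no_types, lifting) atLeastAtMost_iff greaterThan_iff indicator_simps(1)\<close>)
      then show ?thesis by (rule tendsto_eventually)
    next
      case False
      have "0 < g (a n)" for n using a0 c by (simp add: g_def)
      then have "u \<notin> {g (a n)..g (b n)}" for n
        using False by (metis atLeastAtMost_iff not_le order.strict_trans1)
      then show ?thesis using False by simp
    qed
  qed simp
  have lim2: "(\<lambda>n. \<integral>\<^sup>+t. f (g t) * ennreal (1 / (2 * sqrt (c * t))) * indicator {a n..b n} t \<partial>lborel) \<longlonglongrightarrow>
      (\<integral>\<^sup>+t. f (g t) * ennreal (1 / (2 * sqrt (c * t))) * indicator {0<..} t \<partial>lborel)"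
  proof (rule nn_integral_LIMSEQ)
    show "incseq (\<lambda>n t. f (g t) * ennreal (1 / (2 * sqrt (c * t))) * indicator {a n..b n} t)"
    proof (intro incseq_SucI le_funI mult_left_mono indicator_leI zero_le)
      fix n t assume "t \<in> {a n..b n}"
      then show "t \<in> {a (Suc n)..b (Suc n)}"
        using a_dec[of n "Suc n"] b_inc[of n "Suc n"] by auto
    qed
    show "(\<lambda>n. f (g t) * ennreal (1 / (2 * sqrt (c * t))) * indicator {a n..b n} t) \<longlonglongrightarrow>
        f (g t) * ennreal (1 / (2 * sqrt (c * t))) * indicator {0<..} t" for t
    proof (cases "0 < t")
      case True
      from ev[OF this] have "\<forall>\<^sub>F n in sequentially. f (g t) * ennreal (1 / (2 * sqrt (c * t))) * indicator {a n..b n} t =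
         f (g t) * ennreal (1 / (2 * sqrt (c * t))) * indicator {0<..} t"
        by eventually_elim (use True in simp)
      then show ?thesis by (rule tendsto_eventually)
    next
      case False
      then have "t \<notin> {a n..b n}" for n
        using a0[of n] by (metis atLeastAtMost_iff not_le order.strict_trans1)
      then show ?thesis using False by simp
    qed
    show "(\<lambda>t. f (g t) * ennreal (1 / (2 * sqrt (c * t))) * indicator {a n..b n} t) \<in> borel_measurable lborel" for n
      unfolding g_def by measurable
  qed
  show ?thesis
    using LIMSEQ_unique[OF lim1[unfolded I] lim2] by (simp add: g_def)
qed

text \<open>Both half-lines are parametrized by t = c u^2. With c = N^(-a) this passes from the
  variable of \<open>g (- s * x^2)\<close> to the distance from the spectral edge.\<close>

lemma nn_integral_fold_sqrt:
  fixes f :: "real \<Rightarrow> ennreal"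
  assumes [measurable]: "f \<in> borel_measurable borel" and c: "0 < c"
  shows "(\<integral>\<^sup>+u. f u \<partial>lborel) =
    (\<integral>\<^sup>+t. (f (sqrt (t / c)) + f (- sqrt (t / c))) * ennreal (1 / (2 * sqrt (c * t))) * indicator {0<..} t \<partial>lborel)"
proof -
  have "(\<integral>\<^sup>+u. f u \<partial>lborel) =
      (\<integral>\<^sup>+u. f u * indicator {0<..} u + f u * indicator {..<0} u \<partial>lborel)"
    by (intro nn_integral_cong_AE eventually_mono[OF AE_lborel_singleton[of 0]])
      (auto simp: indicator_def)
  also have "\<dots> = (\<integral>\<^sup>+u. f u * indicator {0<..} u \<partial>lborel) + (\<integral>\<^sup>+u. f u * indicator {..<0} u \<partial>lborel)"
    by (rule nn_integral_add) simp_all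
  also have "(\<integral>\<^sup>+u. f u * indicator {..<0} u \<partial>lborel) = (\<integral>\<^sup>+u. f (- u) * indicator {0<..} u \<partial>lborel)"
    by (subst nn_integral_real_affine[where c = "-1" and t = 0])
      (auto simp: indicator_def intro!: nn_integral_cong)
  also have "(\<integral>\<^sup>+u. f u * indicator {0<..} u \<partial>lborel) + (\<integral>\<^sup>+u. f (- u) * indicator {0<..} u \<partial>lborel) =
     (\<integral>\<^sup>+u. (f u + f (- u)) * indicator {0<..} u \<partial>lborel)"
    by (simp add: nn_integral_add distrib_right)
  also have "\<dots> = (\<integral>\<^sup>+t. (f (sqrt (t / c)) + f (- sqrt (t / c))) * ennreal (1 / (2 * sqrt (c * t))) * indicator {0<..} t \<partial>lborel)"
    by (rule nn_integral_sqrt_substitution[OF _ c]) simp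
  finally show ?thesis .
qed

section \<open>Product integrals, affine maps and null sets in the plane\<close>

lemma measurable_fst_borel [measurable]: "fst \<in> borel_measurable (borel :: (real \<times> real) measure)"
  and measurable_snd_borel [measurable]: "snd \<in> borel_measurable (borel :: (real \<times> real) measure)"
  by (intro borel_measurable_continuous_onI continuous_intros)+

lemma integral_product:
  fixes f g :: "real \<Rightarrow> real"
  assumes "integrable lborel f" "integrable lborel g"
  shows "integrable lborel (\<lambda>(x, y). f x * g y)"
    and "(LINT (x, y)|lborel. f x * g y) = (LINT x|lborel. f x) * (LINT y|lborel. g y)"
proof -
  have i: "integrable (lborel \<Otimes>\<^sub>M lborel) (\<lambda>(x, y). f x * g y)"
    using assms by (intro lborel_pair.Fubini_integrable) (auto simp: abs_mult)
  then show "integrable lborel (\<lambda>(x, y). f x * g y)"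
    by (simp add: lborel_prod)
  show "(LINT (x, y)|lborel. f x * g y) = (LINT x|lborel. f x) * (LINT y|lborel. g y)"
    using lborel_pair.integral_fst'[OF i] by (simp add: lborel_prod)
qed

lemma integral_lborel_affine_pair:
  fixes F :: "real \<times> real \<Rightarrow> real"
  assumes [measurable]: "F \<in> borel_measurable borel" and c: "\<bar>c\<bar> = 1"
  shows "(LINT p|lborel. F p) = (LINT p|lborel. F ((t, t) + c *\<^sub>R p))"
    and "integrable lborel F \<longleftrightarrow> integrable lborel (\<lambda>p. F ((t, t) + c *\<^sub>R p))"
proof -
  have "c \<noteq> 0" using c by auto
  then have "lborel = distr lborel borel (\<lambda>x. (t, t) + c *\<^sub>R x :: real \<times> real)"
    using lborel_affine[of c "(t, t)"] c by (simp add: density_1)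
  then have *: "(LINT p|lborel. F p) = (LINT p|distr lborel borel (\<lambda>x. (t, t) + c *\<^sub>R x). F p)"
    "integrable lborel F \<longleftrightarrow> integrable (distr lborel borel (\<lambda>x. (t, t) + c *\<^sub>R x)) F"
    by simp_all
  show "(LINT p|lborel. F p) = (LINT p|lborel. F ((t, t) + c *\<^sub>R p))"
    unfolding *(1) by (rule integral_distr) auto
  show "integrable lborel F \<longleftrightarrow> integrable lborel (\<lambda>p. F ((t, t) + c *\<^sub>R p))"
    unfolding *(2) by (rule integrable_distr_eq) auto
qed

lemma AE_lborel_pair:
  fixes P :: "real \<times> real \<Rightarrow> bool"
  assumes "{p. P p} \<in> sets borel" and "AE x in lborel. AE y in lborel. P (x, y)"
  shows "AE p in lborel. P p"
proof -
  have "AE p in lborel \<Otimes>\<^sub>M lborel. P p"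
  proof (rule lborel_pair.AE_pair_measure)
    show "{p \<in> space (lborel \<Otimes>\<^sub>M lborel). P p} \<in> sets (lborel \<Otimes>\<^sub>M lborel)"
      unfolding lborel_prod using assms(1) by simp
  qed fact
  then show ?thesis unfolding lborel_prod .
qed

lemma AE_generic_pair: "AE p in (lborel :: (real \<times> real) measure). fst p \<noteq> c \<and> snd p \<noteq> c \<and> fst p \<noteq> snd p"
proof (rule AE_lborel_pair)
  show "{p. fst p \<noteq> c \<and> snd p \<noteq> c \<and> fst p \<noteq> (snd p :: real)} \<in> sets borel"
    by (intro borel_open open_Collect_conj open_Collect_neq continuous_intros)
  have "AE y in lborel. x \<noteq> c \<longrightarrow> y \<noteq> c \<and> x \<noteq> y" for x
    using AE_lborel_singleton[of c] AE_lborel_singleton[of x] by eventually_elim auto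
  then show "AE x in lborel. AE y in lborel. fst (x, y) \<noteq> c \<and> snd (x, y) \<noteq> c \<and> fst (x, y) \<noteq> snd (x, y)"
    using AE_lborel_singleton[of c]
    by (auto elim!: eventually_mono)
qed

text \<open>The integrands are singular like 1/sqrt at the endpoints, hence derivatives in the open
  interval. Nonnegativity yields integrability as part of the conclusion, since the nonnegative
  integral equals the finite difference of \<open>F\<close>.\<close>

lemma FTC_interior_nonneg:
  fixes f F :: "real \<Rightarrow> real"
  assumes "a \<le> b" and "continuous_on {a..b} F"
    and "\<And>x. a < x \<Longrightarrow> x < b \<Longrightarrow> (F has_real_derivative f x) (at x)"
    and "\<And>x. a < x \<Longrightarrow> x < b \<Longrightarrow> 0 \<le> f x" and [measurable]: "f \<in> borel_measurable borel"
  shows "has_bochner_integral lborel (\<lambda>x. indicator {a..b} x * f x) (F b - F a)"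
proof -
  have *: "(f has_integral (F b - F a)) {a..b}"
    using assms by (intro fundamental_theorem_of_calculus_interior)
      (auto simp: has_real_derivative_iff_has_vector_derivative)
  have "((\<lambda>x. indicator {a<..<b} x * f x) has_integral (F b - F a)) UNIV"
  proof (rule has_integral_spike_finite[of "{a, b}" _ _ "\<lambda>x. if x \<in> {a..b} then f x else 0"])
    show "((\<lambda>x. if x \<in> {a..b} then f x else 0) has_integral (F b - F a)) UNIV"
      using * by (simp only: has_integral_restrict_UNIV)
  qed (auto simp: indicator_def)
  then have "(\<integral>\<^sup>+x. ennreal (indicator {a<..<b} x * f x) \<partial>lborel) = F b - F a"
    by (rule nn_integral_has_integral_lborel[rotated 2]) (use assms in \<open>auto simp: indicator_def\<close>)
  moreover have "0 \<le> F b - F a"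
  proof (rule has_integral_nonneg)
    show "((\<lambda>x. indicator {a<..<b} x * f x) has_integral (F b - F a)) UNIV" by fact
  qed (use assms in \<open>auto simp: indicator_def\<close>)
  ultimately have "has_bochner_integral lborel (\<lambda>x. indicator {a<..<b} x * f x) (F b - F a)"
    by (intro has_bochner_integral_nn_integral) (use assms in \<open>auto simp: indicator_def\<close>)
  moreover have "AE x in lborel. indicator {a<..<b} x * f x = indicator {a..b} x * f x"
    using AE_lborel_singleton[of a] AE_lborel_singleton[of b]
    by eventually_elim (auto simp: indicator_def)
  ultimately show ?thesis
    by (subst (asm) has_bochner_integral_cong_AE) auto
qed

text \<open>Companion for integrands of varying sign: with integrability supplied, the gauge
  integral from the fundamental theorem agrees with the Lebesgue integral.\<close>

lemma FTC_interior_integrable: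
  fixes f F :: "real \<Rightarrow> real"
  assumes "a \<le> b" and "continuous_on {a..b} F"
    and "\<And>x. a < x \<Longrightarrow> x < b \<Longrightarrow> (F has_real_derivative f x) (at x)"
    and int: "integrable lborel (\<lambda>x. indicator {a..b} x * f x)"
  shows "(LINT x|lborel. indicator {a..b} x * f x) = F b - F a"
proof -
  have *: "(f has_integral (F b - F a)) {a..b}"
    using assms by (intro fundamental_theorem_of_calculus_interior)
      (auto simp: has_real_derivative_iff_has_vector_derivative)
  have "((\<lambda>x. indicator {a..b} x * f x) has_integral (LINT x|lborel. indicator {a..b} x * f x)) UNIV"
    by (rule has_integral_integral_lborel[OF int])
  moreover have "(\<lambda>x. indicator {a..b} x * f x) = (\<lambda>x. if x \<in> {a..b} then f x else 0)"
    by (auto simp: indicator_def)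
  ultimately have "(f has_integral (LINT x|lborel. indicator {a..b} x * f x)) {a..b}"
    by (simp only: has_integral_restrict_UNIV)
  then show ?thesis using * by (rule has_integral_unique)
qed

section \<open>The kernels of the second family of variances\<close>

text \<open>For \<open>x = 2 cos \<theta>\<close> and \<open>y = 2 cos \<phi>\<close> one has \<open>hgt x = 2 sin \<theta>\<close>, \<open>cosp x y = cos (\<theta> + \<phi>)\<close>, \<open>cosm x y = cos (\<theta> - \<phi>)\<close>,
  and \<open>ker_q \<sigma> (cos u)\<close> is the second derivative of \<open>ln (1 + \<sigma>\<^sup>2 - 2 \<sigma> cos u)\<close>.\<close>

definition hgt :: "real \<Rightarrow> real" where "hgt x = sqrt (4 - x\<^sup>2)"
definition cosp :: "real \<Rightarrow> real \<Rightarrow> real" where "cosp x y = (x * y - hgt x * hgt y) / 4"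
definition cosm :: "real \<Rightarrow> real \<Rightarrow> real" where "cosm x y = (x * y + hgt x * hgt y) / 4"
definition den :: "real \<Rightarrow> real \<Rightarrow> real" where "den \<sigma> c = 1 + \<sigma>\<^sup>2 - 2 * \<sigma> * c"
definition ker_q :: "real \<Rightarrow> real \<Rightarrow> real" where
  "ker_q \<sigma> c = 2 * \<sigma> * ((1 + \<sigma>\<^sup>2) * c - 2 * \<sigma>) / (den \<sigma> c)\<^sup>2"
definition tr_kernel :: "real \<Rightarrow> real \<Rightarrow> real \<Rightarrow> real" where
  "tr_kernel \<sigma> x y = ker_q \<sigma> (cosp x y) + ker_q \<sigma> (cosm x y)"

lemma hgt_sq: "\<bar>x\<bar> \<le> 2 \<Longrightarrow> (hgt x)\<^sup>2 = 4 - x\<^sup>2"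
  using abs_le_square_iff[of x 2] by (simp add: hgt_def)

lemma hgt_nonneg: "\<bar>x\<bar> \<le> 2 \<Longrightarrow> 0 \<le> hgt x"
  using abs_le_square_iff[of x 2] by (simp add: hgt_def)

lemma hgt_pos: "\<bar>x\<bar> < 2 \<Longrightarrow> 0 < hgt x"
  using abs_less_iff abs_le_square_iff[of 2 x] by (simp add: hgt_def)

lemma hgt_le: "\<bar>x\<bar> \<le> 2 \<Longrightarrow> hgt x \<le> 2"
  using real_sqrt_le_mono[of "4 - x\<^sup>2" 4] by (simp add: hgt_def)

lemma hgt_edge: "\<bar>x\<bar> = 2 \<Longrightarrow> hgt x = 0"
  using power2_abs[of x] by (simp add: hgt_def)

lemma hgt_mult: "sqrt ((4 - x\<^sup>2) * (4 - y\<^sup>2)) = hgt x * hgt y"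
  by (simp add: hgt_def real_sqrt_mult)

lemma continuous_on_hgt [continuous_intros]:
  "continuous_on A f \<Longrightarrow> continuous_on A (\<lambda>x. hgt (f x))"
  unfolding hgt_def by (intro continuous_intros)

lemma tendsto_hgt [tendsto_intros]: "(f \<longlongrightarrow> a) F \<Longrightarrow> ((\<lambda>x. hgt (f x)) \<longlongrightarrow> hgt a) F"
  unfolding hgt_def by (intro tendsto_intros)

lemma measurable_hgt [measurable]: "hgt \<in> borel_measurable borel"
  unfolding hgt_def[abs_def] by measurable

lemma DERIV_hgt: "\<bar>x\<bar> < 2 \<Longrightarrow> (hgt has_real_derivative - x / hgt x) (at x)"
  using hgt_pos[of x] unfolding hgt_def[abs_def]
  by (auto intro!: derivative_eq_intros simp: field_simps)

lemma cosp_cosm_bounds: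
  assumes "\<bar>x\<bar> \<le> 2" "\<bar>y\<bar> \<le> 2"
  shows "\<bar>cosp x y\<bar> \<le> 1" "\<bar>cosm x y\<bar> \<le> 1"
proof -
  have "(x - y)\<^sup>2 + (hgt x - hgt y)\<^sup>2 \<ge> 0" "(x + y)\<^sup>2 + (hgt x - hgt y)\<^sup>2 \<ge> 0"
    "(x - y)\<^sup>2 + (hgt x + hgt y)\<^sup>2 \<ge> 0" "(x + y)\<^sup>2 + (hgt x + hgt y)\<^sup>2 \<ge> 0"
    by simp_all
  then show "\<bar>cosp x y\<bar> \<le> 1" "\<bar>cosm x y\<bar> \<le> 1"
    using hgt_sq[OF assms(1)] hgt_sq[OF assms(2)]
    by (auto simp: cosp_def cosm_def power2_sum power2_diff abs_le_iff)
qed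

text \<open>In angles, (1 - cos (\<theta> + \<phi>)) (1 - cos (\<theta> - \<phi>)) = (cos \<theta> -
  cos \<phi>)^2. It translates the singularities of the kernels at \<sigma> = 1 into the 1 / (x -
  y)^2 that a Lipschitz function cancels.\<close>

lemma cosp_cosm_prod:
  assumes "\<bar>x\<bar> \<le> 2" "\<bar>y\<bar> \<le> 2"
  shows "(1 - cosp x y) * (1 - cosm x y) = (x - y)\<^sup>2 / 4"
proof -
  have "(1 - cosp x y) * (1 - cosm x y) = ((4 - x * y)\<^sup>2 - (hgt x)\<^sup>2 * (hgt y)\<^sup>2) / 16"
    by (simp add: cosp_def cosm_def field_simps power2_eq_square)
  also have "\<dots> = (x - y)\<^sup>2 / 4"
    unfolding hgt_sq[OF assms(1)] hgt_sq[OF assms(2)]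
    by (simp add: field_simps power2_eq_square)
  finally show ?thesis .
qed

text \<open>The right-hand side is the denominator of \<open>V_d2_open\<close>; it is a product of
  Poisson denominators at the sum and the difference of the angles.\<close>

lemma den_prod:
  assumes "\<bar>x\<bar> \<le> 2" "\<bar>y\<bar> \<le> 2"
  shows "den \<sigma> (cosp x y) * den \<sigma> (cosm x y) =
    \<sigma>\<^sup>2 * (x\<^sup>2 + y\<^sup>2) + (1 - \<sigma>\<^sup>2)\<^sup>2 - x * y * \<sigma> * (1 + \<sigma>\<^sup>2)"
proof -
  have "den \<sigma> (cosp x y) * den \<sigma> (cosm x y) =
      (1 + \<sigma>\<^sup>2 - \<sigma> * (x * y) / 2)\<^sup>2 - \<sigma>\<^sup>2 / 4 * ((hgt x)\<^sup>2 * (hgt y)\<^sup>2)"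
    by (simp add: den_def cosp_def cosm_def field_simps power2_eq_square)
  then show ?thesis
    unfolding hgt_sq[OF assms(1)] hgt_sq[OF assms(2)]
    by (simp add: field_simps power2_eq_square)
qed

lemma den_eq: "den \<sigma> c = (1 - \<sigma>)\<^sup>2 + 2 * \<sigma> * (1 - c)"
  by (simp add: den_def power2_eq_square algebra_simps)

lemma den_pos:
  assumes "\<bar>\<sigma>\<bar> < 1" "\<bar>c\<bar> \<le> 1"
  shows "(1 - \<bar>\<sigma>\<bar>)\<^sup>2 \<le> den \<sigma> c" "0 < den \<sigma> c"
proof -
  have "\<sigma> * c \<le> \<bar>\<sigma>\<bar>"
    using assms by (metis abs_ge_self abs_ge_zero abs_mult mult_left_le order_trans)
  then show le: "(1 - \<bar>\<sigma>\<bar>)\<^sup>2 \<le> den \<sigma> c"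
    by (simp add: den_def power2_diff)
  have "0 < (1 - \<bar>\<sigma>\<bar>)\<^sup>2" using assms by simp
  with le show "0 < den \<sigma> c" by linarith
qed

lemma tendsto_den [tendsto_intros]:
  "(f \<longlongrightarrow> a) F \<Longrightarrow> (g \<longlongrightarrow> b) F \<Longrightarrow> ((\<lambda>x. den (f x) (g x)) \<longlongrightarrow> den a b) F"
  unfolding den_def by (intro tendsto_intros)

lemma tendsto_cosp [tendsto_intros]:
  "(f \<longlongrightarrow> a) F \<Longrightarrow> (g \<longlongrightarrow> b) F \<Longrightarrow> ((\<lambda>x. cosp (f x) (g x)) \<longlongrightarrow> cosp a b) F"
  unfolding cosp_def by (intro tendsto_intros) auto

lemma tendsto_cosm [tendsto_intros]:
  "(f \<longlongrightarrow> a) F \<Longrightarrow> (g \<longlongrightarrow> b) F \<Longrightarrow> ((\<lambda>x. cosm (f x) (g x)) \<longlongrightarrow> cosm a b) F"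
  unfolding cosm_def by (intro tendsto_intros) auto

lemma tendsto_ker_q [tendsto_intros]:
  "(f \<longlongrightarrow> a) F \<Longrightarrow> (g \<longlongrightarrow> b) F \<Longrightarrow> den a b \<noteq> 0 \<Longrightarrow> ((\<lambda>x. ker_q (f x) (g x)) \<longlongrightarrow> ker_q a b) F"
  unfolding ker_q_def by (intro tendsto_intros) auto

lemma tr_kernel_commute: "tr_kernel \<sigma> x y = tr_kernel \<sigma> y x"
  by (simp add: tr_kernel_def cosp_def cosm_def mult.commute)

lemma measurable_tr_kernel [measurable]:
  assumes [measurable]: "f \<in> borel_measurable M" "g \<in> borel_measurable M"
  shows "(\<lambda>x. tr_kernel \<sigma> (f x) (g x)) \<in> borel_measurable M"
  unfolding tr_kernel_def ker_q_def den_def cosp_def cosm_def by measurable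

section \<open>The mixed derivative of the logarithmic kernel\<close>

lemma V_tr2_log_eq:
  assumes "\<bar>x\<bar> \<le> 2" "\<bar>y\<bar> \<le> 2"
  shows "V_tr2_log \<sigma> x y = ln (den \<sigma> (cosp x y) / den \<sigma> (cosm x y))"
proof -
  \<comment> \<open>The points (x, hgt x) and (y, \<plusminus>hgt y) lie on the circle of radius 2,
    so these are squared distances, evaluated by the law of cosines.\<close>
  have "(x - \<sigma> * y)\<^sup>2 + (hgt x + \<sigma> * hgt y)\<^sup>2 =
      (x\<^sup>2 + (hgt x)\<^sup>2) + \<sigma>\<^sup>2 * (y\<^sup>2 + (hgt y)\<^sup>2) - 2 * \<sigma> * (x * y - hgt x * hgt y)"
    "(x - \<sigma> * y)\<^sup>2 + (hgt x - \<sigma> * hgt y)\<^sup>2 =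
      (x\<^sup>2 + (hgt x)\<^sup>2) + \<sigma>\<^sup>2 * (y\<^sup>2 + (hgt y)\<^sup>2) - 2 * \<sigma> * (x * y + hgt x * hgt y)"
    by (simp_all add: power2_eq_square algebra_simps)
  then have "(x - \<sigma> * y)\<^sup>2 + (hgt x + \<sigma> * hgt y)\<^sup>2 = 4 * den \<sigma> (cosp x y)"
    "(x - \<sigma> * y)\<^sup>2 + (hgt x - \<sigma> * hgt y)\<^sup>2 = 4 * den \<sigma> (cosm x y)"
    unfolding hgt_sq[OF assms(1)] hgt_sq[OF assms(2)]
    by (simp_all add: den_def cosp_def cosm_def)
  then show ?thesis
    unfolding V_tr2_log_def hgt_def by simp
qed

text \<open>The y-derivative of \<open>V_tr2_log\<close>. In angles the two numerators are 4 sin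
  (\<theta> + \<phi>) and -4 sin (\<theta> - \<phi>). It is at the same time a primitive in x of the
  mixed derivative and vanishes at x = 2 and x = -2, which later gives the marginal of the
  kernel.\<close>

definition dlog :: "real \<Rightarrow> real \<Rightarrow> real \<Rightarrow> real" where
  "dlog \<sigma> x y = - (\<sigma> / (2 * hgt y)) *
     ((x * hgt y + y * hgt x) / den \<sigma> (cosp x y) - (x * hgt y - y * hgt x) / den \<sigma> (cosm x y))"

lemma DERIV_cosp:
  assumes "\<bar>y\<bar> < 2"
  shows "((\<lambda>y. cosp x y) has_real_derivative (x * hgt y + y * hgt x) / (4 * hgt y)) (at y)"
    "((\<lambda>x. cosp x z) has_real_derivative (y * hgt z + z * hgt y) / (4 * hgt y)) (at y)"
  unfolding cosp_def using hgt_pos[OF assms]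
  by (auto intro!: derivative_eq_intros DERIV_hgt[OF assms] simp: field_simps)

lemma DERIV_cosm:
  assumes "\<bar>y\<bar> < 2"
  shows "((\<lambda>y. cosm x y) has_real_derivative (x * hgt y - y * hgt x) / (4 * hgt y)) (at y)"
    "((\<lambda>x. cosm x z) has_real_derivative - (y * hgt z - z * hgt y) / (4 * hgt y)) (at y)"
  unfolding cosm_def using hgt_pos[OF assms]
  by (auto intro!: derivative_eq_intros DERIV_hgt[OF assms] simp: field_simps)

lemma V_tr2_log_DERIV_y:
  assumes \<sigma>: "\<bar>\<sigma>\<bar> < 1" and x: "\<bar>x\<bar> \<le> 2" and y: "\<bar>y\<bar> < 2"
  shows "((\<lambda>y. V_tr2_log \<sigma> x y) has_real_derivative dlog \<sigma> x y) (at y)"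
proof -
  have y': "\<bar>y\<bar> \<le> 2" using y by simp
  have pos: "0 < den \<sigma> (cosp x y)" "0 < den \<sigma> (cosm x y)"
    using den_pos(2)[OF \<sigma>] cosp_cosm_bounds[OF x y'] by auto
  let ?a = "(x * hgt y + y * hgt x) / (4 * hgt y)" and ?b = "(x * hgt y - y * hgt x) / (4 * hgt y)"
  have dp: "((\<lambda>y. den \<sigma> (cosp x y)) has_real_derivative - 2 * \<sigma> * ?a) (at y)"
    unfolding den_def by (auto intro!: derivative_eq_intros DERIV_cosp(1)[OF y])
  have dm: "((\<lambda>y. den \<sigma> (cosm x y)) has_real_derivative - 2 * \<sigma> * ?b) (at y)"
    unfolding den_def by (auto intro!: derivative_eq_intros DERIV_cosm(1)[OF y])
  have "((\<lambda>y. ln (den \<sigma> (cosp x y)) - ln (den \<sigma> (cosm x y))) has_real_derivative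
      1 / den \<sigma> (cosp x y) * (- 2 * \<sigma> * ?a) - 1 / den \<sigma> (cosm x y) * (- 2 * \<sigma> * ?b)) (at y)"
    by (intro DERIV_diff DERIV_chain2[OF DERIV_ln_divide dp] DERIV_chain2[OF DERIV_ln_divide dm] pos)
  moreover have "1 / den \<sigma> (cosp x y) * (- 2 * \<sigma> * ?a) - 1 / den \<sigma> (cosm x y) * (- 2 * \<sigma> * ?b) = dlog \<sigma> x y"
    unfolding dlog_def using pos hgt_pos[OF y] by (simp add: divide_simps) (simp add: algebra_simps)
  ultimately have *: "((\<lambda>y. ln (den \<sigma> (cosp x y)) - ln (den \<sigma> (cosm x y))) has_real_derivative dlog \<sigma> x y) (at y)"
    by simp
  have "\<forall>\<^sub>F z in nhds y. z \<in> {-2<..<2}"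
    using y by (intro eventually_nhds_in_open) (auto simp: abs_less_iff)
  then have "\<forall>\<^sub>F z in nhds y. V_tr2_log \<sigma> x z = ln (den \<sigma> (cosp x z)) - ln (den \<sigma> (cosm x z))"
  proof eventually_elim
    case (elim z)
    then have z: "\<bar>z\<bar> \<le> 2" by auto
    then have "0 < den \<sigma> (cosp x z)" "0 < den \<sigma> (cosm x z)"
      using den_pos(2)[OF \<sigma>] cosp_cosm_bounds[OF x z] by auto
    then show ?case by (simp add: V_tr2_log_eq[OF x z] ln_div)
  qed
  with * show ?thesis by (subst DERIV_cong_ev[OF refl _ refl]) auto
qed

text \<open>One computation serves both \<theta> + \<phi> and \<theta> - \<phi>. The assumptions say
  that C = cos u and N = 4 sin u for an angle u with du/dx = -1/h, so this is the derivative of 4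
  sin u / den(cos u).\<close>

lemma DERIV_quotient_aux:
  fixes h c :: real
  assumes "(N has_real_derivative N') (at x)" "(C has_real_derivative C') (at x)"
    and "den \<sigma> (C x) \<noteq> 0" and "N' = - (4 * C x) / h" "C' = N x / (4 * h)" "(N x)\<^sup>2 = 16 * (1 - (C x)\<^sup>2)"
    and "h \<noteq> 0"
  shows "((\<lambda>x. N x / den \<sigma> (C x)) has_real_derivative
     - (4 / h) * (((1 + \<sigma>\<^sup>2) * C x - 2 * \<sigma>) / (den \<sigma> (C x))\<^sup>2)) (at x)"
proof -
  let ?D = "den \<sigma> (C x)"
  have dd: "((\<lambda>x. den \<sigma> (C x)) has_real_derivative - 2 * \<sigma> * C') (at x)"
    unfolding den_def using assms(2) by (auto intro!: derivative_eq_intros)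
  have "((\<lambda>x. N x / den \<sigma> (C x)) has_real_derivative (N' * ?D - N x * (- 2 * \<sigma> * C')) / (?D * ?D)) (at x)"
    by (rule DERIV_divide[OF assms(1) dd assms(3)])
  moreover have "N' * ?D - N x * (- 2 * \<sigma> * C') = - (4 / h) * ((1 + \<sigma>\<^sup>2) * C x - 2 * \<sigma>)"
  proof -
    have "N' * ?D - N x * (- 2 * \<sigma> * C') = (- 4 * C x * ?D + \<sigma> / 2 * (N x)\<^sup>2) / h"
      unfolding assms(4,5) using assms(7) by (simp add: field_simps power2_eq_square)
    also have "- 4 * C x * ?D + \<sigma> / 2 * (N x)\<^sup>2 = - 4 * ((1 + \<sigma>\<^sup>2) * C x - 2 * \<sigma>)"
      unfolding assms(6) den_def by (simp add: algebra_simps power2_eq_square)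
    finally show ?thesis using assms(7) by (simp add: field_simps)
  qed
  ultimately show ?thesis by (simp add: power2_eq_square)
qed

lemma numerator_sq:
  assumes "\<bar>x\<bar> \<le> 2" "\<bar>y\<bar> \<le> 2"
  shows "(x * hgt y + y * hgt x)\<^sup>2 = 16 * (1 - (cosp x y)\<^sup>2)"
    "(x * hgt y - y * hgt x)\<^sup>2 = 16 * (1 - (cosm x y)\<^sup>2)"
proof -
  have "(x * hgt y + y * hgt x)\<^sup>2 + 16 * (cosp x y)\<^sup>2 = (x\<^sup>2 + (hgt x)\<^sup>2) * (y\<^sup>2 + (hgt y)\<^sup>2)"
    "(x * hgt y - y * hgt x)\<^sup>2 + 16 * (cosm x y)\<^sup>2 = (x\<^sup>2 + (hgt x)\<^sup>2) * (y\<^sup>2 + (hgt y)\<^sup>2)"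
    unfolding cosp_def cosm_def by (simp_all add: power2_eq_square field_simps)
  then show "(x * hgt y + y * hgt x)\<^sup>2 = 16 * (1 - (cosp x y)\<^sup>2)"
    "(x * hgt y - y * hgt x)\<^sup>2 = 16 * (1 - (cosm x y)\<^sup>2)"
    unfolding hgt_sq[OF assms(1)] hgt_sq[OF assms(2)] by simp_all
qed

lemma dlog_DERIV_x:
  assumes \<sigma>: "\<bar>\<sigma>\<bar> < 1" and x: "\<bar>x\<bar> < 2" and y: "\<bar>y\<bar> < 2"
  shows "((\<lambda>x. dlog \<sigma> x y) has_real_derivative tr_kernel \<sigma> x y / (hgt x * hgt y)) (at x)"
proof -
  have x': "\<bar>x\<bar> \<le> 2" and y': "\<bar>y\<bar> \<le> 2" using x y by simp_all
  have pos: "den \<sigma> (cosp x y) \<noteq> 0" "den \<sigma> (cosm x y) \<noteq> 0"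
    using den_pos(2)[OF \<sigma>] cosp_cosm_bounds[OF x' y'] by (metis less_irrefl)+
  have h: "hgt x > 0" "hgt y > 0" using hgt_pos x y by auto
  have Np: "((\<lambda>x. x * hgt y + y * hgt x) has_real_derivative - (4 * cosp x y) / hgt x) (at x)"
    using h by (auto intro!: derivative_eq_intros DERIV_hgt[OF x] simp: cosp_def field_simps)
  have Nm: "((\<lambda>x. - (x * hgt y - y * hgt x)) has_real_derivative - (4 * cosm x y) / hgt x) (at x)"
    using h by (auto intro!: derivative_eq_intros DERIV_hgt[OF x] simp: cosm_def field_simps)
  let ?q = "\<lambda>c. ((1 + \<sigma>\<^sup>2) * c - 2 * \<sigma>) / (den \<sigma> c)\<^sup>2"
  have Qp: "((\<lambda>x. (x * hgt y + y * hgt x) / den \<sigma> (cosp x y)) has_real_derivative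
      - (4 / hgt x) * ?q (cosp x y)) (at x)"
    by (rule DERIV_quotient_aux[OF Np DERIV_cosp(2)[OF x]])
      (use pos h numerator_sq[OF x' y'] in auto)
  have Qm: "((\<lambda>x. - (x * hgt y - y * hgt x) / den \<sigma> (cosm x y)) has_real_derivative
      - (4 / hgt x) * ?q (cosm x y)) (at x)"
    by (rule DERIV_quotient_aux[OF Nm DERIV_cosm(2)[OF x]])
      (use pos h numerator_sq[OF x' y'] in \<open>auto simp: power2_commute\<close>)
  have "((\<lambda>x. - (\<sigma> / (2 * hgt y)) * ((x * hgt y + y * hgt x) / den \<sigma> (cosp x y) +
      - (x * hgt y - y * hgt x) / den \<sigma> (cosm x y))) has_real_derivative
      - (\<sigma> / (2 * hgt y)) * (- (4 / hgt x) * ?q (cosp x y) + - (4 / hgt x) * ?q (cosm x y))) (at x)"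
    by (intro DERIV_cmult DERIV_add Qp Qm)
  moreover have "(\<lambda>x. - (\<sigma> / (2 * hgt y)) * ((x * hgt y + y * hgt x) / den \<sigma> (cosp x y) +
      - (x * hgt y - y * hgt x) / den \<sigma> (cosm x y))) = (\<lambda>x. dlog \<sigma> x y)"
    unfolding dlog_def by (simp only: minus_divide_left[symmetric] diff_conv_add_uminus)
  moreover have "- (\<sigma> / (2 * hgt y)) * (- (4 / hgt x) * ?q (cosp x y) + - (4 / hgt x) * ?q (cosm x y)) =
      tr_kernel \<sigma> x y / (hgt x * hgt y)"
  proof -
    have K: "tr_kernel \<sigma> x y = 2 * \<sigma> * (?q (cosp x y) + ?q (cosm x y))"
      by (simp add: tr_kernel_def ker_q_def distrib_left)
    have "- (\<sigma> / (2 * s)) * (- (4 / h) * P + - (4 / h) * Q) = 2 * \<sigma> * (P + Q) / (h * s)"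
      if "h \<noteq> 0" "s \<noteq> 0" for P Q h s :: real
      using that by (simp add: field_simps)
    from this[OF less_imp_neq[OF h(1), symmetric] less_imp_neq[OF h(2), symmetric]]
    show ?thesis unfolding K .
  qed
  ultimately show ?thesis by simp
qed

lemma deriv_deriv_V_tr2_log:
  assumes \<sigma>: "\<bar>\<sigma>\<bar> < 1" and x: "\<bar>x\<bar> < 2" and y: "\<bar>y\<bar> < 2"
  shows "deriv (\<lambda>x'. deriv (\<lambda>y'. V_tr2_log \<sigma> x' y') y) x = tr_kernel \<sigma> x y / (hgt x * hgt y)"
proof -
  have "\<forall>\<^sub>F z in nhds x. z \<in> {-2<..<2}"
    using x by (intro eventually_nhds_in_open) (auto simp: abs_less_iff)
  then have "\<forall>\<^sub>F z in nhds x. deriv (\<lambda>y'. V_tr2_log \<sigma> z y') y = dlog \<sigma> z y"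
    by eventually_elim (auto intro!: DERIV_imp_deriv V_tr2_log_DERIV_y \<sigma> y)
  then have "deriv (\<lambda>x'. deriv (\<lambda>y'. V_tr2_log \<sigma> x' y') y) x = deriv (\<lambda>x'. dlog \<sigma> x' y) x"
    by (rule deriv_cong_ev) simp
  then show ?thesis
    using dlog_DERIV_x[OF assms] by (simp add: DERIV_imp_deriv)
qed

section \<open>Values of the iterated derivative on the sides of the square\<close>

lemma dlog_edge: "\<bar>x\<bar> = 2 \<Longrightarrow> dlog \<sigma> x y = 0"
  by (simp add: dlog_def hgt_edge cosp_def cosm_def)

lemma continuous_on_dlog:
  assumes \<sigma>: "\<bar>\<sigma>\<bar> < 1" and y: "\<bar>y\<bar> < 2"
  shows "continuous_on {-2..2} (\<lambda>x. dlog \<sigma> x y)"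
proof -
  have "den \<sigma> (cosp x y) \<noteq> 0" "den \<sigma> (cosm x y) \<noteq> 0" if "x \<in> {-2..2}" for x
    using den_pos(2)[OF \<sigma>] cosp_cosm_bounds[of x y] that y by (smt (verit) atLeastAtMost_iff)+
  then show ?thesis
    using hgt_pos[OF y] unfolding dlog_def den_def cosp_def cosm_def by (intro continuous_intros) auto
qed

text \<open>The function vanishes like a square root at the edge. With a derivative, (t - e) times
  the squared difference quotient would tend to 0; since hgt^2 = -(t - e)(t + e), that expression is
  -(t + e) C^2, with nonzero limit -2 e c^2. The approach is from inside (-2, 2), where
  \<open>hgt\<close> is the true height.\<close>

lemma not_differentiable_sqrt_edge:
  assumes e: "\<bar>e\<bar> = 2" and \<phi>e: "\<phi> e = 0"
    and eq: "\<forall>\<^sub>F t in at e within {-2<..<2}. \<phi> t = hgt t * C t"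
    and C: "(C \<longlongrightarrow> c) (at e within {-2<..<2})" and "c \<noteq> 0"
  shows "\<not> (\<phi> has_real_derivative D) (at e)"
proof
  let ?F = "at e within {-2<..<2}"
  assume "(\<phi> has_real_derivative D) (at e)"
  then have "((\<lambda>t. (\<phi> t - \<phi> e) / (t - e)) \<longlongrightarrow> D) ?F"
    using tendsto_within_subset unfolding has_field_derivative_iff by blast
  then have "((\<lambda>t. (t - e) * (\<phi> t / (t - e))\<^sup>2) \<longlongrightarrow> (e - e) * D\<^sup>2) ?F"
    unfolding \<phi>e by (intro tendsto_intros) simp
  moreover have "\<forall>\<^sub>F t in ?F. t \<noteq> e \<and> t \<in> {-2<..<2}"
    by (auto simp: eventually_at_filter)
  with eq have "\<forall>\<^sub>F t in ?F. (t - e) * (\<phi> t / (t - e))\<^sup>2 = - (t + e) * (C t)\<^sup>2"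
  proof eventually_elim
    case t: (elim t)
    have t': "\<bar>t\<bar> \<le> 2" using t by auto
    have e2: "e\<^sup>2 = 4" using e power2_abs[of e] by simp
    have "(\<phi> t)\<^sup>2 = - (t - e) * (t + e) * (C t)\<^sup>2"
      using t hgt_sq[OF t'] e2 by (simp add: power_mult_distrib) (simp add: power2_eq_square algebra_simps)
    moreover have "(t - e) * (\<phi> t / (t - e))\<^sup>2 = (\<phi> t)\<^sup>2 / (t - e)"
      using t by (simp add: power2_eq_square)
    moreover have "- (t - e) * r / (t - e) = - r" for r
      using t by (simp add: field_simps)
    ultimately show ?case
      by (simp only: mult.assoc mult_minus_left)
  qed
  ultimately have "((\<lambda>t. - (t + e) * (C t)\<^sup>2) \<longlongrightarrow> (e - e) * D\<^sup>2) ?F"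
    by (rule Lim_transform_eventually)
  moreover have "((\<lambda>t. - (t + e) * (C t)\<^sup>2) \<longlongrightarrow> - (e + e) * c\<^sup>2) ?F"
    by (intro tendsto_intros C)
  moreover have "?F \<noteq> bot"
  proof -
    consider "e = 2" | "e = -2" using e by (auto simp: abs_if split: if_splits)
    then show ?thesis
      by cases (simp_all add: trivial_limit_within islimpt_greaterThanLessThan1 islimpt_greaterThanLessThan2)
  qed
  ultimately have "- (e + e) * c\<^sup>2 = (e - e) * D\<^sup>2"
    using tendsto_unique by blast
  then show False using \<open>c \<noteq> 0\<close> e by auto
qed

lemma V_tr2_log_zero: "V_tr2_log 0 x y = 0"
  by (simp add: V_tr2_log_def)

lemma V_tr2_log_edge:
  assumes "\<bar>\<sigma>\<bar> < 1" "\<bar>x\<bar> \<le> 2" "\<bar>y\<bar> \<le> 2" "\<bar>x\<bar> = 2 \<or> \<bar>y\<bar> = 2"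
  shows "V_tr2_log \<sigma> x y = 0"
proof -
  have "cosp x y = cosm x y"
    using assms(4) by (auto simp: cosp_def cosm_def hgt_edge)
  moreover have "0 < den \<sigma> (cosm x y)"
    using den_pos(2)[OF assms(1) cosp_cosm_bounds(2)[OF assms(2,3)]] .
  ultimately show ?thesis by (simp add: V_tr2_log_eq[OF assms(2,3)])
qed

text \<open>On the edges of the square the iterated \<^const>\<open>deriv\<close> need not exist; that its values there are
  still Borel measurable has to be known before the integrand can be replaced by its interior formula.\<close>

lemma deriv_not_differentiable:
  "(\<And>D. \<not> (\<phi> has_real_derivative D) (at e)) \<Longrightarrow> deriv \<phi> e = (SOME D. False)"
  by (simp add: deriv_def)

text \<open>The slope is infinite, so \<open>deriv\<close> returns its default. That value does not
  depend on x, so along the sides y = 2 and y = -2 the inner derivative is constant in x and the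
  outer one is 0.\<close>

lemma deriv_V_tr2_log_y_edge:
  assumes \<sigma>: "\<bar>\<sigma>\<bar> < 1" "\<sigma> \<noteq> 0" and x: "\<bar>x\<bar> < 2" and y: "\<bar>y\<bar> = 2"
  shows "deriv (\<lambda>y'. V_tr2_log \<sigma> x y') y = (SOME D. False)"
proof (rule deriv_not_differentiable)
  fix D
  show "\<not> ((\<lambda>y'. V_tr2_log \<sigma> x y') has_real_derivative D) (at y)"
  proof
    assume "((\<lambda>y'. V_tr2_log \<sigma> x y') has_real_derivative D) (at y)"
    \<comment> \<open>Exponentiating removes the logarithm: the result is the difference of the two
      denominators over the second one, which is \<open>hgt t\<close> times a continuous
      factor.\<close>
    then have d: "((\<lambda>y'. exp (V_tr2_log \<sigma> x y') - 1) has_real_derivative exp (V_tr2_log \<sigma> x y) * D - 0) (at y)"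
      by (intro DERIV_diff DERIV_const DERIV_chain2[OF DERIV_exp])
    have x': "\<bar>x\<bar> \<le> 2" and y': "\<bar>y\<bar> \<le> 2" using x y by auto
    have dm: "0 < den \<sigma> (cosm x y)"
      using den_pos(2)[OF \<sigma>(1) cosp_cosm_bounds(2)[OF x' y']] .
    have "\<not> ((\<lambda>y'. exp (V_tr2_log \<sigma> x y') - 1) has_real_derivative exp (V_tr2_log \<sigma> x y) * D - 0) (at y)"
    proof (rule not_differentiable_sqrt_edge[OF y])
      show "exp (V_tr2_log \<sigma> x y) - 1 = 0"
        using V_tr2_log_edge[OF \<sigma>(1) x' y'] y by simp
      show "\<forall>\<^sub>F t in at y within {-2<..<2}. exp (V_tr2_log \<sigma> x t) - 1 = hgt t * (\<sigma> * hgt x / den \<sigma> (cosm x t))"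
        unfolding eventually_at_filter
      proof (intro always_eventually allI impI)
        fix t :: real assume "t \<in> {-2<..<2}"
        then have t: "\<bar>t\<bar> \<le> 2" by auto
        have pos: "0 < den \<sigma> (cosp x t)" "0 < den \<sigma> (cosm x t)"
          using den_pos(2)[OF \<sigma>(1)] cosp_cosm_bounds[OF x' t] by auto
        then show "exp (V_tr2_log \<sigma> x t) - 1 = hgt t * (\<sigma> * hgt x / den \<sigma> (cosm x t))"
          by (simp add: V_tr2_log_eq[OF x' t] field_simps) (simp add: den_def cosp_def cosm_def field_simps)
      qed
      show "((\<lambda>t. \<sigma> * hgt x / den \<sigma> (cosm x t)) \<longlongrightarrow> \<sigma> * hgt x / den \<sigma> (cosm x y)) (at y within {-2<..<2})"
        using dm by (intro tendsto_intros) auto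
      show "\<sigma> * hgt x / den \<sigma> (cosm x y) \<noteq> 0"
        using dm \<sigma>(2) hgt_pos[OF x] by simp
    qed
    with d show False by blast
  qed
qed

text \<open>For |y| < 2 the inner derivative is \<open>dlog\<close>, and from inside it is
  \<open>hgt t\<close> times a continuous factor, so the outer derivative is again the default
  value. The factor vanishes at a single y on each of the two sides, which \<open>generic\<close>
  excludes.\<close>

lemma deriv_deriv_V_tr2_log_x_edge:
  assumes \<sigma>: "\<bar>\<sigma>\<bar> < 1" "\<sigma> \<noteq> 0" and x: "\<bar>x\<bar> = 2" and y: "\<bar>y\<bar> < 2"
    and generic: "y * (1 + \<sigma>\<^sup>2) \<noteq> 2 * \<sigma> * x"
  shows "deriv (\<lambda>x'. deriv (\<lambda>y'. V_tr2_log \<sigma> x' y') y) x = (SOME D. False)"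
proof (rule deriv_not_differentiable)
  fix D
  have x': "\<bar>x\<bar> \<le> 2" and y': "\<bar>y\<bar> \<le> 2" using x y by auto
  have pos: "0 < den \<sigma> (cosp x y)" "0 < den \<sigma> (cosm x y)"
    using den_pos(2)[OF \<sigma>(1)] cosp_cosm_bounds[OF x' y'] by auto
  have hy: "0 < hgt y" using hgt_pos[OF y] .
  define C where "C t = - (\<sigma> / (2 * hgt y)) * (2 * y * (1 + \<sigma>\<^sup>2 - \<sigma> * t * y / 2) - \<sigma> * t * (hgt y)\<^sup>2) /
      (den \<sigma> (cosp t y) * den \<sigma> (cosm t y))" for t
  show "\<not> ((\<lambda>x'. deriv (\<lambda>y'. V_tr2_log \<sigma> x' y') y) has_real_derivative D) (at x)"
  proof (rule not_differentiable_sqrt_edge[OF x])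
    show "deriv (\<lambda>y'. V_tr2_log \<sigma> x y') y = 0"
      using V_tr2_log_DERIV_y[OF \<sigma>(1) x' y] dlog_edge[OF x] by (simp add: DERIV_imp_deriv)
    show "\<forall>\<^sub>F t in at x within {-2<..<2}. deriv (\<lambda>y'. V_tr2_log \<sigma> t y') y = hgt t * C t"
      unfolding eventually_at_filter
    proof (intro always_eventually allI impI)
      fix t :: real assume "t \<in> {-2<..<2}"
      then have t: "\<bar>t\<bar> \<le> 2" by auto
      have post: "0 < den \<sigma> (cosp t y)" "0 < den \<sigma> (cosm t y)"
        using den_pos(2)[OF \<sigma>(1)] cosp_cosm_bounds[OF t y'] by auto
      have "(t * hgt y + y * hgt t) * den \<sigma> (cosm t y) - (t * hgt y - y * hgt t) * den \<sigma> (cosp t y) =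
          hgt t * (2 * y * (1 + \<sigma>\<^sup>2 - \<sigma> * t * y / 2) - \<sigma> * t * (hgt y)\<^sup>2)"
        by (simp add: den_def cosp_def cosm_def field_simps power2_eq_square)
      then have "dlog \<sigma> t y = hgt t * C t"
        unfolding dlog_def C_def using post by (simp add: diff_frac_eq)
      then show "deriv (\<lambda>y'. V_tr2_log \<sigma> t y') y = hgt t * C t"
        using V_tr2_log_DERIV_y[OF \<sigma>(1) t y] by (simp add: DERIV_imp_deriv)
    qed
    show "(C \<longlongrightarrow> C x) (at x within {-2<..<2})"
      unfolding C_def using hy pos by (intro tendsto_intros) auto
    have "2 * y * (1 + \<sigma>\<^sup>2 - \<sigma> * x * y / 2) - \<sigma> * x * (hgt y)\<^sup>2 = 2 * (y * (1 + \<sigma>\<^sup>2) - 2 * \<sigma> * x)"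
      unfolding hgt_sq[OF y'] by (simp add: field_simps power2_eq_square)
    then show "C x \<noteq> 0"
      using hy pos \<sigma>(2) generic by (simp add: C_def)
  qed
qed

definition square :: "(real \<times> real) set" where "square = {-2..2} \<times> {-2..2}"

lemma square_sets [measurable]: "square \<in> sets borel"
  unfolding square_def by (intro borel_closed closed_Times) auto

text \<open>Outside a finite set, the four corners and the exceptional point on each vertical side,
  the iterated derivative is the piecewise Borel function \<open>G\<close>: the kernel in the
  interior, 0 on the horizontal sides, the default value on the vertical ones. For \<sigma> = 0 the
  logarithm vanishes identically.\<close>

lemma measurable_deriv_deriv_V_tr2_log:
  assumes \<sigma>: "\<bar>\<sigma>\<bar> < 1"
  shows "(\<lambda>p. indicator square p * deriv (\<lambda>x'. deriv (\<lambda>y'. V_tr2_log \<sigma> x' y') (snd p)) (fst p))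
    \<in> borel_measurable borel"
proof (cases "\<sigma> = 0")
  case True
  then show ?thesis by (simp add: V_tr2_log_zero)
next
  case False
  define c :: real where "c = (SOME D. False)"
  define G where "G p = indicator square p * (if \<bar>fst p\<bar> < 2 \<and> \<bar>snd p\<bar> < 2
      then tr_kernel \<sigma> (fst p) (snd p) / (hgt (fst p) * hgt (snd p)) else if \<bar>snd p\<bar> < 2 then c else 0)" for p :: "real \<times> real"
  define X :: "(real \<times> real) set" where "X = {(2, 2), (2, -2), (-2, 2), (-2, -2), (2, 4 * \<sigma> / (1 + \<sigma>\<^sup>2)), (-2, - 4 * \<sigma> / (1 + \<sigma>\<^sup>2))}"
  have [measurable]: "G \<in> borel_measurable borel"
    unfolding G_def by measurable
  show ?thesis
  proof (rule measurable_discrete_difference[where X = X and f = G])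
    fix p assume p: "p \<notin> X"
    obtain x y where xy: "p = (x, y)" by (cases p)
    have s: "1 + \<sigma>\<^sup>2 > 0" by (simp add: add_pos_nonneg)
    show "G p = indicator square p * deriv (\<lambda>x'. deriv (\<lambda>y'. V_tr2_log \<sigma> x' y') (snd p)) (fst p)"
    proof (cases "p \<in> square")
      case True
      then have b: "\<bar>x\<bar> \<le> 2" "\<bar>y\<bar> \<le> 2" by (auto simp: square_def xy)
      consider "\<bar>x\<bar> < 2" "\<bar>y\<bar> < 2" | "\<bar>x\<bar> < 2" "\<bar>y\<bar> = 2" | "\<bar>x\<bar> = 2" "\<bar>y\<bar> < 2" | "\<bar>x\<bar> = 2" "\<bar>y\<bar> = 2"
        using b by linarith
      then show ?thesis
      proof cases
        case 1
        then show ?thesis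
          using True by (simp add: G_def xy deriv_deriv_V_tr2_log[OF \<sigma>])
      next
        case 2
        have "\<forall>\<^sub>F z in nhds x. z \<in> {-2<..<2}"
          using 2 by (intro eventually_nhds_in_open) (auto simp: abs_less_iff)
        then have "\<forall>\<^sub>F z in nhds x. deriv (\<lambda>y'. V_tr2_log \<sigma> z y') y = c"
          unfolding c_def by eventually_elim (auto intro!: deriv_V_tr2_log_y_edge \<sigma> False 2)
        then have "deriv (\<lambda>x'. deriv (\<lambda>y'. V_tr2_log \<sigma> x' y') y) x = deriv (\<lambda>x'. c) x"
          by (rule deriv_cong_ev) simp
        then show ?thesis using 2 by (simp add: G_def xy)
      next
        case 3
        have "y * (1 + \<sigma>\<^sup>2) \<noteq> 2 * \<sigma> * x"
        proof
          assume "y * (1 + \<sigma>\<^sup>2) = 2 * \<sigma> * x"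
          then have "y = 2 * \<sigma> * x / (1 + \<sigma>\<^sup>2)" using s by (simp add: field_simps)
          moreover have "x = 2 \<or> x = -2" using 3 by (auto simp: abs_if split: if_splits)
          ultimately show False using p by (auto simp: X_def xy)
        qed
        then show ?thesis
          using 3 True deriv_deriv_V_tr2_log_x_edge[OF \<sigma> False 3] by (simp add: G_def xy c_def)
      next
        case 4
        then have "x = 2 \<or> x = -2" "y = 2 \<or> y = -2" by (auto simp: abs_if split: if_splits)
        then show ?thesis using p by (auto simp: X_def xy)
      qed
    qed (simp add: G_def)
  qed (auto simp: X_def)
qed

lemma AE_square_interior:
  "AE p in lborel. p \<in> square \<longrightarrow> \<bar>fst p\<bar> < 2 \<and> \<bar>snd p\<bar> < 2 \<and> fst p \<noteq> snd p"
  using AE_generic_pair[of 2] AE_generic_pair[of "-2"]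
  by eventually_elim (auto simp: square_def abs_less_iff)

lemma V_tr2_open_eq:
  assumes \<sigma>: "\<bar>\<sigma>\<bar> < 1" and [measurable]: "f \<in> borel_measurable borel"
  shows "V_tr2_open f \<sigma> = 1 / (4 * pi\<^sup>2) * (LINT p|lborel. indicator square p *
    (f (fst p) * f (snd p) * (tr_kernel \<sigma> (fst p) (snd p) / (hgt (fst p) * hgt (snd p)))))"
proof -
  note [measurable] = measurable_deriv_deriv_V_tr2_log[OF \<sigma>]
  have "(LINT (x, y):{-2..2} \<times> {-2..2}|lborel.
     f x * f y * deriv (\<lambda>x'. deriv (\<lambda>y'. V_tr2_log \<sigma> x' y') y) x) =
     (LINT p|lborel. f (fst p) * f (snd p) *
        (indicator square p * deriv (\<lambda>x'. deriv (\<lambda>y'. V_tr2_log \<sigma> x' y') (snd p)) (fst p)))"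
    unfolding set_lebesgue_integral_def square_def
    by (intro Bochner_Integration.integral_cong) (auto simp: indicator_def split: prod.splits)
  also have "\<dots> = (LINT p|lborel. indicator square p *
    (f (fst p) * f (snd p) * (tr_kernel \<sigma> (fst p) (snd p) / (hgt (fst p) * hgt (snd p)))))"
  proof (rule integral_cong_AE)
    show "AE p in lborel. f (fst p) * f (snd p) *
        (indicator square p * deriv (\<lambda>x'. deriv (\<lambda>y'. V_tr2_log \<sigma> x' y') (snd p)) (fst p)) =
        indicator square p * (f (fst p) * f (snd p) * (tr_kernel \<sigma> (fst p) (snd p) / (hgt (fst p) * hgt (snd p))))"
      using AE_square_interior
      by eventually_elim (auto simp: indicator_def deriv_deriv_V_tr2_log[OF \<sigma>])
  qed measurable
  finally show ?thesis by (simp add: V_tr2_open_def)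
qed

section \<open>The limits at one\<close>

lemma tendsto_integral_dominated:
  fixes F :: "real \<Rightarrow> 'b \<Rightarrow> real"
  assumes meas: "\<And>\<sigma>. \<sigma> \<in> S \<Longrightarrow> \<sigma> \<noteq> a \<Longrightarrow> F \<sigma> \<in> borel_measurable M" and "F0 \<in> borel_measurable M"
    and "integrable M W"
    and dom: "\<And>\<sigma>. \<sigma> \<in> S \<Longrightarrow> \<sigma> \<noteq> a \<Longrightarrow> AE p in M. \<bar>F \<sigma> p\<bar> \<le> W p"
    and lim: "AE p in M. ((\<lambda>\<sigma>. F \<sigma> p) \<longlongrightarrow> F0 p) (at a within S)"
  shows "((\<lambda>\<sigma>. LINT p|M. F \<sigma> p) \<longlongrightarrow> (LINT p|M. F0 p)) (at a within S)"
  unfolding tendsto_at_iff_sequentially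
proof (intro allI impI)
  fix X :: "nat \<Rightarrow> real"
  assume X: "\<forall>i. X i \<in> S - {a}" "X \<longlonglongrightarrow> a"
  show "((\<lambda>\<sigma>. LINT p|M. F \<sigma> p) \<circ> X) \<longlonglongrightarrow> (LINT p|M. F0 p)"
    unfolding comp_def
  proof (rule integral_dominated_convergence[where w = W])
    show "AE p in M. (\<lambda>i. F (X i) p) \<longlonglongrightarrow> F0 p"
      using lim by eventually_elim (use X in \<open>auto simp: tendsto_at_iff_sequentially comp_def\<close>)
  qed (use X assms in auto)
qed

text \<open>The product majorant makes the three terms of the expansion separately integrable. It is
  available for each fixed |\<sigma>| < 1 without being uniform, so the limit \<sigma> \<rightarrow>
  1 is taken afterwards, in the difference term. The function \<open>m\<close> is the marginal of
  the kernel.\<close>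

lemma polarization:
  fixes k :: "real \<Rightarrow> real \<Rightarrow> real"
  assumes [measurable]: "(\<lambda>p. k (fst p) (snd p)) \<in> borel_measurable borel"
    and sym: "\<And>x y. k x y = k y x" and k: "\<And>x y. \<bar>k x y\<bar> \<le> w x * w y" and w: "integrable lborel w"
    and [measurable]: "f \<in> borel_measurable borel" and f: "\<And>x. \<bar>f x\<bar> \<le> B"
    and m: "AE y in lborel. (LINT x|lborel. k x y) = m y" and [measurable]: "m \<in> borel_measurable borel"
  shows "(LINT p|lborel. f (fst p) * f (snd p) * k (fst p) (snd p)) =
    (LINT y|lborel. (f y)\<^sup>2 * m y) - 1 / 2 * (LINT p|lborel. (f (fst p) - f (snd p))\<^sup>2 * k (fst p) (snd p))"
proof -
  have W: "integrable lborel (\<lambda>p. w (fst p) * w (snd p))"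
    using integral_product(1)[OF w w] by (simp add: case_prod_unfold)
  have int: "integrable lborel (\<lambda>p. g p * k (fst p) (snd p))"
    if [measurable]: "g \<in> borel_measurable borel" and g: "\<And>p. \<bar>g p\<bar> \<le> C" for g C
  proof (rule Bochner_Integration.integrable_bound)
    show "integrable lborel (\<lambda>p. C * (w (fst p) * w (snd p)))"
      using W by (rule integrable_mult_right)
    have "\<bar>g p\<bar> * \<bar>k (fst p) (snd p)\<bar> \<le> C * (w (fst p) * w (snd p))" for p
      using g[of p] k[of "fst p" "snd p"] by (intro mult_mono) auto
    then show "AE p in lborel. norm (g p * k (fst p) (snd p)) \<le> norm (C * (w (fst p) * w (snd p)))"
      by (intro AE_I2) (simp only: real_norm_def abs_mult[of "g _"], rule order_trans[OF _ abs_ge_self])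
  qed measurable
  have f2: "\<bar>(f x)\<^sup>2\<bar> \<le> B\<^sup>2" for x
    using power_mono[OF f[of x], of 2] by simp
  have i1: "integrable lborel (\<lambda>p. (f (fst p))\<^sup>2 * k (fst p) (snd p))"
    by (rule int[where C = "B\<^sup>2"]) (use f2 in auto)
  have i2: "integrable lborel (\<lambda>p. (f (snd p))\<^sup>2 * k (fst p) (snd p))"
    by (rule int[where C = "B\<^sup>2"]) (use f2 in auto)
  have i3: "integrable lborel (\<lambda>p. (f (fst p) - f (snd p))\<^sup>2 * k (fst p) (snd p))"
  proof (rule int[where C = "(2 * B)\<^sup>2"])
    show "\<bar>(f (fst p) - f (snd p))\<^sup>2\<bar> \<le> (2 * B)\<^sup>2" for p
      using power_mono[of "\<bar>f (fst p) - f (snd p)\<bar>" "2 * B" 2] f[of "fst p"] f[of "snd p"]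
        abs_triangle_ineq4[of "f (fst p)" "f (snd p)"] by simp
  qed measurable
  have e1: "(LINT p|lborel. (f (fst p))\<^sup>2 * k (fst p) (snd p)) = (LINT y|lborel. (f y)\<^sup>2 * m y)"
  proof -
    have "(LINT p|lborel. (f (fst p))\<^sup>2 * k (fst p) (snd p)) =
        (LINT x|lborel. (LINT y|lborel. (f x)\<^sup>2 * k x y))"
      using lborel_pair.integral_fst'[of "\<lambda>p. (f (fst p))\<^sup>2 * k (fst p) (snd p)"] i1
      by (simp add: lborel_prod)
    also have "\<dots> = (LINT y|lborel. (f y)\<^sup>2 * m y)"
    proof (rule integral_cong_AE)
      have [measurable]: "(\<lambda>(x, y). k x y) \<in> borel_measurable (borel \<Otimes>\<^sub>M borel)"
        using assms(1) by (simp add: borel_prod case_prod_unfold)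
      show "(\<lambda>x. LINT y|lborel. (f x)\<^sup>2 * k x y) \<in> borel_measurable lborel"
        by measurable
      show "AE x in lborel. (LINT y|lborel. (f x)\<^sup>2 * k x y) = (f x)\<^sup>2 * m x"
        using m by eventually_elim (simp add: sym)
    qed measurable
    finally show ?thesis .
  qed
  have e2: "(LINT p|lborel. (f (snd p))\<^sup>2 * k (fst p) (snd p)) = (LINT y|lborel. (f y)\<^sup>2 * m y)"
  proof -
    have "(LINT p|lborel. (f (snd p))\<^sup>2 * k (fst p) (snd p)) =
        (LINT y|lborel. (LINT x|lborel. (f y)\<^sup>2 * k x y))"
      using lborel_pair.integral_snd[of "\<lambda>x y. (f y)\<^sup>2 * k x y"] i2
      by (simp add: lborel_prod case_prod_unfold)
    also have "\<dots> = (LINT y|lborel. (f y)\<^sup>2 * m y)"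
    proof (rule integral_cong_AE)
      have [measurable]: "(\<lambda>(x, y). k x y) \<in> borel_measurable (borel \<Otimes>\<^sub>M borel)"
        using assms(1) by (simp add: borel_prod case_prod_unfold)
      show "(\<lambda>y. LINT x|lborel. (f y)\<^sup>2 * k x y) \<in> borel_measurable lborel"
        by measurable
      show "AE y in lborel. (LINT x|lborel. (f y)\<^sup>2 * k x y) = (f y)\<^sup>2 * m y"
        using m by eventually_elim simp
    qed measurable
    finally show ?thesis .
  qed
  have "(LINT p|lborel. f (fst p) * f (snd p) * k (fst p) (snd p)) =
      (LINT p|lborel. 1 / 2 * ((f (fst p))\<^sup>2 * k (fst p) (snd p) + (f (snd p))\<^sup>2 * k (fst p) (snd p)
         - (f (fst p) - f (snd p))\<^sup>2 * k (fst p) (snd p)))"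
    by (intro Bochner_Integration.integral_cong) (simp_all add: power2_eq_square algebra_simps)
  also have "\<dots> = 1 / 2 * ((LINT y|lborel. (f y)\<^sup>2 * m y) + (LINT y|lborel. (f y)\<^sup>2 * m y)
      - (LINT p|lborel. (f (fst p) - f (snd p))\<^sup>2 * k (fst p) (snd p)))"
    using i1 i2 i3 e1 e2 by simp
  finally show ?thesis by simp
qed

section \<open>The arcsine weight, which is d\<theta> for x = 2 cos \<theta>\<close>

definition wgt :: "real \<Rightarrow> real" where "wgt x = indicator {-2..2} x * (1 / hgt x)"

lemma measurable_wgt [measurable]: "wgt \<in> borel_measurable borel"
  unfolding wgt_def[abs_def] by measurable

lemma wgt_nonneg: "0 \<le> wgt x"
  using hgt_nonneg[of x] by (auto simp: wgt_def indicator_def abs_le_iff)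

lemma hgt_cos:
  assumes "0 < t" "t < pi"
  shows "hgt (2 * cos t) = 2 * sin t"
proof -
  have "4 - (2 * cos t)\<^sup>2 = (2 * sin t)\<^sup>2"
    by (simp add: power_mult_distrib cos_squared_eq)
  then have "hgt (2 * cos t) = \<bar>2 * sin t\<bar>"
    unfolding hgt_def by (simp only: real_sqrt_abs)
  then show ?thesis using assms sin_gt_zero[of t] by simp
qed

lemma arccos_interior:
  assumes "\<bar>x\<bar> < 2"
  shows "0 < arccos (x / 2)" "arccos (x / 2) < pi" "2 * cos (arccos (x / 2)) = x"
    and "((\<lambda>x. arccos (x / 2)) has_real_derivative - 1 / hgt x) (at x)"
    and "hgt x = 2 * sin (arccos (x / 2))"
proof -
  have x: "-1 < x / 2" "x / 2 < 1" using assms by auto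
  show r: "0 < arccos (x / 2)" "arccos (x / 2) < pi" using arccos_lt_bounded[OF x] by auto
  show c: "2 * cos (arccos (x / 2)) = x" using x by simp
  show h: "hgt x = 2 * sin (arccos (x / 2))" using hgt_cos[OF r] c by simp
  have D: "((\<lambda>x. arccos (x / 2)) has_real_derivative inverse (- sqrt (1 - (x / 2)\<^sup>2)) * (1 / 2)) (at x)"
    using x by (auto intro!: derivative_eq_intros DERIV_chain2[OF DERIV_arccos])
  have "hgt x = 2 * sqrt (1 - (x / 2)\<^sup>2)"
  proof -
    have "4 - x\<^sup>2 = 2\<^sup>2 * (1 - (x / 2)\<^sup>2)" by (simp add: power_divide)
    then show ?thesis unfolding hgt_def by (simp only: real_sqrt_mult real_sqrt_abs)
  qed
  then have "inverse (- sqrt (1 - (x / 2)\<^sup>2)) * (1 / 2) = - 1 / hgt x"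
    by (simp add: inverse_eq_divide)
  with D show "((\<lambda>x. arccos (x / 2)) has_real_derivative - 1 / hgt x) (at x)"
    by (simp only:)
qed

lemma continuous_on_arccos_half: "continuous_on {-2..2} (\<lambda>x. arccos (x / 2))"
  by (intro continuous_intros) auto

lemma wgt_integral: "has_bochner_integral lborel wgt pi"
proof -
  have "has_bochner_integral lborel (\<lambda>x. indicator {-2..2} x * (1 / hgt x)) (- arccos (2 / 2) - (- arccos (- 2 / 2)))"
  proof (rule FTC_interior_nonneg[where F = "\<lambda>x. - arccos (x / 2)"])
    show "continuous_on {-2..2} (\<lambda>x. - arccos (x / 2))"
      by (intro continuous_on_minus continuous_on_arccos_half)
    show "((\<lambda>x. - arccos (x / 2)) has_real_derivative 1 / hgt x) (at x)" if "-2 < x" "x < 2" for x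
      using DERIV_minus[OF arccos_interior(4)[of x]] that by auto
    show "0 \<le> 1 / hgt x" if "-2 < x" "x < 2" for x
      using hgt_nonneg[of x] that by auto
  qed auto
  then show ?thesis by (simp add: wgt_def[abs_def])
qed

lemma wgt_integrable: "integrable lborel wgt"
  using wgt_integral by (simp add: has_bochner_integral_iff)

lemma indicator_square: "indicator square p = indicator {-2..2} (fst p) * (indicator {-2..2} (snd p) :: real)"
  by (cases p) (auto simp: indicator_def square_def)

lemma wgt_wgt: "wgt (fst p) * wgt (snd p) = indicator square p * (1 / (hgt (fst p) * hgt (snd p)))"
  by (simp add: wgt_def indicator_square)

lemma wgt_wgt_integrable: "integrable lborel (\<lambda>p. wgt (fst p) * wgt (snd p))"
  using integral_product(1)[OF wgt_integrable wgt_integrable] by (simp add: case_prod_unfold)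

section \<open>The limit of \<open>V_tr2\<close> at one\<close>

lemma ker_q_bound:
  assumes \<sigma>: "\<bar>\<sigma>\<bar> \<le> 1" and c: "\<bar>c\<bar> \<le> 1" and d: "0 < d" "d \<le> den \<sigma> c"
  shows "\<bar>ker_q \<sigma> c\<bar> \<le> 8 / d\<^sup>2"
proof -
  have s2: "\<sigma>\<^sup>2 \<le> 1" using \<sigma> by (simp add: abs_square_le_1)
  have "\<bar>(1 + \<sigma>\<^sup>2) * c - 2 * \<sigma>\<bar> \<le> \<bar>(1 + \<sigma>\<^sup>2) * c\<bar> + 2 * \<bar>\<sigma>\<bar>"
    using abs_triangle_ineq4[of "(1 + \<sigma>\<^sup>2) * c" "2 * \<sigma>"] by (simp add: abs_mult)
  also have "\<bar>(1 + \<sigma>\<^sup>2) * c\<bar> \<le> 2 * 1"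
    unfolding abs_mult using s2 c by (intro mult_mono) auto
  finally have "\<bar>(1 + \<sigma>\<^sup>2) * c - 2 * \<sigma>\<bar> \<le> 4" using \<sigma> by simp
  then have n: "\<bar>2 * \<sigma>\<bar> * \<bar>(1 + \<sigma>\<^sup>2) * c - 2 * \<sigma>\<bar> \<le> 2 * 4"
    using \<sigma> by (intro mult_mono) auto
  have sq: "d\<^sup>2 \<le> (den \<sigma> c)\<^sup>2" using d by (intro power_mono) auto
  have "\<bar>2 * \<sigma>\<bar> * \<bar>(1 + \<sigma>\<^sup>2) * c - 2 * \<sigma>\<bar> / (den \<sigma> c)\<^sup>2 \<le> 2 * 4 / d\<^sup>2"
    by (rule frac_le[OF _ n zero_less_power[OF d(1)] sq]) simp
  then show ?thesis
    unfolding ker_q_def abs_divide abs_mult[of "2 * \<sigma>"] abs_power2 by simp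
qed

lemma wgt_tr_kernel_bound:
  assumes \<sigma>: "\<bar>\<sigma>\<bar> < 1"
  shows "\<bar>wgt x * wgt y * tr_kernel \<sigma> x y\<bar> \<le> 16 / ((1 - \<bar>\<sigma>\<bar>)\<^sup>2)\<^sup>2 * (wgt x * wgt y)"
proof (cases "\<bar>x\<bar> \<le> 2 \<and> \<bar>y\<bar> \<le> 2")
  case True
  have q: "\<bar>ker_q \<sigma> c\<bar> \<le> 8 / ((1 - \<bar>\<sigma>\<bar>)\<^sup>2)\<^sup>2" if c: "\<bar>c\<bar> \<le> 1" for c
    using \<sigma> by (intro ker_q_bound c den_pos(1)) auto
  have "\<bar>tr_kernel \<sigma> x y\<bar> \<le> 16 / ((1 - \<bar>\<sigma>\<bar>)\<^sup>2)\<^sup>2"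
    using q[OF cosp_cosm_bounds(1)[of x y]] q[OF cosp_cosm_bounds(2)[of x y]] True
      abs_triangle_ineq[of "ker_q \<sigma> (cosp x y)" "ker_q \<sigma> (cosm x y)"]
    unfolding tr_kernel_def by simp
  then show ?thesis
    using wgt_nonneg[of x] wgt_nonneg[of y]
    by (simp only: abs_mult abs_of_nonneg mult.commute[of "_ / _"]) (intro mult_left_mono, auto)
next
  case False
  then have "wgt x = 0 \<or> wgt y = 0" by (auto simp: wgt_def indicator_def abs_le_iff)
  then show ?thesis by auto
qed

text \<open>In x the kernel is the derivative of \<open>dlog\<close>, which vanishes at x = 2 and x
  = -2. With this zero marginal the terms f(x)^2 and f(y)^2 drop out of the polarization.\<close>

lemma integral_wgt_tr_kernel:
  assumes \<sigma>: "\<bar>\<sigma>\<bar> < 1"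
  shows "AE y in lborel. (LINT x|lborel. wgt x * wgt y * tr_kernel \<sigma> x y) = 0"
proof -
  have *: "(LINT x|lborel. wgt x * wgt y * tr_kernel \<sigma> x y) = 0" if y: "y \<noteq> 2" "y \<noteq> -2" for y
  proof (cases "\<bar>y\<bar> < 2")
    case True
    have eq: "wgt x * wgt y * tr_kernel \<sigma> x y = indicator {-2..2} x * (tr_kernel \<sigma> x y / (hgt x * hgt y))" for x
      using True by (auto simp: wgt_def indicator_def abs_less_iff)
    have "integrable lborel (\<lambda>x. wgt x * wgt y * tr_kernel \<sigma> x y)"
    proof (rule Bochner_Integration.integrable_bound)
      show "integrable lborel (\<lambda>x. 16 / ((1 - \<bar>\<sigma>\<bar>)\<^sup>2)\<^sup>2 * (wgt x * wgt y))"
        using wgt_integrable by simp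
      show "AE x in lborel. norm (wgt x * wgt y * tr_kernel \<sigma> x y) \<le> norm (16 / ((1 - \<bar>\<sigma>\<bar>)\<^sup>2)\<^sup>2 * (wgt x * wgt y))"
        by (intro AE_I2, unfold real_norm_def, rule order_trans[OF wgt_tr_kernel_bound[OF \<sigma>] abs_ge_self])
    qed measurable
    then have "(LINT x|lborel. indicator {-2..2} x * (tr_kernel \<sigma> x y / (hgt x * hgt y))) = dlog \<sigma> 2 y - dlog \<sigma> (-2) y"
      unfolding eq using continuous_on_dlog[OF \<sigma> True]
      by (intro FTC_interior_integrable) (auto intro!: dlog_DERIV_x \<sigma> True)
    then show ?thesis unfolding eq by (simp add: dlog_edge)
  next
    case False
    then have "wgt y = 0" using y by (auto simp: wgt_def indicator_def)
    then show ?thesis by simp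
  qed
  show ?thesis
    using AE_lborel_singleton[of 2] AE_lborel_singleton[of "-2"] by eventually_elim (rule *)
qed

lemma V_tr2_open_polarized:
  assumes \<sigma>: "\<bar>\<sigma>\<bar> < 1" and [measurable]: "f \<in> borel_measurable borel" and f: "\<And>x. \<bar>f x\<bar> \<le> B"
  shows "V_tr2_open f \<sigma> = 1 / (4 * pi\<^sup>2) * (LINT p|lborel.
     (f (fst p) - f (snd p))\<^sup>2 * (wgt (fst p) * wgt (snd p)) * (- tr_kernel \<sigma> (fst p) (snd p) / 2))"
proof -
  \<comment> \<open>The bound 16 / (1 - |\<sigma>|)^4 of \<open>wgt_tr_kernel_bound\<close> is the
    square of \<open>?c\<close>, so it splits evenly between the two variables.\<close>
  let ?c = "4 / ((1 - \<bar>\<sigma>\<bar>)\<^sup>2)"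
  have "V_tr2_open f \<sigma> = 1 / (4 * pi\<^sup>2) * (LINT p|lborel. f (fst p) * f (snd p) * (wgt (fst p) * wgt (snd p) * tr_kernel \<sigma> (fst p) (snd p)))"
    unfolding V_tr2_open_eq[OF \<sigma> assms(2)] wgt_wgt by (simp add: algebra_simps)
  also have "(LINT p|lborel. f (fst p) * f (snd p) * (wgt (fst p) * wgt (snd p) * tr_kernel \<sigma> (fst p) (snd p))) =
     (LINT y|lborel. (f y)\<^sup>2 * 0) - 1 / 2 * (LINT p|lborel. (f (fst p) - f (snd p))\<^sup>2 *
       (wgt (fst p) * wgt (snd p) * tr_kernel \<sigma> (fst p) (snd p)))"
  proof (rule polarization[where w = "\<lambda>x. ?c * wgt x"])
    show "wgt x * wgt y * tr_kernel \<sigma> x y = wgt y * wgt x * tr_kernel \<sigma> y x" for x y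
      by (simp add: tr_kernel_commute)
    show "\<bar>wgt x * wgt y * tr_kernel \<sigma> x y\<bar> \<le> ?c * wgt x * (?c * wgt y)" for x y
      using wgt_tr_kernel_bound[OF \<sigma>, of x y] by (simp add: power2_eq_square field_simps)
    show "integrable lborel (\<lambda>x. ?c * wgt x)" using wgt_integrable by simp
  qed (use f integral_wgt_tr_kernel[OF \<sigma>] in auto)
  also have "\<dots> = (LINT p|lborel. (f (fst p) - f (snd p))\<^sup>2 * (wgt (fst p) * wgt (snd p)) * (- tr_kernel \<sigma> (fst p) (snd p) / 2))"
  proof -
    have "(LINT p|lborel. (f (fst p) - f (snd p))\<^sup>2 * (wgt (fst p) * wgt (snd p)) * (- tr_kernel \<sigma> (fst p) (snd p) / 2)) =
        (LINT p|lborel. (- 1 / 2) * ((f (fst p) - f (snd p))\<^sup>2 * (wgt (fst p) * wgt (snd p) * tr_kernel \<sigma> (fst p) (snd p))))"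
      by (intro Bochner_Integration.integral_cong) auto
    then show ?thesis by simp
  qed
  finally show ?thesis .
qed

lemma V_tr1_eq:
  "V_tr1 f = 1 / (4 * pi\<^sup>2) * (LINT p|lborel. (f (fst p) - f (snd p))\<^sup>2 * (wgt (fst p) * wgt (snd p)) *
     ((4 - fst p * snd p) / (fst p - snd p)\<^sup>2))"
  unfolding V_tr1_def set_lebesgue_integral_def hgt_mult wgt_wgt
  by (intro arg_cong2[where f = "(*)"] refl Bochner_Integration.integral_cong)
    (auto simp: square_def power_divide mult_ac split: prod.splits)

definition lip_bound :: "real \<Rightarrow> (real \<Rightarrow> real) \<Rightarrow> bool" where
  "lip_bound L f \<longleftrightarrow> (\<forall>x y. \<bar>f x - f y\<bar> \<le> L * \<bar>x - y\<bar>)"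

lemma lip_bound_power2:
  assumes "lip_bound L f"
  shows "(f x - f y)\<^sup>2 \<le> L\<^sup>2 * (x - y)\<^sup>2"
  using power_mono[of "\<bar>f x - f y\<bar>" "L * \<bar>x - y\<bar>" 2] assms
  by (simp add: lip_bound_def power_mult_distrib)

lemma lip_bound_nonneg: "lip_bound L f \<Longrightarrow> 0 \<le> L"
  unfolding lip_bound_def using abs_ge_zero order_trans by (metis abs_minus_commute diff_zero mult.right_neutral abs_one)

lemma lip_bound_measurable:
  assumes "lip_bound L f"
  shows "f \<in> borel_measurable borel"
proof (rule borel_measurable_continuous_onI)
  have "L-lipschitz_on UNIV f"
    using assms lip_bound_nonneg[OF assms] by (intro lipschitz_onI) (auto simp: lip_bound_def dist_real_def)
  then show "continuous_on UNIV f" by (rule lipschitz_on_continuous_on)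
qed

text \<open>Uniform in \<sigma>, and up to the factor 4 the modulus of the limit -1 / (1 - c). The
  numerator is (1 - \<sigma>)^2 - (1 + \<sigma>^2)(1 - c), and for 2 \<sigma> \<ge> 1 the
  denominator is at least (1 - \<sigma>)^2 + (1 - c).\<close>

lemma abs_ker_q_le:
  assumes "1 / 2 \<le> \<sigma>" "\<sigma> < 1" "\<bar>c\<bar> \<le> 1" "c \<noteq> 1"
  shows "\<bar>ker_q \<sigma> c\<bar> \<le> 4 / (1 - c)"
proof -
  have c: "0 < 1 - c" using assms by auto
  have d: "(1 - \<sigma>)\<^sup>2 + (1 - c) \<le> den \<sigma> c"
  proof -
    have "1 * (1 - c) \<le> (2 * \<sigma>) * (1 - c)" using assms c by (intro mult_right_mono) auto
    then show ?thesis by (simp add: den_eq)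
  qed
  have s2: "\<sigma>\<^sup>2 \<le> 1" using assms by (simp add: abs_square_le_1)
  have "(1 + \<sigma>\<^sup>2) * c - 2 * \<sigma> = (1 - \<sigma>)\<^sup>2 - (1 + \<sigma>\<^sup>2) * (1 - c)"
    by (simp add: power2_eq_square algebra_simps)
  moreover have "(1 + \<sigma>\<^sup>2) * (1 - c) \<le> 2 * (1 - c)"
    using c s2 by (intro mult_right_mono) auto
  moreover have "0 \<le> (1 + \<sigma>\<^sup>2) * (1 - c)" using c by (intro mult_nonneg_nonneg) auto
  moreover have gen: "\<bar>A\<bar> \<le> 2 * D" if "A = S - P" "P \<le> 2 * u" "0 \<le> P" "S + u \<le> D" "0 \<le> S" "0 < u"
    for A S P u D :: real
    using that by arith
  ultimately have n: "\<bar>(1 + \<sigma>\<^sup>2) * c - 2 * \<sigma>\<bar> \<le> 2 * den \<sigma> c"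
    using d c zero_le_power2[of "1 - \<sigma>"] gen by metis
  have dp: "0 < den \<sigma> c" using d c zero_le_power2[of "1 - \<sigma>"] by linarith
  have "\<bar>ker_q \<sigma> c\<bar> = 2 * \<sigma> * \<bar>(1 + \<sigma>\<^sup>2) * c - 2 * \<sigma>\<bar> / (den \<sigma> c)\<^sup>2"
    using assms by (simp add: ker_q_def abs_mult)
  also have "\<dots> \<le> 2 * (2 * den \<sigma> c) / (den \<sigma> c)\<^sup>2"
    using n assms by (intro divide_right_mono mult_mono) auto
  also have "\<dots> = 4 / den \<sigma> c" using dp by (simp add: power2_eq_square)
  also have "\<dots> \<le> 4 / (1 - c)"
  proof (rule divide_left_mono)
    show "1 - c \<le> den \<sigma> c" using d zero_le_power2[of "1 - \<sigma>"] by linarith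
  qed (use c dp in auto)
  finally show ?thesis .
qed

text \<open>Since \<open>ker_q 1 c\<close> is -1 / (1 - c), this turns the kernel of
  \<open>V_tr2\<close> at \<sigma> = 1 into that of \<open>V_tr1\<close>. The two factors 1 -
  \<open>cosp x y\<close> and 1 - \<open>cosm x y\<close> have sum (4 - x y) / 2 and product (x -
  y)^2 / 4.\<close>

lemma cosp_cosm_sum_inverse:
  assumes "\<bar>x\<bar> \<le> 2" "\<bar>y\<bar> \<le> 2" "x \<noteq> y"
  shows "cosp x y \<noteq> 1" "cosm x y \<noteq> 1"
    and "1 / (1 - cosp x y) + 1 / (1 - cosm x y) = 2 * ((4 - x * y) / (x - y)\<^sup>2)"
proof -
  have eq: "(r / 2) / (q / 4) = 2 * (r / q)" for r q :: real by simp
  have p: "(1 - cosp x y) * (1 - cosm x y) = (x - y)\<^sup>2 / 4" by (rule cosp_cosm_prod[OF assms(1,2)])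
  then show ne: "cosp x y \<noteq> 1" "cosm x y \<noteq> 1" using assms(3) by auto
  have "1 / (1 - cosp x y) + 1 / (1 - cosm x y) =
      ((1 - cosm x y) + (1 - cosp x y)) / ((1 - cosp x y) * (1 - cosm x y))"
    using ne by (simp add: add_frac_eq)
  also have "(1 - cosm x y) + (1 - cosp x y) = (4 - x * y) / 2"
    by (simp add: cosp_def cosm_def field_simps)
  finally show "1 / (1 - cosp x y) + 1 / (1 - cosm x y) = 2 * ((4 - x * y) / (x - y)\<^sup>2)"
    unfolding p by (simp only: eq)
qed

lemma V_tr1_integrand_bound:
  assumes f: "lip_bound L f"
  shows "(f (fst p) - f (snd p))\<^sup>2 * (wgt (fst p) * wgt (snd p)) * \<bar>(4 - fst p * snd p) / (fst p - snd p)\<^sup>2\<bar>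
    \<le> 8 * L\<^sup>2 * (wgt (fst p) * wgt (snd p))"
proof (cases "p \<in> square \<and> fst p \<noteq> snd p")
  case True
  then have b: "\<bar>fst p\<bar> \<le> 2" "\<bar>snd p\<bar> \<le> 2" by (auto simp: square_def)
  have "\<bar>fst p * snd p\<bar> \<le> 2 * 2" unfolding abs_mult using b by (intro mult_mono) auto
  then have "\<bar>4 - fst p * snd p\<bar> \<le> 8" by linarith
  then have "(f (fst p) - f (snd p))\<^sup>2 * \<bar>4 - fst p * snd p\<bar> \<le> (L\<^sup>2 * (fst p - snd p)\<^sup>2) * 8"
    using lip_bound_power2[OF f, of "fst p" "snd p"] by (intro mult_mono) auto
  then have "(f (fst p) - f (snd p))\<^sup>2 * \<bar>(4 - fst p * snd p) / (fst p - snd p)\<^sup>2\<bar> \<le> 8 * L\<^sup>2"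
    using True by (simp add: abs_divide divide_simps mult_ac)
  from mult_right_mono[OF this mult_nonneg_nonneg[OF wgt_nonneg[of "fst p"] wgt_nonneg[of "snd p"]]]
  show ?thesis by (simp add: mult_ac)
next
  case False
  then have "f (fst p) - f (snd p) = 0 \<or> wgt (fst p) * wgt (snd p) = 0"
    by (auto simp: wgt_wgt)
  then show ?thesis
    using wgt_nonneg[of "fst p"] wgt_nonneg[of "snd p"] by auto
qed

lemma V_tr2_open_tendsto:
  assumes f: "lip_bound L f" and fB: "\<And>x. \<bar>f x\<bar> \<le> B"
  shows "(V_tr2_open f \<longlongrightarrow> V_tr1 f) (at_left 1)"
proof -
  have [measurable]: "f \<in> borel_measurable borel" by (rule lip_bound_measurable[OF f])
  let ?w = "\<lambda>p. wgt (fst p) * wgt (snd p)" and ?d = "\<lambda>p. (f (fst p) - f (snd p))\<^sup>2"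
  have "((\<lambda>\<sigma>. LINT p|lborel. ?d p * ?w p * (- tr_kernel \<sigma> (fst p) (snd p) / 2)) \<longlongrightarrow>
     (LINT p|lborel. ?d p * ?w p * ((4 - fst p * snd p) / (fst p - snd p)\<^sup>2))) (at 1 within {1/2..1})"
  \<comment> \<open>Here 32 = 4 * 8: half of the kernel is at most 4 times that of
    \<open>V_tr1\<close>, and 8 L^2 comes from \<open>V_tr1_integrand_bound\<close>. Staying above
    1/2 makes \<open>abs_ker_q_le\<close> applicable.\<close>
  proof (rule tendsto_integral_dominated[where W = "\<lambda>p. 32 * L\<^sup>2 * ?w p"])
    show "integrable lborel (\<lambda>p. 32 * L\<^sup>2 * ?w p)"
      using wgt_wgt_integrable by (rule integrable_mult_right)
    fix \<sigma> :: real assume "\<sigma> \<in> {1/2..1}" "\<sigma> \<noteq> 1"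
    then have \<sigma>: "1 / 2 \<le> \<sigma>" "\<sigma> < 1" by auto
    show "AE p in lborel. \<bar>?d p * ?w p * (- tr_kernel \<sigma> (fst p) (snd p) / 2)\<bar> \<le> 32 * L\<^sup>2 * ?w p"
      using AE_square_interior
    proof eventually_elim
      case (elim p)
      show ?case
      proof (cases "p \<in> square")
        case True
        let ?x = "fst p" and ?y = "snd p"
        have b: "\<bar>?x\<bar> \<le> 2" "\<bar>?y\<bar> \<le> 2" "?x \<noteq> ?y" using elim True by auto
        note ne = cosp_cosm_sum_inverse[OF b]
        have "\<bar>tr_kernel \<sigma> ?x ?y\<bar> \<le> 4 / (1 - cosp ?x ?y) + 4 / (1 - cosm ?x ?y)"
          using abs_ker_q_le[OF \<sigma> cosp_cosm_bounds(1)[OF b(1,2)] ne(1)]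
            abs_ker_q_le[OF \<sigma> cosp_cosm_bounds(2)[OF b(1,2)] ne(2)]
            abs_triangle_ineq[of "ker_q \<sigma> (cosp ?x ?y)" "ker_q \<sigma> (cosm ?x ?y)"]
          unfolding tr_kernel_def by linarith
        also have "\<dots> = 4 * (2 * ((4 - ?x * ?y) / (?x - ?y)\<^sup>2))"
          unfolding ne(3)[symmetric] by simp
        finally have K0: "\<bar>tr_kernel \<sigma> ?x ?y\<bar> \<le> 4 * (2 * ((4 - ?x * ?y) / (?x - ?y)\<^sup>2))" .
        have "\<bar>- k / 2\<bar> \<le> 4 * \<bar>r\<bar>" if "\<bar>k\<bar> \<le> 4 * (2 * r)" for k r :: real
          using that by simp
        from this[OF K0] have K: "\<bar>- tr_kernel \<sigma> ?x ?y / 2\<bar> \<le> 4 * \<bar>(4 - ?x * ?y) / (?x - ?y)\<^sup>2\<bar>" .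
        have "\<bar>?d p * ?w p * (- tr_kernel \<sigma> ?x ?y / 2)\<bar> = (?d p * ?w p) * \<bar>- tr_kernel \<sigma> ?x ?y / 2\<bar>"
          using wgt_nonneg[of ?x] wgt_nonneg[of ?y] by (simp add: abs_mult)
        also have "\<dots> \<le> (?d p * ?w p) * (4 * \<bar>(4 - ?x * ?y) / (?x - ?y)\<^sup>2\<bar>)"
          using K wgt_nonneg[of ?x] wgt_nonneg[of ?y] by (intro mult_left_mono) auto
        also have "\<dots> = 4 * (?d p * ?w p * \<bar>(4 - ?x * ?y) / (?x - ?y)\<^sup>2\<bar>)"
          by (simp only: mult_ac)
        also have "\<dots> \<le> 4 * (8 * L\<^sup>2 * ?w p)"
          using V_tr1_integrand_bound[OF f, of p] by (intro mult_left_mono) auto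
        finally show ?thesis by simp
      qed (simp add: wgt_wgt)
    qed
  next
    show "AE p in lborel. ((\<lambda>\<sigma>. ?d p * ?w p * (- tr_kernel \<sigma> (fst p) (snd p) / 2)) \<longlongrightarrow>
        ?d p * ?w p * ((4 - fst p * snd p) / (fst p - snd p)\<^sup>2)) (at 1 within {1/2..1})"
      using AE_square_interior
    proof eventually_elim
      case (elim p)
      show ?case
      proof (cases "p \<in> square")
        case True
        let ?x = "fst p" and ?y = "snd p"
        have b: "\<bar>?x\<bar> \<le> 2" "\<bar>?y\<bar> \<le> 2" "?x \<noteq> ?y" using elim True by auto
        note ne = cosp_cosm_sum_inverse[OF b]
        have q1: "ker_q 1 c = - 1 / (1 - c)" if "c \<noteq> 1" for c
        proof -
          have "ker_q 1 c = - (4 * (1 - c)) / (4 * (1 - c)\<^sup>2)"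
            by (simp add: ker_q_def den_def power2_eq_square algebra_simps)
          moreover have "- (4 * u) / (4 * u\<^sup>2) = - 1 / u" for u :: real
            by (simp add: power2_eq_square)
          ultimately show ?thesis by (simp only:)
        qed
        have d1: "den 1 c \<noteq> 0" if "c \<noteq> 1" for c using that by (simp add: den_def)
        have lim: "((\<lambda>\<sigma>. tr_kernel \<sigma> ?x ?y) \<longlongrightarrow> tr_kernel 1 ?x ?y) (at 1 within {1/2..1})"
          unfolding tr_kernel_def by (intro tendsto_intros d1 ne(1,2))
        have "(4 - ?x * ?y) / (?x - ?y)\<^sup>2 = - tr_kernel 1 ?x ?y / 2"
        proof -
          have "r = - (- 1 / u + - 1 / v) / 2" if "1 / u + 1 / v = 2 * r" for r u v :: real
            using that by simp
          from this[OF ne(3)] show ?thesis unfolding tr_kernel_def q1[OF ne(1)] q1[OF ne(2)] .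
        qed
        then show ?thesis
          using lim by (auto intro!: tendsto_intros)
      qed (simp add: wgt_wgt)
    qed
  qed measurable
  then have "((\<lambda>\<sigma>. 1 / (4 * pi\<^sup>2) * (LINT p|lborel. ?d p * ?w p * (- tr_kernel \<sigma> (fst p) (snd p) / 2))) \<longlongrightarrow> V_tr1 f)
      (at_left 1)"
    unfolding V_tr1_eq at_within_Icc_at_left[of "1/2" "1::real", simplified] by (rule tendsto_mult_left)
  moreover have "\<forall>\<^sub>F \<sigma> in at_left 1. 1 / (4 * pi\<^sup>2) * (LINT p|lborel. ?d p * ?w p * (- tr_kernel \<sigma> (fst p) (snd p) / 2)) = V_tr2_open f \<sigma>"
    unfolding eventually_at_left_field
  proof (intro exI[of _ 0] conjI allI impI)
    fix \<sigma> :: real assume "0 < \<sigma>" "\<sigma> < 1"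
    then have "\<bar>\<sigma>\<bar> < 1" by simp
    then show "1 / (4 * pi\<^sup>2) * (LINT p|lborel. ?d p * ?w p * (- tr_kernel \<sigma> (fst p) (snd p) / 2)) = V_tr2_open f \<sigma>"
      using V_tr2_open_polarized[of \<sigma> f B] fB by simp
  qed simp
  ultimately show ?thesis by (rule Lim_transform_eventually)
qed

lemma V_tr2_one:
  assumes "lip_bound L f" "\<And>x. \<bar>f x\<bar> \<le> B"
  shows "V_tr2 f 1 = V_tr1 f"
  unfolding V_tr2_def extend_to_pm1_def using V_tr2_open_tendsto[OF assms] by (simp add: tendsto_Lim)

section \<open>The Poisson kernel and the limit of \<open>V_d2\<close> at one\<close>

text \<open>A primitive of the Poisson kernel that is smooth across \<open>u = \<pi>\<close>.\<close>

definition pois_prim :: "real \<Rightarrow> real \<Rightarrow> real" where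
  "pois_prim \<sigma> u = u + 2 * arctan (\<sigma> * sin u / (1 - \<sigma> * cos u))"

text \<open>This is the real part of 1 - \<sigma> exp (i u); its positivity makes the arctangent in
  \<open>pois_prim\<close> a global branch of minus the argument of that number.\<close>

lemma one_minus_cos_pos:
  fixes \<sigma> u :: real
  assumes "\<bar>\<sigma>\<bar> < 1"
  shows "0 < 1 - \<sigma> * cos u"
proof -
  have "\<bar>\<sigma> * cos u\<bar> \<le> \<bar>\<sigma>\<bar> * 1"
    unfolding abs_mult by (intro mult_left_mono) auto
  then show ?thesis using assms by simp
qed

lemma DERIV_pois_prim:
  assumes \<sigma>: "\<bar>\<sigma>\<bar> < 1"
  shows "(pois_prim \<sigma> has_real_derivative (1 - \<sigma>\<^sup>2) / den \<sigma> (cos u)) (at u)"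
proof -
  let ?d = "1 - \<sigma> * cos u"
  have d: "0 < ?d" by (rule one_minus_cos_pos[OF \<sigma>])
  have dp: "0 < den \<sigma> (cos u)" by (rule den_pos(2)[OF \<sigma> abs_cos_le_one])
  have D: "den \<sigma> (cos u) = ?d\<^sup>2 + (\<sigma> * sin u)\<^sup>2"
    using sin_cos_squared_add[of u] unfolding den_def by algebra
  have t: "((\<lambda>u. \<sigma> * sin u / (1 - \<sigma> * cos u)) has_real_derivative
      (\<sigma> * cos u * ?d - \<sigma> * sin u * (\<sigma> * sin u)) / (?d * ?d)) (at u)"
    using d by (auto intro!: derivative_eq_intros)
  have "(pois_prim \<sigma> has_real_derivative 1 + 2 * (inverse (1 + (\<sigma> * sin u / ?d)\<^sup>2) *
      ((\<sigma> * cos u * ?d - \<sigma> * sin u * (\<sigma> * sin u)) / (?d * ?d)))) (at u)"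
    unfolding pois_prim_def[abs_def]
    by (intro DERIV_add DERIV_ident DERIV_cmult DERIV_chain2[OF DERIV_arctan t])
  moreover have "inverse (1 + (\<sigma> * sin u / ?d)\<^sup>2) = ?d\<^sup>2 / den \<sigma> (cos u)"
  proof -
    have "1 + (\<sigma> * sin u / ?d)\<^sup>2 = den \<sigma> (cos u) / ?d\<^sup>2"
      unfolding D power_divide using d by (simp add: add_divide_distrib)
    then show ?thesis by simp
  qed
  moreover have "1 + 2 * (?d\<^sup>2 / den \<sigma> (cos u) * ((\<sigma> * cos u * ?d - \<sigma> * sin u * (\<sigma> * sin u)) / (?d * ?d))) =
      (1 - \<sigma>\<^sup>2) / den \<sigma> (cos u)"
  proof -
    have n: "\<sigma> * cos u * ?d - \<sigma> * sin u * (\<sigma> * sin u) = \<sigma> * cos u - \<sigma>\<^sup>2"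
      using sin_cos_squared_add[of u] by algebra
    have "1 + 2 * (?d\<^sup>2 / den \<sigma> (cos u) * ((\<sigma> * cos u - \<sigma>\<^sup>2) / (?d * ?d))) = 1 + 2 * (\<sigma> * cos u - \<sigma>\<^sup>2) / den \<sigma> (cos u)"
      using d by (simp add: power2_eq_square)
    also have "\<dots> = (den \<sigma> (cos u) + 2 * (\<sigma> * cos u - \<sigma>\<^sup>2)) / den \<sigma> (cos u)"
      using dp by (simp add: add_divide_distrib)
    also have "den \<sigma> (cos u) + 2 * (\<sigma> * cos u - \<sigma>\<^sup>2) = 1 - \<sigma>\<^sup>2"
      by (simp add: den_def)
    finally show ?thesis unfolding n .
  qed
  ultimately show ?thesis by simp
qed

text \<open>In angles this is (P(\<theta> - \<phi>) - P(\<theta> + \<phi>)) / \<sigma> for the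
  Poisson kernel P(u) = (1 - \<sigma>^2) / den(cos u), whence its concentration on the
  diagonal.\<close>

definition d_kernel :: "real \<Rightarrow> real \<Rightarrow> real \<Rightarrow> real" where
  "d_kernel \<sigma> x y = (1 - \<sigma>\<^sup>2) * (hgt x * hgt y) / (den \<sigma> (cosp x y) * den \<sigma> (cosm x y))"

definition chi :: "real \<Rightarrow> real" where "chi x = indicator {-2..2} x"

lemma measurable_chi [measurable]: "chi \<in> borel_measurable borel"
  unfolding chi_def[abs_def] by measurable

lemma measurable_d_kernel [measurable]:
  assumes [measurable]: "f \<in> borel_measurable M" "g \<in> borel_measurable M"
  shows "(\<lambda>x. d_kernel \<sigma> (f x) (g x)) \<in> borel_measurable M"
  unfolding d_kernel_def den_def cosp_def cosm_def by measurable

lemma chi_bounds: "0 \<le> chi x" "chi x \<le> 1"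
  by (auto simp: chi_def indicator_def)

lemma integrable_chi: "integrable lborel chi"
  unfolding chi_def[abs_def] by (intro integrable_real_indicator) auto

lemma chi_hgt_nonneg: "0 \<le> chi x * hgt x"
  using hgt_nonneg[of x] by (auto simp: chi_def indicator_def)

lemma integrable_chi_hgt: "integrable lborel (\<lambda>x. chi x * hgt x)"
proof (rule Bochner_Integration.integrable_bound)
  show "integrable lborel (\<lambda>x. 2 * chi x)" using integrable_chi by simp
  show "AE x in lborel. norm (chi x * hgt x) \<le> norm (2 * chi x)"
    using hgt_le hgt_nonneg by (auto simp: chi_def indicator_def)
qed measurable

lemma d_kernel_le:
  assumes \<sigma>: "\<bar>\<sigma>\<bar> \<le> 1" and xy: "\<bar>x\<bar> \<le> 2" "\<bar>y\<bar> \<le> 2"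
    and d: "0 < d" "d \<le> den \<sigma> (cosp x y)" "d \<le> den \<sigma> (cosm x y)"
  shows "\<bar>d_kernel \<sigma> x y\<bar> \<le> 1 / d\<^sup>2 * (hgt x * hgt y)"
proof -
  have dd: "d\<^sup>2 \<le> den \<sigma> (cosp x y) * den \<sigma> (cosm x y)"
    unfolding power2_eq_square using d by (intro mult_mono) auto
  have h: "0 \<le> hgt x * hgt y" using xy hgt_nonneg by simp
  have s: "0 \<le> 1 - \<sigma>\<^sup>2" "1 - \<sigma>\<^sup>2 \<le> 1" using \<sigma> by (auto simp: abs_square_le_1)
  have "\<bar>d_kernel \<sigma> x y\<bar> = (1 - \<sigma>\<^sup>2) * (hgt x * hgt y) / (den \<sigma> (cosp x y) * den \<sigma> (cosm x y))"
    unfolding d_kernel_def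
    by (intro abs_of_nonneg divide_nonneg_pos mult_nonneg_nonneg[OF s(1) h] less_le_trans[OF zero_less_power[OF d(1)] dd])
  also have "\<dots> \<le> 1 * (hgt x * hgt y) / d\<^sup>2"
    by (rule frac_le[OF mult_nonneg_nonneg[OF zero_le_one h] mult_right_mono[OF s(2) h] zero_less_power[OF d(1)] dd])
  finally show ?thesis by simp
qed

lemma d_kernel_bound:
  assumes \<sigma>: "\<bar>\<sigma>\<bar> < 1"
  shows "\<bar>chi x * chi y * d_kernel \<sigma> x y\<bar> \<le> 1 / ((1 - \<bar>\<sigma>\<bar>)\<^sup>2)\<^sup>2 * ((chi x * hgt x) * (chi y * hgt y))"
proof (cases "\<bar>x\<bar> \<le> 2 \<and> \<bar>y\<bar> \<le> 2")
  case True
  let ?e = "(1 - \<bar>\<sigma>\<bar>)\<^sup>2"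
  have "\<bar>d_kernel \<sigma> x y\<bar> \<le> 1 / ?e\<^sup>2 * (hgt x * hgt y)"
    using True \<sigma> by (intro d_kernel_le den_pos(1) cosp_cosm_bounds) auto
  then show ?thesis using True by (simp add: chi_def abs_le_iff indicator_def)
next
  case False
  then show ?thesis by (auto simp: chi_def indicator_def)
qed

text \<open>With x = 2 cos t and \<theta> the angle of y, this is 2/\<sigma> times the integral over
  (0, \<pi>) of sin t (P(t - \<theta>) - P(t + \<theta>)), P the Poisson kernel: in essence the
  first Fourier coefficient of P, which is proportional to \<sigma>, so that \<sigma>
  cancels.\<close>

lemma integral_d_kernel:
  assumes \<sigma>: "0 < \<sigma>" "\<sigma> < 1" and y: "\<bar>y\<bar> < 2"
  shows "(LINT x|lborel. indicator {-2..2} x * d_kernel \<sigma> x y) = 2 * pi * hgt y"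
proof -
  have \<sigma>': "\<bar>\<sigma>\<bar> < 1" using \<sigma> by simp
  define \<theta> where "\<theta> = arccos (y / 2)"
  have y_eq: "y = 2 * cos \<theta>" "hgt y = 2 * sin \<theta>"
    using arccos_interior[OF y] by (simp_all add: \<theta>_def)
  \<comment> \<open>Writing sin t as the sine of (t - \<theta>) + \<theta> or of (t + \<theta>) -
    \<theta> leaves P(u) sin u and P(u) cos u, with primitives \<open>S\<close> and
    \<open>C\<close>. For \<open>C\<close> one uses 2 \<sigma> cos u P(u) = (1 + \<sigma>^2) P(u) -
    (1 - \<sigma>^2).\<close>
  define S where "S u = (1 - \<sigma>\<^sup>2) / (2 * \<sigma>) * ln (den \<sigma> (cos u))" for u
  define C where "C u = ((1 + \<sigma>\<^sup>2) * pois_prim \<sigma> u - (1 - \<sigma>\<^sup>2) * u) / (2 * \<sigma>)" for u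
  define \<Gamma> where "\<Gamma> t = 2 / \<sigma> * (cos \<theta> * (S (t - \<theta>) - S (t + \<theta>)) + sin \<theta> * (C (t - \<theta>) + C (t + \<theta>)))" for t
  let ?P = "\<lambda>u. (1 - \<sigma>\<^sup>2) / den \<sigma> (cos u)"
  have dpos: "0 < den \<sigma> (cos u)" for u by (rule den_pos(2)[OF \<sigma>' abs_cos_le_one])
  have S': "(S has_real_derivative ?P u * sin u) (at u)" for u
  proof -
    have "((\<lambda>u. den \<sigma> (cos u)) has_real_derivative 2 * \<sigma> * sin u) (at u)"
      unfolding den_def by (auto intro!: derivative_eq_intros)
    then have "(S has_real_derivative (1 - \<sigma>\<^sup>2) / (2 * \<sigma>) * (1 / den \<sigma> (cos u) * (2 * \<sigma> * sin u))) (at u)"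
      unfolding S_def[abs_def] by (intro DERIV_cmult DERIV_chain2[OF DERIV_ln_divide] dpos)
    then show ?thesis using \<sigma> by simp
  qed
  have C': "(C has_real_derivative ?P u * cos u) (at u)" for u
  proof -
    have "(C has_real_derivative ((1 + \<sigma>\<^sup>2) * ?P u - (1 - \<sigma>\<^sup>2) * 1) / (2 * \<sigma>)) (at u)"
      unfolding C_def[abs_def]
      by (intro DERIV_cdivide DERIV_diff DERIV_cmult DERIV_pois_prim[OF \<sigma>'] DERIV_ident)
    moreover have "((1 + \<sigma>\<^sup>2) * ?P u - (1 - \<sigma>\<^sup>2) * 1) / (2 * \<sigma>) = ?P u * cos u"
    proof -
      have "(1 + \<sigma>\<^sup>2) * ?P u - (1 - \<sigma>\<^sup>2) * 1 = ?P u * ((1 + \<sigma>\<^sup>2) - den \<sigma> (cos u))"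
      proof -
        have "?P u * den \<sigma> (cos u) = 1 - \<sigma>\<^sup>2" using dpos[of u] by simp
        then show ?thesis by (simp only: right_diff_distrib) (simp add: mult.commute)
      qed
      also have "(1 + \<sigma>\<^sup>2) - den \<sigma> (cos u) = 2 * \<sigma> * cos u" by (simp add: den_def)
      finally show ?thesis using \<sigma> by simp
    qed
    ultimately show ?thesis by simp
  qed
  have shift: "((\<lambda>t. S (t - \<theta>)) has_real_derivative ?P (t - \<theta>) * sin (t - \<theta>)) (at t)"
    "((\<lambda>t. S (t + \<theta>)) has_real_derivative ?P (t + \<theta>) * sin (t + \<theta>)) (at t)"
    "((\<lambda>t. C (t - \<theta>)) has_real_derivative ?P (t - \<theta>) * cos (t - \<theta>)) (at t)"
    "((\<lambda>t. C (t + \<theta>)) has_real_derivative ?P (t + \<theta>) * cos (t + \<theta>)) (at t)" for t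
  proof -
    have l: "((\<lambda>t. t - \<theta>) has_real_derivative 1) (at t)" "((\<lambda>t. t + \<theta>) has_real_derivative 1) (at t)"
      by (auto intro!: derivative_eq_intros)
    show "((\<lambda>t. S (t - \<theta>)) has_real_derivative ?P (t - \<theta>) * sin (t - \<theta>)) (at t)"
      "((\<lambda>t. S (t + \<theta>)) has_real_derivative ?P (t + \<theta>) * sin (t + \<theta>)) (at t)"
      "((\<lambda>t. C (t - \<theta>)) has_real_derivative ?P (t - \<theta>) * cos (t - \<theta>)) (at t)"
      "((\<lambda>t. C (t + \<theta>)) has_real_derivative ?P (t + \<theta>) * cos (t + \<theta>)) (at t)"
      using DERIV_chain2[OF S' l(1)] DERIV_chain2[OF S' l(2)] DERIV_chain2[OF C' l(1)] DERIV_chain2[OF C' l(2)]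
      by simp_all
  qed
  have \<Gamma>': "(\<Gamma> has_real_derivative 2 / \<sigma> * sin t * (?P (t - \<theta>) - ?P (t + \<theta>))) (at t)" for t
  proof -
    have "(\<Gamma> has_real_derivative 2 / \<sigma> * (cos \<theta> * (?P (t - \<theta>) * sin (t - \<theta>) - ?P (t + \<theta>) * sin (t + \<theta>)) +
        sin \<theta> * (?P (t - \<theta>) * cos (t - \<theta>) + ?P (t + \<theta>) * cos (t + \<theta>)))) (at t)"
      unfolding \<Gamma>_def[abs_def] by (intro DERIV_cmult DERIV_add DERIV_diff shift)
    moreover have "cos \<theta> * (P * sin (t - \<theta>) - Q * sin (t + \<theta>)) + sin \<theta> * (P * cos (t - \<theta>) + Q * cos (t + \<theta>)) =
        sin t * (P - Q)" for P Q
      using sin_cos_squared_add[of \<theta>] unfolding sin_diff sin_add cos_diff cos_add by algebra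
    ultimately show ?thesis by (simp only: mult.assoc)
  qed
  have d_kernel_eq: "d_kernel \<sigma> (2 * cos t) y = 1 / \<sigma> * (?P (t - \<theta>) - ?P (t + \<theta>))" if t: "0 < t" "t < pi" for t
  proof -
    have c: "cosp (2 * cos t) y = cos (t + \<theta>)" "cosm (2 * cos t) y = cos (t - \<theta>)"
      using hgt_cos[OF t] y_eq by (simp_all add: cosp_def cosm_def cos_add cos_diff)
    have h: "hgt (2 * cos t) * hgt y = (den \<sigma> (cos (t + \<theta>)) - den \<sigma> (cos (t - \<theta>))) / \<sigma>"
      using hgt_cos[OF t] y_eq \<sigma> by (simp add: den_def cos_add cos_diff field_simps)
    show ?thesis
      unfolding d_kernel_def c h using dpos[of "t + \<theta>"] dpos[of "t - \<theta>"] \<sigma> by (simp add: field_simps)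
  qed
  let ?F = "\<lambda>x. - \<Gamma> (arccos (x / 2))"
  have "(LINT x|lborel. indicator {-2..2} x * d_kernel \<sigma> x y) = ?F 2 - ?F (-2)"
  proof (rule FTC_interior_integrable)
    have "continuous_on UNIV \<Gamma>"
      using \<Gamma>' DERIV_isCont by (intro continuous_at_imp_continuous_on) blast
    then show "continuous_on {-2..2} ?F"
      by (intro continuous_on_minus continuous_on_compose2[OF _ continuous_on_arccos_half]) auto
    show "(?F has_real_derivative d_kernel \<sigma> x y) (at x)" if "-2 < x" "x < 2" for x
    proof -
      have x: "\<bar>x\<bar> < 2" using that by auto
      let ?t = "arccos (x / 2)"
      note a = arccos_interior[OF x]
      have "(?F has_real_derivative - (2 / \<sigma> * sin ?t * (?P (?t - \<theta>) - ?P (?t + \<theta>)) * (- 1 / hgt x))) (at x)"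
        by (intro DERIV_minus DERIV_chain2[OF \<Gamma>' a(4)])
      moreover have "- (2 / \<sigma> * sin ?t * (?P (?t - \<theta>) - ?P (?t + \<theta>)) * (- 1 / hgt x)) = d_kernel \<sigma> x y"
        using d_kernel_eq[OF a(1,2)] hgt_pos[OF x] unfolding a(3) by (simp add: a(5))
      ultimately show ?thesis by simp
    qed
    show "integrable lborel (\<lambda>x. indicator {-2..2} x * d_kernel \<sigma> x y)"
    proof (rule Bochner_Integration.integrable_bound)
      show "integrable lborel (\<lambda>x. 1 / ((1 - \<bar>\<sigma>\<bar>)\<^sup>2)\<^sup>2 * ((chi x * hgt x) * (chi y * hgt y)))"
        using integrable_chi_hgt by simp
      have "chi y = 1" using y by (auto simp: chi_def indicator_def)
      then show "AE x in lborel. norm (indicator {-2..2} x * d_kernel \<sigma> x y) \<le> norm (1 / ((1 - \<bar>\<sigma>\<bar>)\<^sup>2)\<^sup>2 * ((chi x * hgt x) * (chi y * hgt y)))"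
        using order_trans[OF d_kernel_bound[OF \<sigma>', of _ y] abs_ge_self]
        by (intro AE_I2) (simp add: chi_def)
    qed measurable
  qed simp
  also have "\<dots> = 2 * pi * hgt y"
  proof -
    \<comment> \<open>The even periodic function \<open>S\<close> drops out; in \<open>C\<close> the
      arctangents cancel in pairs and the linear part of \<open>pois_prim\<close> remains.\<close>
    have "S (pi - \<theta>) = S (pi + \<theta>)" "S (0 - \<theta>) = S (0 + \<theta>)" by (simp_all add: S_def)
    moreover have "C (pi - \<theta>) + C (pi + \<theta>) - (C (0 - \<theta>) + C (0 + \<theta>)) = 2 * pi * \<sigma>"
    proof -
      have p: "pois_prim \<sigma> (pi - \<theta>) + pois_prim \<sigma> (pi + \<theta>) = 2 * pi"
        "pois_prim \<sigma> (0 - \<theta>) + pois_prim \<sigma> (0 + \<theta>) = 0"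
        by (simp_all add: pois_prim_def arctan_minus)
      have "C (pi - \<theta>) + C (pi + \<theta>) - (C (0 - \<theta>) + C (0 + \<theta>)) =
          ((1 + \<sigma>\<^sup>2) * (pois_prim \<sigma> (pi - \<theta>) + pois_prim \<sigma> (pi + \<theta>)) - (1 - \<sigma>\<^sup>2) * (2 * pi) -
           (1 + \<sigma>\<^sup>2) * (pois_prim \<sigma> (0 - \<theta>) + pois_prim \<sigma> (0 + \<theta>))) / (2 * \<sigma>)"
        unfolding C_def using \<sigma> by (simp add: field_simps)
      also have "\<dots> = 2 * pi * \<sigma>"
        unfolding p using \<sigma> by (simp add: field_simps power2_eq_square)
      finally show ?thesis .
    qed
    moreover have "2 / \<sigma> * (c * (a - a') + s * u) - 2 / \<sigma> * (c * (b - b') + s * v) = 2 / \<sigma> * (s * (u - v))"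
      if "a = a'" "b = b'" for a a' b b' c s u v :: real
      using that by (simp add: right_diff_distrib)
    ultimately have "\<Gamma> pi - \<Gamma> 0 = 2 / \<sigma> * (sin \<theta> * (2 * pi * \<sigma>))"
      unfolding \<Gamma>_def by metis
    then show ?thesis using \<sigma> y_eq by simp
  qed
  finally show ?thesis .
qed

lemma V_d2_open_eq:
  "V_d2_open f \<sigma> = 1 / (4 * pi\<^sup>2) * (LINT p|lborel. f (fst p) * f (snd p) *
     (chi (fst p) * chi (snd p) * d_kernel \<sigma> (fst p) (snd p))) - (avg_sc f)\<^sup>2"
proof -
  have "(LINT (x, y):{-2..2} \<times> {-2..2}|lborel.
     f x * f y * ((1 - \<sigma>\<^sup>2) * sqrt ((4 - x\<^sup>2) * (4 - y\<^sup>2)) /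
       (\<sigma>\<^sup>2 * (x\<^sup>2 + y\<^sup>2) + (1 - \<sigma>\<^sup>2)\<^sup>2 - x * y * \<sigma> * (1 + \<sigma>\<^sup>2)))) =
    (LINT p|lborel. f (fst p) * f (snd p) * (chi (fst p) * chi (snd p) * d_kernel \<sigma> (fst p) (snd p)))"
    unfolding set_lebesgue_integral_def
  proof (intro Bochner_Integration.integral_cong refl)
    fix p :: "real \<times> real"
    obtain x y where p: "p = (x, y)" by (cases p)
    show "indicat_real ({- 2..2} \<times> {- 2..2}) p *\<^sub>R (case p of (x, y) \<Rightarrow>
       f x * f y * ((1 - \<sigma>\<^sup>2) * sqrt ((4 - x\<^sup>2) * (4 - y\<^sup>2)) /
       (\<sigma>\<^sup>2 * (x\<^sup>2 + y\<^sup>2) + (1 - \<sigma>\<^sup>2)\<^sup>2 - x * y * \<sigma> * (1 + \<sigma>\<^sup>2)))) =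
       f (fst p) * f (snd p) * (chi (fst p) * chi (snd p) * d_kernel \<sigma> (fst p) (snd p))"
    proof (cases "\<bar>x\<bar> \<le> 2 \<and> \<bar>y\<bar> \<le> 2")
      case True
      then show ?thesis
        using den_prod[of x y \<sigma>] by (auto simp: p hgt_mult d_kernel_def chi_def indicator_def abs_le_iff)
    next
      case False
      then show ?thesis by (auto simp: p chi_def indicator_def)
    qed
  qed
  then show ?thesis by (simp add: V_d2_open_def)
qed

lemma avg_sc_eq: "avg_sc h = 1 / (2 * pi) * (LINT x|lborel. h x * (chi x * hgt x))"
proof -
  have "avg_sc h = (LINT x|lborel. 1 / (2 * pi) * (h x * (chi x * hgt x)))"
    unfolding avg_sc_def set_lebesgue_integral_def chi_def hgt_def
    by (intro Bochner_Integration.integral_cong) auto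
  then show ?thesis by simp
qed

text \<open>The marginal of \<open>d_kernel\<close> does not depend on \<sigma>, so
  \<open>V_d1 f\<close> appears exactly for every \<sigma> in (0, 1) and only a difference term is
  left to vanish in the limit.\<close>

lemma V_d2_open_polarized:
  assumes \<sigma>: "0 < \<sigma>" "\<sigma> < 1" and [measurable]: "f \<in> borel_measurable borel" and f: "\<And>x. \<bar>f x\<bar> \<le> B"
  shows "V_d2_open f \<sigma> = V_d1 f - 1 / (8 * pi\<^sup>2) * (LINT p|lborel.
     (f (fst p) - f (snd p))\<^sup>2 * (chi (fst p) * chi (snd p) * d_kernel \<sigma> (fst p) (snd p)))"
proof -
  have \<sigma>': "\<bar>\<sigma>\<bar> < 1" using \<sigma> by simp
  let ?c = "1 / (1 - \<bar>\<sigma>\<bar>)\<^sup>2"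
  have "(LINT p|lborel. f (fst p) * f (snd p) * (chi (fst p) * chi (snd p) * d_kernel \<sigma> (fst p) (snd p))) =
     (LINT y|lborel. (f y)\<^sup>2 * (2 * pi * (chi y * hgt y))) - 1 / 2 * (LINT p|lborel. (f (fst p) - f (snd p))\<^sup>2 *
       (chi (fst p) * chi (snd p) * d_kernel \<sigma> (fst p) (snd p)))"
  proof (rule polarization[where w = "\<lambda>x. ?c * (chi x * hgt x)"])
    show "chi x * chi y * d_kernel \<sigma> x y = chi y * chi x * d_kernel \<sigma> y x" for x y
      by (simp add: d_kernel_def cosp_def cosm_def mult_ac)
    show "\<bar>chi x * chi y * d_kernel \<sigma> x y\<bar> \<le> ?c * (chi x * hgt x) * (?c * (chi y * hgt y))" for x y
      using d_kernel_bound[OF \<sigma>', of x y] by (simp add: power2_eq_square mult_ac)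
    show "integrable lborel (\<lambda>x. ?c * (chi x * hgt x))" using integrable_chi_hgt by (rule integrable_mult_right)
    have *: "(LINT x|lborel. chi x * chi y * d_kernel \<sigma> x y) = 2 * pi * (chi y * hgt y)" if y: "y \<noteq> 2" "y \<noteq> -2" for y
    proof (cases "\<bar>y\<bar> < 2")
      case True
      then have "chi y = 1" by (auto simp: chi_def indicator_def)
      then show ?thesis using integral_d_kernel[OF \<sigma> True] by (simp add: chi_def)
    next
      case False
      then have "chi y = 0" using y by (auto simp: chi_def indicator_def)
      then show ?thesis by simp
    qed
    show "AE y in lborel. (LINT x|lborel. chi x * chi y * d_kernel \<sigma> x y) = 2 * pi * (chi y * hgt y)"
      using AE_lborel_singleton[of 2] AE_lborel_singleton[of "-2"] by eventually_elim (rule *)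
  qed (use f in auto)
  also have "(LINT y|lborel. (f y)\<^sup>2 * (2 * pi * (chi y * hgt y))) = 4 * pi\<^sup>2 * avg_sc (\<lambda>x. (f x)\<^sup>2)"
  proof -
    have "(LINT y|lborel. (f y)\<^sup>2 * (2 * pi * (chi y * hgt y))) = (LINT y|lborel. 2 * pi * ((f y)\<^sup>2 * (chi y * hgt y)))"
      by (intro Bochner_Integration.integral_cong) auto
    then show ?thesis by (simp add: avg_sc_eq power2_eq_square)
  qed
  finally show ?thesis
    unfolding V_d2_open_eq V_d1_def by (simp add: right_diff_distrib)
qed

text \<open>For \<sigma> \<ge> 1/2 the product of the denominators is at least (x - y)^2 / 4, which
  the Lipschitz bound cancels. The factor 1 - \<sigma>^2 survives, so the difference term is
  dominated; 16 is 4 from here times 4 from the heights.\<close>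

lemma d_kernel_diff_bound:
  assumes f: "lip_bound L f" and \<sigma>: "1 / 2 \<le> \<sigma>" "\<sigma> < 1" and b: "\<bar>x\<bar> \<le> 2" "\<bar>y\<bar> \<le> 2" "x \<noteq> y"
  shows "\<bar>(f x - f y)\<^sup>2 * d_kernel \<sigma> x y\<bar> \<le> 16 * L\<^sup>2 * (1 - \<sigma>\<^sup>2)"
proof -
  have c: "0 \<le> 1 - cosp x y" "0 \<le> 1 - cosm x y"
    using cosp_cosm_bounds[OF b(1,2)] by auto
  have d: "1 * (1 - c) \<le> den \<sigma> c" if "0 \<le> 1 - c" for c
  proof -
    have "1 * (1 - c) \<le> (2 * \<sigma>) * (1 - c)" using \<sigma> that by (intro mult_right_mono) auto
    then show ?thesis using zero_le_power2[of "1 - \<sigma>"] unfolding den_eq by linarith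
  qed
  have "(1 - cosp x y) * (1 - cosm x y) \<le> den \<sigma> (cosp x y) * den \<sigma> (cosm x y)"
    using c d[OF c(1)] d[OF c(2)] by (intro mult_mono) auto
  then have D: "(x - y)\<^sup>2 / 4 \<le> den \<sigma> (cosp x y) * den \<sigma> (cosm x y)"
    by (simp only: cosp_cosm_prod[OF b(1,2)])
  have xy: "0 < (x - y)\<^sup>2 / 4" using b by simp
  have h: "0 \<le> hgt x * hgt y" "hgt x * hgt y \<le> 2 * 2"
    using hgt_nonneg[OF b(1)] hgt_nonneg[OF b(2)] mult_mono[OF hgt_le[OF b(1)] hgt_le[OF b(2)]] by auto
  have s: "0 \<le> 1 - \<sigma>\<^sup>2" using \<sigma> by (simp add: abs_square_le_1)
  have "\<bar>(f x - f y)\<^sup>2 * d_kernel \<sigma> x y\<bar> = (f x - f y)\<^sup>2 * ((1 - \<sigma>\<^sup>2) * (hgt x * hgt y)) / (den \<sigma> (cosp x y) * den \<sigma> (cosm x y))"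
  proof -
    have "0 \<le> d_kernel \<sigma> x y"
      unfolding d_kernel_def by (intro divide_nonneg_pos mult_nonneg_nonneg[OF s h(1)]) (use D xy in linarith)
    then show ?thesis by (simp add: abs_mult) (simp add: d_kernel_def)
  qed
  also have "\<dots> \<le> (L\<^sup>2 * (x - y)\<^sup>2) * ((1 - \<sigma>\<^sup>2) * (2 * 2)) / ((x - y)\<^sup>2 / 4)"
    using lip_bound_power2[OF f, of x y] h s D xy hgt_nonneg[OF b(1)] hgt_nonneg[OF b(2)]
      hgt_le[OF b(1)] hgt_le[OF b(2)] by (intro frac_le mult_mono mult_nonneg_nonneg) auto
  also have "\<dots> = 16 * L\<^sup>2 * (1 - \<sigma>\<^sup>2)"
    using b(3) by simp
  finally show ?thesis .
qed

lemma V_d2_open_tendsto: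
  assumes f: "lip_bound L f" and fB: "\<And>x. \<bar>f x\<bar> \<le> B"
  shows "(V_d2_open f \<longlongrightarrow> V_d1 f) (at_left 1)"
proof -
  have [measurable]: "f \<in> borel_measurable borel" by (rule lip_bound_measurable[OF f])
  let ?c = "\<lambda>p. chi (fst p) * chi (snd p)" and ?d = "\<lambda>p. (f (fst p) - f (snd p))\<^sup>2"
  have ae: "AE p in lborel. \<bar>?d p * (?c p * d_kernel \<sigma> (fst p) (snd p))\<bar> \<le> 16 * L\<^sup>2 * (1 - \<sigma>\<^sup>2) * ?c p"
    if \<sigma>: "1 / 2 \<le> \<sigma>" "\<sigma> < 1" for \<sigma>
    using AE_square_interior
  proof eventually_elim
    case (elim p)
    show ?case
    proof (cases "p \<in> square")
      case True
      then have b: "\<bar>fst p\<bar> \<le> 2" "\<bar>snd p\<bar> \<le> 2" "fst p \<noteq> snd p" using elim by auto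
      then have "chi (fst p) = 1" "chi (snd p) = 1" by (auto simp: chi_def indicator_def abs_le_iff)
      then show ?thesis using d_kernel_diff_bound[OF f \<sigma> b] by simp
    next
      case False
      then have "?c p = 0" by (cases p) (auto simp: chi_def indicator_def square_def)
      then show ?thesis by (simp only: mult_zero_left mult_zero_right abs_zero order_refl)
    qed
  qed
  have c_int: "integrable lborel ?c"
    using integral_product(1)[OF integrable_chi integrable_chi] by (simp add: case_prod_unfold)
  have "((\<lambda>\<sigma>. LINT p|lborel. ?d p * (?c p * d_kernel \<sigma> (fst p) (snd p))) \<longlongrightarrow> (LINT p|(lborel :: (real \<times> real) measure). 0))
     (at 1 within {1/2..1})"
  proof (rule tendsto_integral_dominated[where W = "\<lambda>p. 16 * L\<^sup>2 * ?c p"])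
    show "integrable lborel (\<lambda>p. 16 * L\<^sup>2 * ?c p)" using c_int by (rule integrable_mult_right)
    fix \<sigma> :: real assume "\<sigma> \<in> {1/2..1}" "\<sigma> \<noteq> 1"
    then have \<sigma>: "1 / 2 \<le> \<sigma>" "\<sigma> < 1" by auto
    show "AE p in lborel. \<bar>?d p * (?c p * d_kernel \<sigma> (fst p) (snd p))\<bar> \<le> 16 * L\<^sup>2 * ?c p"
      using ae[OF \<sigma>]
    proof eventually_elim
      case (elim p)
      have "16 * L\<^sup>2 * (1 - \<sigma>\<^sup>2) * ?c p \<le> 16 * L\<^sup>2 * 1 * ?c p"
        using chi_bounds by (intro mult_right_mono mult_left_mono) auto
      then show ?case using elim by simp
    qed
  next
    show "AE p in lborel. ((\<lambda>\<sigma>. ?d p * (?c p * d_kernel \<sigma> (fst p) (snd p))) \<longlongrightarrow> 0) (at 1 within {1/2..1})"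
      using AE_square_interior
    proof eventually_elim
      case (elim p)
      show ?case
      proof (cases "p \<in> square")
        case True
        then have b: "\<bar>fst p\<bar> \<le> 2" "\<bar>snd p\<bar> \<le> 2" "fst p \<noteq> snd p" using elim by auto
        have "den 1 (cosp (fst p) (snd p)) * den 1 (cosm (fst p) (snd p)) \<noteq> 0"
          using cosp_cosm_sum_inverse(1,2)[OF b] by (simp add: den_def)
        then have "((\<lambda>\<sigma>. ?d p * (?c p * d_kernel \<sigma> (fst p) (snd p))) \<longlongrightarrow> ?d p * (?c p * d_kernel 1 (fst p) (snd p))) (at 1 within {1/2..1})"
          unfolding d_kernel_def by (intro tendsto_intros)
        then show ?thesis by (simp add: d_kernel_def)
      next
        case False
        then have "?c p = 0" by (cases p) (auto simp: chi_def indicator_def square_def)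
        then show ?thesis by (simp only: mult_zero_left mult_zero_right tendsto_const)
      qed
    qed
  qed measurable
  then have "((\<lambda>\<sigma>. LINT p|lborel. ?d p * (?c p * d_kernel \<sigma> (fst p) (snd p))) \<longlongrightarrow> 0) (at_left 1)"
    unfolding at_within_Icc_at_left[of "1/2" "1::real", simplified] by simp
  then have "((\<lambda>\<sigma>. V_d1 f - 1 / (8 * pi\<^sup>2) * (LINT p|lborel. ?d p * (?c p * d_kernel \<sigma> (fst p) (snd p)))) \<longlongrightarrow>
     V_d1 f - 1 / (8 * pi\<^sup>2) * 0) (at_left 1)"
    by (intro tendsto_diff tendsto_const tendsto_mult_left)
  moreover have "\<forall>\<^sub>F \<sigma> in at_left 1. V_d1 f - 1 / (8 * pi\<^sup>2) * (LINT p|lborel. ?d p * (?c p * d_kernel \<sigma> (fst p) (snd p))) = V_d2_open f \<sigma>"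
    unfolding eventually_at_left_field
  proof (intro exI[of _ 0] conjI allI impI)
    fix \<sigma> :: real assume "0 < \<sigma>" "\<sigma> < 1"
    then show "V_d1 f - 1 / (8 * pi\<^sup>2) * (LINT p|lborel. ?d p * (?c p * d_kernel \<sigma> (fst p) (snd p))) = V_d2_open f \<sigma>"
      using V_d2_open_polarized[of \<sigma> f B] fB by simp
  qed simp
  ultimately show ?thesis
    using Lim_transform_eventually by fastforce
qed

lemma V_d2_one:
  assumes "lip_bound L f" "\<And>x. \<bar>f x\<bar> \<le> B"
  shows "V_d2 f 1 = V_d1 f"
  unfolding V_d2_def extend_to_pm1_def using V_d2_open_tendsto[OF assms] by (simp add: tendsto_Lim)

section \<open>The limit of \<open>E_tr\<close> at one\<close>

definition pois_half :: "real \<Rightarrow> real \<Rightarrow> real" where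
  "pois_half \<sigma> x = (1 - \<sigma>\<^sup>2) / ((1 + \<sigma>)\<^sup>2 - \<sigma> * x\<^sup>2)"

lemma pois_half_eq: "pois_half \<sigma> x = (1 - \<sigma>\<^sup>2) / den \<sigma> (x\<^sup>2 / 2 - 1)"
  by (simp add: pois_half_def den_def power2_eq_square algebra_simps)

lemma measurable_pois_half [measurable]: "pois_half \<sigma> \<in> borel_measurable borel"
  unfolding pois_half_def[abs_def] by measurable

lemma avg_inv_sc_eq: "avg_inv_sc h = 1 / pi * (LINT x|lborel. h x * wgt x)"
proof -
  have "avg_inv_sc h = (LINT x|lborel. 1 / pi * (h x * wgt x))"
    unfolding avg_inv_sc_def set_lebesgue_integral_def wgt_def hgt_def
    by (intro Bochner_Integration.integral_cong) auto
  then show ?thesis by simp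
qed

lemma half_angle_bound: "\<bar>x\<bar> \<le> 2 \<Longrightarrow> \<bar>x\<^sup>2 / 2 - 1\<bar> \<le> (1::real)"
  using abs_le_square_iff[of x 2] by (simp add: abs_le_iff)

text \<open>As \<theta> runs through (0, \<pi>), 2 \<theta> runs through a full period of the
  Poisson kernel, whose mass does not depend on \<sigma>. This mass is what leaves (f(2) + f(-2)) /
  2 in the limit.\<close>

lemma pois_half_wgt:
  assumes \<sigma>: "\<bar>\<sigma>\<bar> < 1"
  shows "has_bochner_integral lborel (\<lambda>x. pois_half \<sigma> x * wgt x) pi"
proof -
  let ?F = "\<lambda>x. - (pois_prim \<sigma> (2 * arccos (x / 2)) / 2)"
  have "has_bochner_integral lborel (\<lambda>x. indicator {-2..2} x * (pois_half \<sigma> x * (1 / hgt x))) (?F 2 - ?F (-2))"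
  proof (rule FTC_interior_nonneg)
    have "continuous_on UNIV (pois_prim \<sigma>)"
      using DERIV_pois_prim[OF \<sigma>] DERIV_isCont by (intro continuous_at_imp_continuous_on) blast
    then have c: "continuous_on {-2..2} (\<lambda>x. pois_prim \<sigma> (2 * arccos (x / 2)))"
      by (rule continuous_on_compose2[OF _ continuous_on_mult_left[OF continuous_on_arccos_half]]) auto
    show "continuous_on {-2..2} ?F"
      by (intro continuous_on_minus continuous_on_divide c continuous_on_const) auto
  next
    fix x :: real assume "-2 < x" "x < 2"
    then have x: "\<bar>x\<bar> < 2" by auto
    let ?t = "arccos (x / 2)"
    note a = arccos_interior[OF x]
    have "cos (2 * ?t) = x\<^sup>2 / 2 - 1"
    proof -
      have "cos ?t = x / 2" using a(3) by linarith
      then show ?thesis by (simp only: cos_double_cos power_divide) simp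
    qed
    moreover have "(?F has_real_derivative - ((1 - \<sigma>\<^sup>2) / den \<sigma> (cos (2 * ?t)) * (2 * (- 1 / hgt x)) / 2)) (at x)"
      by (intro DERIV_minus DERIV_cdivide DERIV_chain2[OF DERIV_pois_prim[OF \<sigma>]] DERIV_cmult a(4))
    moreover have "- (A * (2 * (- 1 / h)) / 2) = A * (1 / h)" for A h :: real by simp
    ultimately show "(?F has_real_derivative pois_half \<sigma> x * (1 / hgt x)) (at x)"
      by (simp only: pois_half_eq)
    have "0 < den \<sigma> (x\<^sup>2 / 2 - 1)" "0 \<le> 1 - \<sigma>\<^sup>2"
      using den_pos(2)[OF \<sigma> half_angle_bound[of x]] x \<sigma> by (auto simp: abs_square_le_1)
    then show "0 \<le> pois_half \<sigma> x * (1 / hgt x)"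
      using hgt_pos[OF x] by (simp add: pois_half_eq)
  qed auto
  moreover have "?F 2 - ?F (-2) = pi" by (simp add: pois_prim_def)
  moreover have "(\<lambda>x. indicator {-2..2} x * (pois_half \<sigma> x * (1 / hgt x))) = (\<lambda>x. pois_half \<sigma> x * wgt x)"
    by (auto simp: wgt_def fun_eq_iff)
  ultimately show ?thesis by simp
qed

lemma pois_half_wgt_odd: "(LINT x|lborel. x * (pois_half \<sigma> x * wgt x)) = 0"
proof -
  have "(LINT x|lborel. x * (pois_half \<sigma> x * wgt x)) = (LINT x|lborel. - (x * (pois_half \<sigma> x * wgt x)))"
    by (subst lborel_integral_real_affine[where c = "-1" and t = 0])
      (auto simp: pois_half_def wgt_def hgt_def indicator_def intro!: Bochner_Integration.integral_cong)
  then show ?thesis by simp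
qed

text \<open>Subtracting the chord through the values at 2 and -2 leaves a function that vanishes at
  both ends at the rate 4 - x^2, enough to offset the denominator of \<open>pois_half\<close>
  uniformly in \<sigma>. The chord itself is integrated exactly: its constant by the total mass, its
  slope by symmetry.\<close>

lemma interpolation_bound:
  assumes f: "lip_bound L f" and x: "\<bar>x\<bar> \<le> 2"
  shows "\<bar>f x - ((f 2 + f (-2)) / 2 + x * ((f 2 - f (-2)) / 4))\<bar> \<le> L * (4 - x\<^sup>2)"
proof -
  have L: "\<bar>f x - f 2\<bar> \<le> L * (2 - x)" "\<bar>f x - f (-2)\<bar> \<le> L * (2 + x)"
  proof -
    have "\<bar>f x - f 2\<bar> \<le> L * \<bar>x - 2\<bar>" "\<bar>f x - f (-2)\<bar> \<le> L * \<bar>x - (-2)\<bar>"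
      using f unfolding lip_bound_def by blast+
    moreover have "\<bar>x - 2\<bar> = 2 - x" "\<bar>x - (-2)\<bar> = 2 + x" using x by auto
    ultimately show "\<bar>f x - f 2\<bar> \<le> L * (2 - x)" "\<bar>f x - f (-2)\<bar> \<le> L * (2 + x)"
      by (simp_all add: add.commute)
  qed
  have s: "0 \<le> 2 - x" "0 \<le> 2 + x" using x by (auto simp: abs_le_iff)
  have "f x - ((f 2 + f (-2)) / 2 + x * ((f 2 - f (-2)) / 4)) = (2 + x) / 4 * (f x - f 2) + (2 - x) / 4 * (f x - f (-2))"
    by (simp add: field_simps)
  also have "\<bar>\<dots>\<bar> \<le> (2 + x) / 4 * \<bar>f x - f 2\<bar> + (2 - x) / 4 * \<bar>f x - f (-2)\<bar>"
    using abs_triangle_ineq[of "(2 + x) / 4 * (f x - f 2)" "(2 - x) / 4 * (f x - f (-2))"] s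
    by (simp add: abs_mult)
  also have "\<dots> \<le> (2 + x) / 4 * (L * (2 - x)) + (2 - x) / 4 * (L * (2 + x))"
    using s L by (intro add_mono mult_left_mono) auto
  also have "\<dots> = L * (4 - x\<^sup>2) / 2" by (simp add: field_simps power2_eq_square)
  also have "\<dots> \<le> L * (4 - x\<^sup>2)"
  proof -
    have "0 \<le> L * (4 - x\<^sup>2)"
    proof (rule mult_nonneg_nonneg[OF lip_bound_nonneg[OF f]])
      show "0 \<le> 4 - x\<^sup>2" using hgt_sq[OF x] zero_le_power2[of "hgt x"] by simp
    qed
    then show ?thesis by simp
  qed
  finally show ?thesis .
qed

lemma E_tr_open_tendsto:
  assumes f: "lip_bound L f" and fB: "\<And>x. \<bar>f x\<bar> \<le> B"
  shows "(E_tr_open f \<longlongrightarrow> avg_inv_sc f - (f 2 + f (-2)) / 2) (at_left 1)"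
proof -
  have [measurable]: "f \<in> borel_measurable borel" by (rule lip_bound_measurable[OF f])
  define l where "l x = (f 2 + f (-2)) / 2 + x * ((f 2 - f (-2)) / 4)" for x
  have [measurable]: "l \<in> borel_measurable borel" unfolding l_def[abs_def] by measurable
  have L0: "0 \<le> L" by (rule lip_bound_nonneg[OF f])
  have lim: "((\<lambda>\<sigma>. LINT x|lborel. (f x - l x) * (pois_half \<sigma> x * wgt x)) \<longlongrightarrow> (LINT x|(lborel :: real measure). 0))
     (at 1 within {1/2..1})"
  proof (rule tendsto_integral_dominated[where W = "\<lambda>x. 2 * L * wgt x"])
    show "integrable lborel (\<lambda>x. 2 * L * wgt x)" using wgt_integrable by (rule integrable_mult_right)
    fix \<sigma> :: real assume "\<sigma> \<in> {1/2..1}" "\<sigma> \<noteq> 1"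
    then have \<sigma>: "1 / 2 \<le> \<sigma>" "\<sigma> < 1" by auto
    show "AE x in lborel. \<bar>(f x - l x) * (pois_half \<sigma> x * wgt x)\<bar> \<le> 2 * L * wgt x"
    proof (rule AE_I2)
      fix x :: real
      \<comment> \<open>At x = 2 and x = -2 division by zero gives \<open>wgt x = 0\<close>, so the
        endpoints join the exterior case.\<close>
      consider "\<bar>x\<bar> < 2" | "wgt x = 0"
        by (cases "\<bar>x\<bar> < 2"; cases "\<bar>x\<bar> = 2") (auto simp: wgt_def hgt_edge indicator_def abs_le_iff)
      then show "\<bar>(f x - l x) * (pois_half \<sigma> x * wgt x)\<bar> \<le> 2 * L * wgt x"
      proof cases
        case 1
        then have x: "\<bar>x\<bar> \<le> 2" by simp
        have p: "0 < 4 - x\<^sup>2" using hgt_sq[OF x] zero_less_power[OF hgt_pos[OF 1], of 2] by simp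
        have "1 / 2 * (4 - x\<^sup>2) \<le> \<sigma> * (4 - x\<^sup>2)" using \<sigma> p by (intro mult_right_mono) auto
        then have d: "(4 - x\<^sup>2) / 2 \<le> (1 + \<sigma>)\<^sup>2 - \<sigma> * x\<^sup>2"
        proof -
          have "(1 + \<sigma>)\<^sup>2 - \<sigma> * x\<^sup>2 = (1 - \<sigma>)\<^sup>2 + \<sigma> * (4 - x\<^sup>2)"
            by (simp add: power2_eq_square algebra_simps)
          with \<open>1 / 2 * (4 - x\<^sup>2) \<le> \<sigma> * (4 - x\<^sup>2)\<close> show ?thesis
            using zero_le_power2[of "1 - \<sigma>"] by linarith
        qed
        have s: "0 \<le> 1 - \<sigma>\<^sup>2" "1 - \<sigma>\<^sup>2 \<le> 1" using \<sigma> by (auto simp: abs_square_le_1)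
        have ph: "0 \<le> pois_half \<sigma> x"
          unfolding pois_half_def by (rule divide_nonneg_pos[OF s(1) less_le_trans[OF _ d]]) (use p in simp)
        have ph2: "pois_half \<sigma> x \<le> 1 / ((4 - x\<^sup>2) / 2)"
          unfolding pois_half_def by (rule frac_le[OF _ s(2) _ d]) (use p in auto)
        have "\<bar>f x - l x\<bar> * pois_half \<sigma> x \<le> (L * (4 - x\<^sup>2)) * (1 / ((4 - x\<^sup>2) / 2))"
          using interpolation_bound[OF f x] ph ph2 L0 p unfolding l_def[symmetric] by (intro mult_mono) auto
        also have "\<dots> = 2 * L" using p by simp
        finally show ?thesis
          using mult_right_mono[OF _ wgt_nonneg[of x]] ph wgt_nonneg[of x]
          by (simp add: abs_mult mult.assoc[symmetric])
      qed simp
    qed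
  next
    show "AE x in lborel. ((\<lambda>\<sigma>. (f x - l x) * (pois_half \<sigma> x * wgt x)) \<longlongrightarrow> 0) (at 1 within {1/2..1})"
    proof (rule AE_I2)
      fix x :: real
      consider "\<bar>x\<bar> < 2" | "wgt x = 0"
        by (cases "\<bar>x\<bar> < 2"; cases "\<bar>x\<bar> = 2") (auto simp: wgt_def hgt_edge indicator_def abs_le_iff)
      then show "((\<lambda>\<sigma>. (f x - l x) * (pois_half \<sigma> x * wgt x)) \<longlongrightarrow> 0) (at 1 within {1/2..1})"
      proof cases
        case 1
        then have x: "\<bar>x\<bar> \<le> 2" by simp
        have p: "0 < 4 - x\<^sup>2" using hgt_sq[OF x] zero_less_power[OF hgt_pos[OF 1], of 2] by simp
        then have "(1 + 1)\<^sup>2 - 1 * x\<^sup>2 \<noteq> 0" by simp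
        then have "((\<lambda>\<sigma>. (f x - l x) * (pois_half \<sigma> x * wgt x)) \<longlongrightarrow> (f x - l x) * (pois_half 1 x * wgt x)) (at 1 within {1/2..1})"
          unfolding pois_half_def by (intro tendsto_intros)
        then show ?thesis by (simp add: pois_half_def)
      qed simp
    qed
  qed measurable
  have eq: "E_tr_open f \<sigma> = avg_inv_sc f - (f 2 + f (-2)) / 2 - 1 / pi * (LINT x|lborel. (f x - l x) * (pois_half \<sigma> x * wgt x))"
    if \<sigma>: "0 < \<sigma>" "\<sigma> < 1" for \<sigma>
  proof -
    have pw: "integrable lborel (\<lambda>x. pois_half \<sigma> x * wgt x)" "(LINT x|lborel. pois_half \<sigma> x * wgt x) = pi"
      using pois_half_wgt[of \<sigma>] \<sigma> by (auto simp: has_bochner_integral_iff)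
    have bi: "integrable lborel (\<lambda>x. h x * k x)"
      if [measurable]: "h \<in> borel_measurable borel" and h: "\<And>x. \<bar>x\<bar> \<le> 2 \<Longrightarrow> \<bar>h x\<bar> \<le> C" and k: "integrable lborel k"
        and z: "\<And>x. \<not> \<bar>x\<bar> \<le> 2 \<Longrightarrow> k x = 0" for h k :: "real \<Rightarrow> real" and C
    proof (rule Bochner_Integration.integrable_bound)
      show "integrable lborel (\<lambda>x. C * k x)" using k by simp
      have "\<bar>h x * k x\<bar> \<le> \<bar>C * k x\<bar>" for x
      proof (cases "\<bar>x\<bar> \<le> 2")
        case True
        have "\<bar>h x\<bar> \<le> \<bar>C\<bar>" using h[OF True] by linarith
        then show ?thesis unfolding abs_mult by (rule mult_right_mono) simp
      qed (simp add: z)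
      then show "AE x in lborel. norm (h x * k x) \<le> norm (C * k x)" by simp
      show "(\<lambda>x. h x * k x) \<in> borel_measurable lborel" using k by measurable
    qed
    have z: "wgt x = 0" if "\<not> \<bar>x\<bar> \<le> 2" for x using that by (auto simp: wgt_def indicator_def)
    have i1: "integrable lborel (\<lambda>x. f x * wgt x)"
      by (rule bi[where C = B]) (use fB wgt_integrable z in auto)
    have i2: "integrable lborel (\<lambda>x. f x * (pois_half \<sigma> x * wgt x))"
      by (rule bi[where C = B]) (use fB pw z in auto)
    have i3: "integrable lborel (\<lambda>x. x * (pois_half \<sigma> x * wgt x))"
      by (rule bi[where C = 2]) (use pw z in auto)
    have l_int: "has_bochner_integral lborel (\<lambda>x. l x * (pois_half \<sigma> x * wgt x)) ((f 2 + f (-2)) / 2 * pi)"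
    proof -
      have e: "(\<lambda>x. l x * (pois_half \<sigma> x * wgt x)) = (\<lambda>x. (f 2 + f (-2)) / 2 * (pois_half \<sigma> x * wgt x) +
          (f 2 - f (-2)) / 4 * (x * (pois_half \<sigma> x * wgt x)))"
        by (auto simp: l_def fun_eq_iff algebra_simps)
      show ?thesis
        unfolding has_bochner_integral_iff e using pw i3 pois_half_wgt_odd[of \<sigma>] by simp
    qed
    have "E_tr_open f \<sigma> = 1 / pi * (LINT x|lborel. f x * wgt x - f x * (pois_half \<sigma> x * wgt x))"
      unfolding E_tr_open_def avg_inv_sc_eq pois_half_def[symmetric]
      by (intro arg_cong2[where f = "(*)"] refl Bochner_Integration.integral_cong) (auto simp: algebra_simps)
    also have "(LINT x|lborel. f x * wgt x - f x * (pois_half \<sigma> x * wgt x)) =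
        (LINT x|lborel. f x * wgt x) - (LINT x|lborel. f x * (pois_half \<sigma> x * wgt x))"
      using i1 i2 by simp
    also have "(LINT x|lborel. f x * (pois_half \<sigma> x * wgt x)) =
        (LINT x|lborel. (f x - l x) * (pois_half \<sigma> x * wgt x)) + (f 2 + f (-2)) / 2 * pi"
      using i2 l_int by (simp add: left_diff_distrib has_bochner_integral_iff)
    finally show ?thesis
    proof -
      assume *: "E_tr_open f \<sigma> = 1 / pi * ((LINT x|lborel. f x * wgt x) -
        ((LINT x|lborel. (f x - l x) * (pois_half \<sigma> x * wgt x)) + (f 2 + f (- 2)) / 2 * pi))"
      have "1 / pi * (F - (G + c * pi)) = 1 / pi * F - c - 1 / pi * G" for F G c :: real
        by (simp add: right_diff_distrib distrib_left)
      with * show ?thesis unfolding avg_inv_sc_eq by (simp only:)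
    qed
  qed
  have "((\<lambda>\<sigma>. LINT x|lborel. (f x - l x) * (pois_half \<sigma> x * wgt x)) \<longlongrightarrow> 0) (at_left 1)"
    using lim unfolding at_within_Icc_at_left[of "1/2" "1::real", simplified] by simp
  then have "((\<lambda>\<sigma>. avg_inv_sc f - (f 2 + f (-2)) / 2 - 1 / pi * (LINT x|lborel. (f x - l x) * (pois_half \<sigma> x * wgt x))) \<longlongrightarrow>
     avg_inv_sc f - (f 2 + f (-2)) / 2 - 1 / pi * 0) (at_left 1)"
    by (intro tendsto_diff tendsto_const tendsto_mult_left)
  moreover have "\<forall>\<^sub>F \<sigma> in at_left 1. avg_inv_sc f - (f 2 + f (-2)) / 2 - 1 / pi * (LINT x|lborel. (f x - l x) * (pois_half \<sigma> x * wgt x)) = E_tr_open f \<sigma>"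
    unfolding eventually_at_left_field
  proof (intro exI[of _ 0] conjI allI impI)
    fix \<sigma> :: real assume "0 < \<sigma>" "\<sigma> < 1"
    then show "avg_inv_sc f - (f 2 + f (-2)) / 2 - 1 / pi * (LINT x|lborel. (f x - l x) * (pois_half \<sigma> x * wgt x)) = E_tr_open f \<sigma>"
      by (rule eq[symmetric])
  qed simp
  ultimately show ?thesis
    using Lim_transform_eventually by fastforce
qed

lemma E_tr_one:
  assumes "lip_bound L f" "\<And>x. \<bar>f x\<bar> \<le> B"
  shows "E_tr f 1 = avg_inv_sc f - (f 2 + f (-2)) / 2"
  unfolding E_tr_def extend_to_pm1_def using E_tr_open_tendsto[OF assms] by (simp add: tendsto_Lim)

section \<open>Kernels away from one\<close>

lemma pi_sq_ge: "4 \<le> pi\<^sup>2"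
  using power_mono[of 2 pi 2] pi_ge_two by simp

lemma abs_integral_le:
  fixes F G :: "'a \<Rightarrow> real"
  assumes "F \<in> borel_measurable M" "integrable M G" "AE x in M. \<bar>F x\<bar> \<le> G x"
  shows "\<bar>LINT x|M. F x\<bar> \<le> (LINT x|M. G x)"
proof -
  have F: "integrable M F"
    by (rule Bochner_Integration.integrable_bound[OF assms(2,1)])
      (use assms(3) in \<open>auto elim!: eventually_mono\<close>)
  have "\<bar>LINT x|M. F x\<bar> \<le> (LINT x|M. \<bar>F x\<bar>)"
    by (rule integral_abs_bound)
  also have "\<dots> \<le> (LINT x|M. G x)"
    using integrable_abs[OF F] assms(2,3) by (rule integral_mono_AE)
  finally show ?thesis .
qed

text \<open>For nonnegative cosines a negative \<sigma> only increases the denominator beyond 1, so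
  the bound holds down to \<sigma> = -1: the singularity there sits at cosine -1, that is at x = -y,
  away from a single edge.\<close>

lemma den_lower:
  assumes "-1 \<le> \<sigma>" "\<sigma> \<le> 1 - \<epsilon>" "0 < \<epsilon>" "0 \<le> c" "c \<le> 1"
  shows "min 1 (\<epsilon>\<^sup>2) \<le> den \<sigma> c"
proof (cases "0 \<le> \<sigma>")
  case True
  have "\<epsilon>\<^sup>2 \<le> (1 - \<sigma>)\<^sup>2" using assms by (intro power_mono) auto
  moreover have "0 \<le> 2 * \<sigma> * (1 - c)" using True assms by simp
  ultimately show ?thesis unfolding den_eq by linarith
next
  case False
  then have "\<sigma> * c \<le> 0" using assms by (simp add: mult_nonpos_nonneg)
  then show ?thesis unfolding den_def using zero_le_power2[of \<sigma>] by linarith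
qed

lemma cosp_cosm_nonneg:
  assumes "\<bar>s\<bar> = 1" "\<bar>x\<bar> \<le> 2" "\<bar>y\<bar> \<le> 2" "3 / 2 \<le> s * x" "3 / 2 \<le> s * y"
  shows "0 \<le> cosp x y" "0 \<le> cosm x y"
proof -
  have s2: "s * s = 1" using assms(1) by (auto simp: abs_if split: if_splits)
  have "9 / 4 \<le> (s * x) * (s * y)"
    using mult_mono[OF assms(4,5)] assms(4) by simp
  then have xy: "9 / 4 \<le> x * y" using s2 by (simp add: mult.left_commute mult.assoc) (metis mult.assoc mult_1)
  have sq: "9 / 4 \<le> z\<^sup>2" if "3 / 2 \<le> s * z" for z
  proof -
    have "(3 / 2)\<^sup>2 \<le> (s * z)\<^sup>2" using that by (intro power_mono) auto
    moreover have "(s * z)\<^sup>2 = (s * s) * z\<^sup>2" by (simp add: power2_eq_square)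
    ultimately show ?thesis using s2 by (simp add: power_divide)
  qed
  have h: "hgt z \<le> 3 / 2" if "\<bar>z\<bar> \<le> 2" "3 / 2 \<le> s * z" for z
  proof (rule power2_le_imp_le)
    show "(hgt z)\<^sup>2 \<le> (3 / 2)\<^sup>2" using hgt_sq[OF that(1)] sq[OF that(2)] by (simp add: power2_eq_square)
  qed simp
  have hh: "0 \<le> hgt x * hgt y" using hgt_nonneg assms by simp
  have "hgt x * hgt y \<le> (3 / 2) * (3 / 2)"
    using h hgt_nonneg assms by (intro mult_mono) auto
  then show "0 \<le> cosp x y" "0 \<le> cosm x y"
    using xy hh by (simp_all add: cosp_def cosm_def)
qed

text \<open>Near a single edge the denominators stay above min 1 (\<epsilon>^2), with \<sigma> = -1
  included. The two positivity facts provide the continuity in \<sigma> that the limit \<sigma>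
  \<rightarrow> -1 requires.\<close>

lemma edge_kernel_bounds:
  assumes \<sigma>: "-1 \<le> \<sigma>" "\<sigma> \<le> 1 - \<epsilon>" "0 < \<epsilon>" and x: "\<bar>s\<bar> = 1" "\<bar>x\<bar> \<le> 2" "3 / 2 \<le> s * x"
  shows "\<lbrakk>\<bar>y\<bar> \<le> 2; 3 / 2 \<le> s * y\<rbrakk> \<Longrightarrow> \<bar>tr_kernel \<sigma> x y\<bar> \<le> 16 / (min 1 (\<epsilon>\<^sup>2))\<^sup>2"
    and "\<lbrakk>\<bar>y\<bar> \<le> 2; 3 / 2 \<le> s * y\<rbrakk> \<Longrightarrow> \<bar>d_kernel \<sigma> x y\<bar> \<le> 1 / (min 1 (\<epsilon>\<^sup>2))\<^sup>2 * (hgt x * hgt y)"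
    and "\<lbrakk>\<bar>y\<bar> \<le> 2; 3 / 2 \<le> s * y\<rbrakk> \<Longrightarrow> 0 < den \<sigma> (cosp x y) \<and> 0 < den \<sigma> (cosm x y)"
    and "\<bar>1 - pois_half \<sigma> x\<bar> \<le> 1 + 1 / min 1 (\<epsilon>\<^sup>2)" and "0 < den \<sigma> (x\<^sup>2 / 2 - 1)"
proof -
  let ?c = "min 1 (\<epsilon>\<^sup>2)"
  have c0: "0 < ?c" using \<sigma> by simp
  have \<sigma>1: "\<bar>\<sigma>\<bar> \<le> 1" using \<sigma> by auto
  then have s2: "0 \<le> 1 - \<sigma>\<^sup>2" "1 - \<sigma>\<^sup>2 \<le> 1" by (auto simp: abs_square_le_1)
  {
    assume y: "\<bar>y\<bar> \<le> 2" "3 / 2 \<le> s * y"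
    note cc = cosp_cosm_nonneg[OF x(1,2) y(1) x(3) y(2)] cosp_cosm_bounds[OF x(2) y(1)]
    have d: "?c \<le> den \<sigma> (cosp x y)" "?c \<le> den \<sigma> (cosm x y)"
      using den_lower[OF \<sigma>] cc by auto
    show "0 < den \<sigma> (cosp x y) \<and> 0 < den \<sigma> (cosm x y)" using d c0 by linarith
    show "\<bar>tr_kernel \<sigma> x y\<bar> \<le> 16 / ?c\<^sup>2"
      using ker_q_bound[OF \<sigma>1 cc(3) c0 d(1)] ker_q_bound[OF \<sigma>1 cc(4) c0 d(2)] abs_triangle_ineq[of "ker_q \<sigma> (cosp x y)" "ker_q \<sigma> (cosm x y)"]
      unfolding tr_kernel_def by simp
    show "\<bar>d_kernel \<sigma> x y\<bar> \<le> 1 / ?c\<^sup>2 * (hgt x * hgt y)"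
      by (rule d_kernel_le[OF \<sigma>1 x(2) y(1) c0 d])
  }
  have s1: "s * s = 1" using x(1) by (auto simp: abs_if split: if_splits)
  have "(3 / 2)\<^sup>2 \<le> (s * x)\<^sup>2" using x(3) by (intro power_mono) auto
  moreover have "(s * x)\<^sup>2 = (s * s) * x\<^sup>2" by (simp add: power2_eq_square)
  ultimately have "9 / 4 \<le> x\<^sup>2" using s1 by (simp add: power_divide)
  then have D: "?c \<le> den \<sigma> (x\<^sup>2 / 2 - 1)"
    using half_angle_bound[OF x(2)] by (intro den_lower[OF \<sigma>]) auto
  then show "0 < den \<sigma> (x\<^sup>2 / 2 - 1)" using c0 by linarith
  have "0 \<le> pois_half \<sigma> x"
    unfolding pois_half_eq by (rule divide_nonneg_pos[OF s2(1) less_le_trans[OF c0 D]])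
  moreover have "pois_half \<sigma> x \<le> 1 / ?c"
    unfolding pois_half_eq by (rule frac_le[OF _ s2(2) c0 D]) simp
  ultimately show "\<bar>1 - pois_half \<sigma> x\<bar> \<le> 1 + 1 / ?c"
    by (intro abs_leI) linarith+
qed

section \<open>Integrals of the weights near one edge\<close>

definition edge :: "real \<Rightarrow> real \<Rightarrow> real \<Rightarrow> real" where
  "edge s \<delta> x = indicator {x. 2 - \<delta> \<le> s * x} x"

lemma measurable_edge [measurable]: "edge s \<delta> \<in> borel_measurable borel"
  unfolding edge_def[abs_def] by measurable

lemma edge_bounds: "0 \<le> edge s \<delta> x" "edge s \<delta> x \<le> 1"
  by (auto simp: edge_def indicator_def)

lemma integrable_edge_mult:
  "integrable lborel k \<Longrightarrow> integrable lborel (\<lambda>x. edge s \<delta> x * k x :: real)"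
  unfolding edge_def by (rule integrable_real_mult_indicator[of "{x. 2 - \<delta> \<le> s * x}", unfolded mult.commute[of _ "indicator _ _"]]) measurable

lemma hgt_minus: "hgt (- x) = hgt x" and wgt_minus: "wgt (- x) = wgt x" and chi_minus: "chi (- x) = chi x"
  by (auto simp: hgt_def wgt_def chi_def indicator_def)

lemma edge_reflect:
  assumes "\<bar>s\<bar> = 1" "\<And>x. k (- x) = k x"
  shows "(LINT x|lborel. edge s \<delta> x * k x) = (LINT x|lborel. edge 1 \<delta> x * (k x :: real))"
proof -
  have "s = 1 \<or> s = -1" using assms(1) by (auto simp: abs_if split: if_splits)
  then show ?thesis
  proof
    assume s: "s = -1"
    show ?thesis
      unfolding s by (subst lborel_integral_real_affine[where c = "-1" and t = 0])
        (auto simp: assms(2) edge_def indicator_def intro!: Bochner_Integration.integral_cong)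
  qed simp
qed

text \<open>Near the edge hgt^2 = (2 - x)(2 + x) is at least 2 - x, so the arcsine weight has mass
  of order sqrt \<delta>; the semicircle weight in \<open>integral_edge_hgt\<close> gains a factor
  \<delta>.\<close>

lemma integral_edge_wgt:
  assumes "\<bar>s\<bar> = 1" "0 \<le> \<delta>" "\<delta> \<le> 1"
  shows "(LINT x|lborel. edge s \<delta> x * wgt x) \<le> 2 * sqrt \<delta>"
proof -
  have "has_bochner_integral lborel (\<lambda>x. indicator {2 - \<delta>..2} x * (1 / sqrt (2 - x))) (- 2 * sqrt (2 - 2) - (- 2 * sqrt (2 - (2 - \<delta>))))"
  proof (rule FTC_interior_nonneg)
    show "((\<lambda>x. - 2 * sqrt (2 - x)) has_real_derivative 1 / sqrt (2 - x)) (at x)" if "2 - \<delta> < x" "x < 2" for x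
      using that by (auto intro!: derivative_eq_intros simp: field_simps)
  qed (use assms in \<open>auto intro!: continuous_intros\<close>)
  then have *: "integrable lborel (\<lambda>x. indicator {2 - \<delta>..2} x * (1 / sqrt (2 - x)))"
    "(LINT x|lborel. indicator {2 - \<delta>..2} x * (1 / sqrt (2 - x))) = 2 * sqrt \<delta>"
    by (auto simp: has_bochner_integral_iff)
  have "(LINT x|lborel. edge 1 \<delta> x * wgt x) \<le> (LINT x|lborel. indicator {2 - \<delta>..2} x * (1 / sqrt (2 - x)))"
  proof (rule integral_mono_AE[OF integrable_edge_mult[OF wgt_integrable] *(1)])
    show "AE x in lborel. edge 1 \<delta> x * wgt x \<le> indicator {2 - \<delta>..2} x * (1 / sqrt (2 - x))"
      using AE_lborel_singleton[of 2]
    proof eventually_elim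
      case (elim x)
      show ?case
      proof (cases "2 - \<delta> \<le> x \<and> x \<le> 2")
        case True
        then have x: "1 \<le> x" "x < 2" using assms elim by auto
        have "1 * (2 - x) \<le> (2 + x) * (2 - x)" using x by (intro mult_right_mono) auto
        then have "sqrt (2 - x) \<le> hgt x"
          unfolding hgt_def by (intro real_sqrt_le_mono) (simp add: power2_eq_square algebra_simps)
        then show ?thesis using True x by (simp add: edge_def wgt_def frac_le)
      qed (auto simp: edge_def wgt_def indicator_def)
    qed
  qed
  then show ?thesis
    using edge_reflect[where k = wgt, OF assms(1) wgt_minus] * by simp
qed

lemma integral_edge_hgt:
  assumes "\<bar>s\<bar> = 1" "0 \<le> \<delta>" "\<delta> \<le> 1"
  shows "(LINT x|lborel. edge s \<delta> x * (chi x * hgt x)) \<le> 2 * sqrt \<delta> * \<delta>"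
proof -
  have "(LINT x|lborel. edge 1 \<delta> x * (chi x * hgt x)) \<le> (LINT x|lborel. 2 * sqrt \<delta> * indicator {2 - \<delta>..2} x)"
  proof (rule integral_mono[OF integrable_edge_mult[OF integrable_chi_hgt]])
    fix x :: real
    show "edge 1 \<delta> x * (chi x * hgt x) \<le> 2 * sqrt \<delta> * indicator {2 - \<delta>..2} x"
    proof (cases "2 - \<delta> \<le> x \<and> x \<le> 2")
      case True
      then have "(2 + x) * (2 - x) \<le> 4 * \<delta>" using assms by (intro mult_mono) auto
      then have "hgt x \<le> sqrt (4 * \<delta>)"
        unfolding hgt_def by (intro real_sqrt_le_mono) (simp add: power2_eq_square algebra_simps)
      also have "\<dots> = 2 * sqrt \<delta>" by (simp add: real_sqrt_mult)
      finally show ?thesis using True assms by (simp add: edge_def chi_def indicator_def)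
    qed (auto simp: edge_def chi_def indicator_def)
  qed (simp add: emeasure_lborel_Icc_eq)
  also have "\<dots> = 2 * sqrt \<delta> * \<delta>" using assms by simp
  finally show ?thesis
    using edge_reflect[where k = "\<lambda>x. chi x * hgt x", OF assms(1)] by (simp add: chi_minus hgt_minus)
qed

section \<open>Bounds away from one for functions supported near one edge\<close>

lemma extend_to_pm1_bound:
  assumes "\<And>\<sigma>. -1 < \<sigma> \<Longrightarrow> \<sigma> \<le> 1 - \<epsilon> \<Longrightarrow> \<bar>F \<sigma>\<bar> \<le> b" and lim: "(F \<longlongrightarrow> l) (at_right (-1))"
    and \<epsilon>: "0 < \<epsilon>" "\<epsilon> \<le> 1" and \<sigma>: "-1 \<le> \<sigma>" "\<sigma> \<le> 1 - \<epsilon>"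
  shows "\<bar>extend_to_pm1 F \<sigma>\<bar> \<le> b"
proof (cases "\<sigma> = -1")
  case True
  \<comment> \<open>At \<sigma> = -1 the value is a \<open>Lim\<close>, meaningful because the limit
    exists; the bound passes to it from the right. As \<epsilon> \<le> 1, the first assumption
    covers all \<sigma> in (-1, 0).\<close>
  have "((\<lambda>\<sigma>. \<bar>F \<sigma>\<bar>) \<longlongrightarrow> \<bar>l\<bar>) (at_right (-1))"
    using lim by (rule tendsto_rabs)
  moreover have "\<forall>\<^sub>F \<sigma> in at_right (-1). \<bar>F \<sigma>\<bar> \<le> b"
    unfolding eventually_at_right_field using assms(1) \<epsilon> by (intro exI[of _ 0]) auto
  ultimately have "\<bar>l\<bar> \<le> b"
    using tendsto_upperbound trivial_limit_at_right_real by blast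
  then show ?thesis
    using True lim by (simp add: extend_to_pm1_def tendsto_Lim)
next
  case False
  then show ?thesis using assms by (auto simp: extend_to_pm1_def)
qed

text \<open>Collects what the estimates away from \<sigma> = 1 use: the size of \<open>f\<close> and
  its support inside [-2, 2]. The bound \<delta> \<le> 1/2 puts that support where both cosines are
  nonnegative.\<close>

locale edge_function =
  fixes f :: "real \<Rightarrow> real" and s \<delta> M \<epsilon> :: real
  assumes f_meas [measurable]: "f \<in> borel_measurable borel"
    and s: "\<bar>s\<bar> = 1" and \<delta>: "0 \<le> \<delta>" "\<delta> \<le> 1 / 2"
    and f_edge: "\<And>x. \<bar>x\<bar> \<le> 2 \<Longrightarrow> \<bar>f x\<bar> \<le> M * edge s \<delta> x"
    and \<epsilon>: "0 < \<epsilon>" "\<epsilon> \<le> 1"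
begin

abbreviation "c\<epsilon> \<equiv> min 1 (\<epsilon>\<^sup>2)"

lemma M_nonneg: "0 \<le> M"
proof -
  have "\<bar>f (2 * s)\<bar> \<le> M * edge s \<delta> (2 * s)" using f_edge[of "2 * s"] s by (simp add: abs_mult)
  moreover have "edge s \<delta> (2 * s) = 1"
    using s \<delta> by (auto simp: edge_def abs_if split: if_splits)
  ultimately show ?thesis by (metis abs_ge_zero mult.right_neutral order_trans)
qed

lemma edge_point: "\<bar>x\<bar> \<le> 2 \<Longrightarrow> f x \<noteq> 0 \<Longrightarrow> 3 / 2 \<le> s * x"
  using f_edge[of x] \<delta> by (cases "2 - \<delta> \<le> s * x") (auto simp: edge_def)

text \<open>If f x and f y are both nonzero, x and y lie near the same edge, where the kernel bounds
  apply; the majorant then factorizes.\<close>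

lemma pair_bound:
  assumes "\<And>x. 0 \<le> w x" and "\<And>x. \<not> \<bar>x\<bar> \<le> 2 \<Longrightarrow> w x = 0" and "0 \<le> C"
    and k: "\<And>x y. \<bar>x\<bar> \<le> 2 \<Longrightarrow> \<bar>y\<bar> \<le> 2 \<Longrightarrow> 3 / 2 \<le> s * x \<Longrightarrow> 3 / 2 \<le> s * y \<Longrightarrow> \<bar>k x y\<bar> \<le> C * (w x * w y)"
    and k0: "\<And>x y. \<not> (\<bar>x\<bar> \<le> 2 \<and> \<bar>y\<bar> \<le> 2) \<Longrightarrow> k x y = 0"
  shows "\<bar>f x * f y * k x y\<bar> \<le> M\<^sup>2 * C * ((edge s \<delta> x * w x) * (edge s \<delta> y * w y))"
proof (cases "\<bar>x\<bar> \<le> 2 \<and> \<bar>y\<bar> \<le> 2 \<and> f x \<noteq> 0 \<and> f y \<noteq> 0")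
  case True
  then have A: "\<bar>k x y\<bar> \<le> C * (w x * w y)" using k edge_point by blast
  have B: "\<bar>f x\<bar> * \<bar>f y\<bar> \<le> (M * edge s \<delta> x) * (M * edge s \<delta> y)"
    using True f_edge M_nonneg edge_bounds by (intro mult_mono mult_nonneg_nonneg) auto
  have "\<bar>f x\<bar> * \<bar>f y\<bar> * \<bar>k x y\<bar> \<le> (M * edge s \<delta> x) * (M * edge s \<delta> y) * (C * (w x * w y))"
    using M_nonneg edge_bounds by (intro mult_mono[OF B A] mult_nonneg_nonneg) auto
  then show ?thesis by (simp add: abs_mult power2_eq_square mult_ac)
next
  case False
  have "0 \<le> M\<^sup>2 * C * ((edge s \<delta> x * w x) * (edge s \<delta> y * w y))"
    using assms edge_bounds by (intro mult_nonneg_nonneg) auto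
  then show ?thesis using False k0 by auto
qed

lemma pair_integral_bound:
  assumes w: "\<And>x. 0 \<le> w x" "integrable lborel w" and I: "(LINT x|lborel. edge s \<delta> x * w x) \<le> I"
    and C: "0 \<le> C" and F: "F \<in> borel_measurable borel"
    and Fb: "\<And>p. \<bar>F p\<bar> \<le> M\<^sup>2 * C * ((edge s \<delta> (fst p) * w (fst p)) * (edge s \<delta> (snd p) * w (snd p)))"
  shows "\<bar>LINT p|lborel. F p\<bar> \<le> M\<^sup>2 * C * I\<^sup>2"
proof -
  let ?w = "\<lambda>x. edge s \<delta> x * w x"
  have i: "integrable lborel ?w" using w(2) by (rule integrable_edge_mult)
  note prod = integral_product[OF i i, unfolded case_prod_unfold]
  have "\<bar>LINT p|lborel. F p\<bar> \<le> (LINT p|lborel. M\<^sup>2 * C * (?w (fst p) * ?w (snd p)))"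
    by (rule abs_integral_le) (use F Fb prod(1) in auto)
  also have "\<dots> = M\<^sup>2 * C * ((LINT x|lborel. ?w x) * (LINT x|lborel. ?w x))"
    using prod(2) by simp
  also have "\<dots> \<le> M\<^sup>2 * C * (I * I)"
  proof -
    have "0 \<le> (LINT x|lborel. ?w x)"
      using w edge_bounds by (intro integral_nonneg_AE) auto
    then show ?thesis
      using I C by (intro mult_left_mono mult_mono) auto
  qed
  finally show ?thesis by (simp add: power2_eq_square)
qed

lemma V_tr2_integrand_bound:
  assumes \<sigma>: "-1 \<le> \<sigma>" "\<sigma> \<le> 1 - \<epsilon>"
  shows "\<bar>f x * f y * (wgt x * wgt y * tr_kernel \<sigma> x y)\<bar> \<le>
    M\<^sup>2 * (16 / c\<epsilon>\<^sup>2) * ((edge s \<delta> x * wgt x) * (edge s \<delta> y * wgt y))"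
proof (rule pair_bound)
  show "\<bar>wgt x * wgt y * tr_kernel \<sigma> x y\<bar> \<le> 16 / c\<epsilon>\<^sup>2 * (wgt x * wgt y)"
    if "\<bar>x\<bar> \<le> 2" "\<bar>y\<bar> \<le> 2" "3 / 2 \<le> s * x" "3 / 2 \<le> s * y" for x y
    using mult_left_mono[OF edge_kernel_bounds(1)[OF \<sigma> \<epsilon>(1) s that(1,3,2,4)], of "wgt x * wgt y"]
      wgt_nonneg[of x] wgt_nonneg[of y] by (simp add: abs_mult mult.commute)
qed (auto simp: wgt_nonneg, auto simp: wgt_def indicator_def abs_le_iff)

lemma V_tr2_open_wgt: "\<bar>\<sigma>\<bar> < 1 \<Longrightarrow> V_tr2_open f \<sigma> = 1 / (4 * pi\<^sup>2) *
    (LINT p|lborel. f (fst p) * f (snd p) * (wgt (fst p) * wgt (snd p) * tr_kernel \<sigma> (fst p) (snd p)))"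
  unfolding wgt_wgt by (subst V_tr2_open_eq) (auto simp: mult_ac)

text \<open>Each variable contributes at most 2 sqrt \<delta>. At \<sigma> = -1 the limit exists by
  dominated convergence, because no denominator vanishes on the support.\<close>

lemma V_tr2_bound:
  assumes \<sigma>: "-1 \<le> \<sigma>" "\<sigma> \<le> 1 - \<epsilon>"
  shows "\<bar>V_tr2 f \<sigma>\<bar> \<le> M\<^sup>2 * (16 / c\<epsilon>\<^sup>2) * \<delta>"
  unfolding V_tr2_def
proof (rule extend_to_pm1_bound[OF _ _ \<epsilon> \<sigma>])
  fix \<sigma> :: real assume \<sigma>: "-1 < \<sigma>" "\<sigma> \<le> 1 - \<epsilon>"
  then have "\<bar>LINT p|lborel. f (fst p) * f (snd p) * (wgt (fst p) * wgt (snd p) * tr_kernel \<sigma> (fst p) (snd p))\<bar> \<le> M\<^sup>2 * (16 / c\<epsilon>\<^sup>2) * (2 * sqrt \<delta>)\<^sup>2"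
    using integral_edge_wgt[OF s \<delta>(1)] \<delta> wgt_nonneg wgt_integrable V_tr2_integrand_bound[of \<sigma>]
    by (intro pair_integral_bound[where w = wgt]) auto
  also have "\<dots> = M\<^sup>2 * (16 / c\<epsilon>\<^sup>2) * \<delta> * 4"
    using \<delta> by (simp add: power_mult_distrib)
  finally have *: "\<bar>LINT p|lborel. f (fst p) * f (snd p) * (wgt (fst p) * wgt (snd p) * tr_kernel \<sigma> (fst p) (snd p))\<bar> \<le> M\<^sup>2 * (16 / c\<epsilon>\<^sup>2) * \<delta> * 4" .
  have X: "\<bar>1 / (4 * pi\<^sup>2) * I\<bar> \<le> X" if "\<bar>I\<bar> \<le> X * 4" for I X :: real
  proof -
    have "\<bar>1 / (4 * pi\<^sup>2) * I\<bar> = 1 / (4 * pi\<^sup>2) * \<bar>I\<bar>" by (simp add: abs_mult)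
    also have "\<dots> \<le> 1 / 4 * \<bar>I\<bar>" using pi_sq_ge by (intro mult_right_mono frac_le) auto
    finally show ?thesis using that by simp
  qed
  have "\<bar>\<sigma>\<bar> < 1" using \<sigma> \<epsilon> by auto
  then show "\<bar>V_tr2_open f \<sigma>\<bar> \<le> M\<^sup>2 * (16 / c\<epsilon>\<^sup>2) * \<delta>"
    unfolding V_tr2_open_wgt[OF \<open>\<bar>\<sigma>\<bar> < 1\<close>] by (intro X *)
next
  let ?G = "\<lambda>\<sigma> p. f (fst p) * f (snd p) * (wgt (fst p) * wgt (snd p) * tr_kernel \<sigma> (fst p) (snd p))"
  have i: "integrable lborel (\<lambda>x. edge s \<delta> x * wgt x)" by (rule integrable_edge_mult[OF wgt_integrable])
  note prod = integral_product[OF i i, unfolded case_prod_unfold]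
  have "((\<lambda>\<sigma>. LINT p|lborel. ?G \<sigma> p) \<longlongrightarrow> (LINT p|lborel. ?G (-1) p)) (at (-1) within {-1..0})"
  proof (rule tendsto_integral_dominated)
    show "integrable lborel (\<lambda>p. M\<^sup>2 * (16 / c\<epsilon>\<^sup>2) * ((edge s \<delta> (fst p) * wgt (fst p)) * (edge s \<delta> (snd p) * wgt (snd p))))"
      using prod(1) by (rule integrable_mult_right)
    show "AE p in lborel. \<bar>?G \<sigma> p\<bar> \<le> M\<^sup>2 * (16 / c\<epsilon>\<^sup>2) * ((edge s \<delta> (fst p) * wgt (fst p)) * (edge s \<delta> (snd p) * wgt (snd p)))"
      if "\<sigma> \<in> {-1..0}" for \<sigma>
      using V_tr2_integrand_bound[of \<sigma>] that \<epsilon> by (intro AE_I2) auto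
    show "AE p in lborel. ((\<lambda>\<sigma>. ?G \<sigma> p) \<longlongrightarrow> ?G (-1) p) (at (-1) within {-1..0})"
    proof (rule AE_I2)
      fix p :: "real \<times> real"
      let ?x = "fst p" and ?y = "snd p"
      show "((\<lambda>\<sigma>. ?G \<sigma> p) \<longlongrightarrow> ?G (-1) p) (at (-1) within {-1..0})"
      proof (cases "\<bar>?x\<bar> \<le> 2 \<and> \<bar>?y\<bar> \<le> 2 \<and> f ?x \<noteq> 0 \<and> f ?y \<noteq> 0")
        case True
        then have "0 < den (-1) (cosp ?x ?y) \<and> 0 < den (-1) (cosm ?x ?y)"
          using edge_kernel_bounds(3)[of "-1" \<epsilon> s ?x ?y] edge_point \<epsilon> s by auto
        then have "den (-1) (cosp ?x ?y) \<noteq> 0" "den (-1) (cosm ?x ?y) \<noteq> 0" by auto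
        then show ?thesis unfolding tr_kernel_def by (intro tendsto_intros)
      next
        case False
        then have "f ?x * f ?y = 0 \<or> wgt ?x * wgt ?y = 0" by (auto simp: wgt_def indicator_def)
        then show ?thesis by (elim disjE) (simp_all only: mult_zero_left mult_zero_right tendsto_const)
      qed
    qed
  qed measurable
  then have "((\<lambda>\<sigma>. 1 / (4 * pi\<^sup>2) * (LINT p|lborel. ?G \<sigma> p)) \<longlongrightarrow> 1 / (4 * pi\<^sup>2) * (LINT p|lborel. ?G (-1) p)) (at_right (-1))"
    unfolding at_within_Icc_at_right[of "-1" "0::real", simplified] by (rule tendsto_mult_left)
  moreover have "\<forall>\<^sub>F \<sigma> in at_right (-1). 1 / (4 * pi\<^sup>2) * (LINT p|lborel. ?G \<sigma> p) = V_tr2_open f \<sigma>"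
    unfolding eventually_at_right_field
  proof (intro exI[of _ 0] conjI allI impI)
    fix \<sigma> :: real assume "-1 < \<sigma>" "\<sigma> < 0"
    then show "1 / (4 * pi\<^sup>2) * (LINT p|lborel. ?G \<sigma> p) = V_tr2_open f \<sigma>"
      by (intro V_tr2_open_wgt[symmetric]) auto
  qed simp
  ultimately show "(V_tr2_open f \<longlongrightarrow> 1 / (4 * pi\<^sup>2) * (LINT p|lborel. ?G (-1) p)) (at_right (-1))"
    by (rule Lim_transform_eventually)
qed

end

context edge_function
begin

lemma avg_sc_bound: "\<bar>avg_sc f\<bar> \<le> M * sqrt \<delta> * \<delta>"
proof -
  have i: "integrable lborel (\<lambda>x. M * (edge s \<delta> x * (chi x * hgt x)))"
    by (intro integrable_mult_right integrable_edge_mult integrable_chi_hgt)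
  have "\<bar>LINT x|lborel. f x * (chi x * hgt x)\<bar> \<le> (LINT x|lborel. M * (edge s \<delta> x * (chi x * hgt x)))"
  proof (rule abs_integral_le[OF _ i AE_I2])
    fix x :: real
    show "\<bar>f x * (chi x * hgt x)\<bar> \<le> M * (edge s \<delta> x * (chi x * hgt x))"
    proof (cases "\<bar>x\<bar> \<le> 2")
      case True
      then show ?thesis
        using mult_right_mono[OF f_edge[OF True] chi_hgt_nonneg[of x]] chi_hgt_nonneg[of x]
        by (simp add: abs_mult[of "f x"] mult.assoc)
    qed (auto simp: chi_def indicator_def)
  qed measurable
  also have "\<dots> \<le> M * (2 * sqrt \<delta> * \<delta>)"
    using integral_edge_hgt[OF s \<delta>(1)] \<delta> M_nonneg by (simp add: mult_left_mono)
  finally have *: "\<bar>LINT x|lborel. f x * (chi x * hgt x)\<bar> \<le> M * (2 * sqrt \<delta> * \<delta>)" .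
  have "\<bar>avg_sc f\<bar> = 1 / (2 * pi) * \<bar>LINT x|lborel. f x * (chi x * hgt x)\<bar>"
    by (simp add: avg_sc_eq abs_mult)
  also have "\<dots> \<le> 1 / 2 * (M * (2 * sqrt \<delta> * \<delta>))"
    using * pi_ge_two by (intro mult_mono frac_le) auto
  finally show ?thesis by simp
qed

lemma avg_inv_sc_bound:
  assumes [measurable]: "h \<in> borel_measurable borel" and h: "\<And>x. \<bar>x\<bar> \<le> 2 \<Longrightarrow> \<bar>h x\<bar> \<le> B * edge s \<delta> x" and "0 \<le> B"
  shows "\<bar>avg_inv_sc h\<bar> \<le> B * sqrt \<delta>"
proof -
  have i: "integrable lborel (\<lambda>x. B * (edge s \<delta> x * wgt x))"
    by (intro integrable_mult_right integrable_edge_mult wgt_integrable)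
  have "\<bar>LINT x|lborel. h x * wgt x\<bar> \<le> (LINT x|lborel. B * (edge s \<delta> x * wgt x))"
  proof (rule abs_integral_le[OF _ i AE_I2])
    fix x :: real
    show "\<bar>h x * wgt x\<bar> \<le> B * (edge s \<delta> x * wgt x)"
    proof (cases "\<bar>x\<bar> \<le> 2")
      case True
      then show ?thesis
        using mult_right_mono[OF h[OF True] wgt_nonneg[of x]] wgt_nonneg[of x]
        by (simp add: abs_mult mult.assoc)
    qed (auto simp: wgt_def indicator_def)
  qed measurable
  also have "\<dots> \<le> B * (2 * sqrt \<delta>)"
    using integral_edge_wgt[OF s \<delta>(1)] \<delta> assms(3) by (simp add: mult_left_mono)
  finally have *: "\<bar>LINT x|lborel. h x * wgt x\<bar> \<le> B * (2 * sqrt \<delta>)" .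
  have "\<bar>avg_inv_sc h\<bar> = 1 / pi * \<bar>LINT x|lborel. h x * wgt x\<bar>"
    by (simp add: avg_inv_sc_eq abs_mult)
  also have "\<dots> \<le> 1 / 2 * (B * (2 * sqrt \<delta>))"
    using * pi_ge_two by (intro mult_mono frac_le) auto
  finally show ?thesis by simp
qed

lemma V_d2_integrand_bound:
  assumes \<sigma>: "-1 \<le> \<sigma>" "\<sigma> \<le> 1 - \<epsilon>"
  shows "\<bar>f x * f y * (chi x * chi y * d_kernel \<sigma> x y)\<bar> \<le>
    M\<^sup>2 * (1 / c\<epsilon>\<^sup>2) * ((edge s \<delta> x * (chi x * hgt x)) * (edge s \<delta> y * (chi y * hgt y)))"
proof (rule pair_bound)
  show "\<bar>chi x * chi y * d_kernel \<sigma> x y\<bar> \<le> 1 / c\<epsilon>\<^sup>2 * (chi x * hgt x * (chi y * hgt y))"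
    if "\<bar>x\<bar> \<le> 2" "\<bar>y\<bar> \<le> 2" "3 / 2 \<le> s * x" "3 / 2 \<le> s * y" for x y
  proof -
    have "chi x = 1" "chi y = 1" using that by (auto simp: chi_def indicator_def abs_le_iff)
    then show ?thesis using edge_kernel_bounds(2)[OF \<sigma> \<epsilon>(1) s that(1,3,2,4)] by simp
  qed
qed (auto simp: chi_hgt_nonneg, auto simp: chi_def indicator_def abs_le_iff)

text \<open>Each variable contributes \<delta>^(3/2), and so does each factor of the squared mean.
  The cube leaves room for C_N, which is of order N^(3a/2).\<close>

lemma V_d2_bound:
  assumes \<sigma>: "-1 \<le> \<sigma>" "\<sigma> \<le> 1 - \<epsilon>"
  shows "\<bar>V_d2 f \<sigma>\<bar> \<le> M\<^sup>2 * (1 / c\<epsilon>\<^sup>2 + 1) * \<delta> ^ 3"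
  unfolding V_d2_def
proof (rule extend_to_pm1_bound[OF _ _ \<epsilon> \<sigma>])
  fix \<sigma> :: real assume \<sigma>: "-1 < \<sigma>" "\<sigma> \<le> 1 - \<epsilon>"
  let ?I = "LINT p|lborel. f (fst p) * f (snd p) * (chi (fst p) * chi (snd p) * d_kernel \<sigma> (fst p) (snd p))"
  have "\<bar>?I\<bar> \<le> M\<^sup>2 * (1 / c\<epsilon>\<^sup>2) * (2 * sqrt \<delta> * \<delta>)\<^sup>2"
    using integral_edge_hgt[OF s \<delta>(1)] \<delta> chi_hgt_nonneg integrable_chi_hgt V_d2_integrand_bound[of \<sigma>] \<sigma>
    by (intro pair_integral_bound[where w = "\<lambda>x. chi x * hgt x"]) auto
  also have "\<dots> = M\<^sup>2 * (1 / c\<epsilon>\<^sup>2) * \<delta> ^ 3 * 4"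
    using \<delta> by (simp add: power_mult_distrib power3_eq_cube power2_eq_square)
  finally have *: "\<bar>?I\<bar> \<le> M\<^sup>2 * (1 / c\<epsilon>\<^sup>2) * \<delta> ^ 3 * 4" .
  have "\<bar>1 / (4 * pi\<^sup>2) * ?I\<bar> = 1 / (4 * pi\<^sup>2) * \<bar>?I\<bar>" by (simp add: abs_mult)
  also have "\<dots> \<le> 1 / 4 * \<bar>?I\<bar>" using pi_sq_ge by (intro mult_right_mono frac_le) auto
  also have "\<dots> \<le> M\<^sup>2 * (1 / c\<epsilon>\<^sup>2) * \<delta> ^ 3" using * by simp
  finally have A: "\<bar>1 / (4 * pi\<^sup>2) * ?I\<bar> \<le> M\<^sup>2 * (1 / c\<epsilon>\<^sup>2) * \<delta> ^ 3" .
  have "\<bar>avg_sc f\<bar>\<^sup>2 \<le> (M * sqrt \<delta> * \<delta>)\<^sup>2"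
    by (rule power_mono[OF avg_sc_bound]) simp
  also have "\<dots> = M\<^sup>2 * \<delta> ^ 3"
    using \<delta> by (simp add: power_mult_distrib power3_eq_cube power2_eq_square)
  finally have B: "\<bar>(avg_sc f)\<^sup>2\<bar> \<le> M\<^sup>2 * \<delta> ^ 3" by simp
  have "\<bar>1 / (4 * pi\<^sup>2) * ?I - (avg_sc f)\<^sup>2\<bar> \<le> M\<^sup>2 * (1 / c\<epsilon>\<^sup>2) * \<delta> ^ 3 + M\<^sup>2 * \<delta> ^ 3"
    by (rule order_trans[OF abs_triangle_ineq4 add_mono[OF A B]])
  then show "\<bar>V_d2_open f \<sigma>\<bar> \<le> M\<^sup>2 * (1 / c\<epsilon>\<^sup>2 + 1) * \<delta> ^ 3"
    unfolding V_d2_open_eq by (simp add: distrib_left distrib_right)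
next
  let ?w = "\<lambda>x. chi x * hgt x"
  let ?G = "\<lambda>\<sigma> p. f (fst p) * f (snd p) * (chi (fst p) * chi (snd p) * d_kernel \<sigma> (fst p) (snd p))"
  have i: "integrable lborel (\<lambda>x. edge s \<delta> x * ?w x)" by (rule integrable_edge_mult[OF integrable_chi_hgt])
  note prod = integral_product[OF i i, unfolded case_prod_unfold]
  have "((\<lambda>\<sigma>. LINT p|lborel. ?G \<sigma> p) \<longlongrightarrow> (LINT p|lborel. ?G (-1) p)) (at (-1) within {-1..0})"
  proof (rule tendsto_integral_dominated)
    show "integrable lborel (\<lambda>p. M\<^sup>2 * (1 / c\<epsilon>\<^sup>2) * ((edge s \<delta> (fst p) * ?w (fst p)) * (edge s \<delta> (snd p) * ?w (snd p))))"
      using prod(1) by (rule integrable_mult_right)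
    show "AE p in lborel. \<bar>?G \<sigma> p\<bar> \<le> M\<^sup>2 * (1 / c\<epsilon>\<^sup>2) * ((edge s \<delta> (fst p) * ?w (fst p)) * (edge s \<delta> (snd p) * ?w (snd p)))"
      if "\<sigma> \<in> {-1..0}" for \<sigma>
      using V_d2_integrand_bound[of \<sigma>] that \<epsilon> by (intro AE_I2) auto
    show "AE p in lborel. ((\<lambda>\<sigma>. ?G \<sigma> p) \<longlongrightarrow> ?G (-1) p) (at (-1) within {-1..0})"
    proof (rule AE_I2)
      fix p :: "real \<times> real"
      let ?x = "fst p" and ?y = "snd p"
      show "((\<lambda>\<sigma>. ?G \<sigma> p) \<longlongrightarrow> ?G (-1) p) (at (-1) within {-1..0})"
      proof (cases "\<bar>?x\<bar> \<le> 2 \<and> \<bar>?y\<bar> \<le> 2 \<and> f ?x \<noteq> 0 \<and> f ?y \<noteq> 0")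
        case True
        then have "0 < den (-1) (cosp ?x ?y) \<and> 0 < den (-1) (cosm ?x ?y)"
          using edge_kernel_bounds(3)[of "-1" \<epsilon> s ?x ?y] edge_point \<epsilon> s by auto
        then have "den (-1) (cosp ?x ?y) * den (-1) (cosm ?x ?y) \<noteq> 0" by auto
        then show ?thesis unfolding d_kernel_def by (intro tendsto_intros)
      next
        case False
        then have "f ?x * f ?y = 0 \<or> chi ?x * chi ?y = 0" by (auto simp: chi_def indicator_def)
        then show ?thesis by (elim disjE) (simp_all only: mult_zero_left mult_zero_right tendsto_const)
      qed
    qed
  qed measurable
  then have "((\<lambda>\<sigma>. 1 / (4 * pi\<^sup>2) * (LINT p|lborel. ?G \<sigma> p) - (avg_sc f)\<^sup>2) \<longlongrightarrow>
      1 / (4 * pi\<^sup>2) * (LINT p|lborel. ?G (-1) p) - (avg_sc f)\<^sup>2) (at_right (-1))"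
    unfolding at_within_Icc_at_right[of "-1" "0::real", simplified]
    by (intro tendsto_diff tendsto_const tendsto_mult_left)
  then show "(V_d2_open f \<longlongrightarrow> 1 / (4 * pi\<^sup>2) * (LINT p|lborel. ?G (-1) p) - (avg_sc f)\<^sup>2) (at_right (-1))"
    unfolding V_d2_open_eq[symmetric] .
qed

lemma E_tr_bound:
  assumes \<sigma>: "-1 \<le> \<sigma>" "\<sigma> \<le> 1 - \<epsilon>"
  shows "\<bar>E_tr f \<sigma>\<bar> \<le> M * (1 + 1 / c\<epsilon>) * sqrt \<delta>"
proof -
  have eq: "E_tr_open f \<sigma> = avg_inv_sc (\<lambda>x. f x * (1 - pois_half \<sigma> x))" for \<sigma>
    by (simp add: E_tr_open_def pois_half_def)
  have C0: "0 \<le> 1 + 1 / c\<epsilon>" by simp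
  have pt: "\<bar>f x * (1 - pois_half \<sigma> x)\<bar> \<le> M * (1 + 1 / c\<epsilon>) * edge s \<delta> x"
    if \<sigma>: "-1 \<le> \<sigma>" "\<sigma> \<le> 1 - \<epsilon>" and x: "\<bar>x\<bar> \<le> 2" for \<sigma> x
  proof (cases "f x = 0")
    case True
    then show ?thesis using M_nonneg edge_bounds C0 by simp
  next
    case False
    have "\<bar>f x\<bar> * \<bar>1 - pois_half \<sigma> x\<bar> \<le> (M * edge s \<delta> x) * (1 + 1 / c\<epsilon>)"
      using M_nonneg edge_bounds
      by (intro mult_mono f_edge x edge_kernel_bounds(4)[OF \<sigma> \<epsilon>(1) s x edge_point[OF x False]] mult_nonneg_nonneg) auto
    then show ?thesis by (simp add: abs_mult mult_ac)
  qed
  show ?thesis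
    unfolding E_tr_def
  proof (rule extend_to_pm1_bound[OF _ _ \<epsilon> \<sigma>])
    fix \<sigma> :: real assume "-1 < \<sigma>" "\<sigma> \<le> 1 - \<epsilon>"
    then show "\<bar>E_tr_open f \<sigma>\<bar> \<le> M * (1 + 1 / c\<epsilon>) * sqrt \<delta>"
      unfolding eq using pt[of \<sigma>] M_nonneg C0 by (intro avg_inv_sc_bound) auto
  next
    let ?G = "\<lambda>\<sigma> x. (f x * (1 - pois_half \<sigma> x)) * wgt x"
    have "((\<lambda>\<sigma>. LINT x|lborel. ?G \<sigma> x) \<longlongrightarrow> (LINT x|lborel. ?G (-1) x)) (at (-1) within {-1..0})"
    proof (rule tendsto_integral_dominated)
      show "integrable lborel (\<lambda>x. M * (1 + 1 / c\<epsilon>) * (edge s \<delta> x * wgt x))"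
        by (intro integrable_mult_right integrable_edge_mult wgt_integrable)
      show "AE x in lborel. \<bar>?G \<sigma> x\<bar> \<le> M * (1 + 1 / c\<epsilon>) * (edge s \<delta> x * wgt x)" if "\<sigma> \<in> {-1..0}" for \<sigma>
      proof (rule AE_I2)
        fix x :: real
        show "\<bar>?G \<sigma> x\<bar> \<le> M * (1 + 1 / c\<epsilon>) * (edge s \<delta> x * wgt x)"
        proof (cases "\<bar>x\<bar> \<le> 2")
          case True
          have \<sigma>: "-1 \<le> \<sigma>" "\<sigma> \<le> 1 - \<epsilon>" using that \<epsilon> by auto
          have "\<bar>?G \<sigma> x\<bar> = \<bar>f x * (1 - pois_half \<sigma> x)\<bar> * wgt x"
            using wgt_nonneg[of x] by (simp only: abs_mult[of _ "wgt x"] abs_of_nonneg)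
          also have "\<dots> \<le> M * (1 + 1 / c\<epsilon>) * edge s \<delta> x * wgt x"
            by (rule mult_right_mono[OF pt[OF \<sigma> True] wgt_nonneg])
          finally show ?thesis by (simp only: mult.assoc)
        qed (auto simp: wgt_def indicator_def)
      qed
      show "AE x in lborel. ((\<lambda>\<sigma>. ?G \<sigma> x) \<longlongrightarrow> ?G (-1) x) (at (-1) within {-1..0})"
      proof (rule AE_I2)
        fix x :: real
        show "((\<lambda>\<sigma>. ?G \<sigma> x) \<longlongrightarrow> ?G (-1) x) (at (-1) within {-1..0})"
        proof (cases "\<bar>x\<bar> \<le> 2 \<and> f x \<noteq> 0")
          case True
          then have "0 < den (-1) (x\<^sup>2 / 2 - 1)"
            using edge_kernel_bounds(5)[of "-1" \<epsilon> s x] edge_point \<epsilon> s by auto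
          then show ?thesis unfolding pois_half_eq by (intro tendsto_intros) auto
        next
          case False
          then have "f x = 0 \<or> wgt x = 0" by (auto simp: wgt_def indicator_def)
          then show ?thesis by (elim disjE) (simp_all only: mult_zero_left mult_zero_right tendsto_const)
        qed
      qed
    qed measurable
    then have "((\<lambda>\<sigma>. 1 / pi * (LINT x|lborel. ?G \<sigma> x)) \<longlongrightarrow> 1 / pi * (LINT x|lborel. ?G (-1) x)) (at_right (-1))"
      unfolding at_within_Icc_at_right[of "-1" "0::real", simplified] by (rule tendsto_mult_left)
    then show "(E_tr_open f \<longlongrightarrow> 1 / pi * (LINT x|lborel. ?G (-1) x)) (at_right (-1))"
      unfolding eq[abs_def] avg_inv_sc_eq .
  qed
qed

end

section \<open>Scaling at the edge\<close>

text \<open>Controls the part of the half-line beyond distance 4 from the edge, which the limiting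
  integrals see but the spectrum does not.\<close>

lemma inverse_three_halves_integral:
  "has_bochner_integral lborel (\<lambda>x. indicator {4..} x * (1 / (x * sqrt x))) 1"
proof (rule has_bochner_integral_nn_integral)
  have "(\<integral>\<^sup>+x. ennreal (1 / (x * sqrt x)) * indicator {4..} x \<partial>lborel) = ennreal (0 - (- 2 / sqrt 4))"
  proof (rule nn_integral_FTC_atLeast[where F = "\<lambda>x. - 2 / sqrt x"])
    show "((\<lambda>x. - 2 / sqrt x) has_real_derivative 1 / (x * sqrt x)) (at x)" if "4 \<le> x" for x
      using that by (auto intro!: derivative_eq_intros simp: field_simps)
    have "filterlim sqrt at_infinity at_top"
      by (rule filterlim_at_top_imp_at_infinity[OF sqrt_at_top])
    then show "((\<lambda>x. - 2 / sqrt x) \<longlongrightarrow> 0) at_top"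
      by (rule tendsto_divide_0[OF tendsto_const])
  qed auto
  moreover have "(\<integral>\<^sup>+x. ennreal (indicator {4..} x * (1 / (x * sqrt x))) \<partial>lborel) =
      (\<integral>\<^sup>+x. ennreal (1 / (x * sqrt x)) * indicator {4..} x \<partial>lborel)"
    by (intro nn_integral_cong) (auto simp: indicator_def)
  ultimately show "(\<integral>\<^sup>+x. ennreal (indicator {4..} x * (1 / (x * sqrt x))) \<partial>lborel) = ennreal 1"
    by simp
qed (auto simp: indicator_def)

lemma hgt_shift:
  assumes "s = 1 \<or> s = -1"
  shows "chi (2 * s + (- s) * \<alpha>) * hgt (2 * s + (- s) * \<alpha>) = indicator {0..4} \<alpha> * (sqrt \<alpha> * sqrt (4 - \<alpha>))"
proof -
  have "4 - (2 * s + (- s) * \<alpha>)\<^sup>2 = \<alpha> * (4 - \<alpha>)"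
    using assms by (auto simp: power2_eq_square algebra_simps)
  moreover have "chi (2 * s + (- s) * \<alpha>) = indicator {0..4} \<alpha>"
    using assms by (auto simp: chi_def indicator_def)
  ultimately show ?thesis by (simp add: hgt_def real_sqrt_mult)
qed

lemma sqrt_four_minus: "0 \<le> \<alpha> \<Longrightarrow> \<alpha> \<le> 4 \<Longrightarrow> \<bar>sqrt (4 - \<alpha>) - 2\<bar> \<le> \<alpha> / 2"
proof -
  assume a: "0 \<le> \<alpha>" "\<alpha> \<le> 4"
  have le: "sqrt (4 - \<alpha>) \<le> 2" using real_sqrt_le_mono[of "4 - \<alpha>" 4] a by simp
  have "2 * (2 - sqrt (4 - \<alpha>)) \<le> (2 + sqrt (4 - \<alpha>)) * (2 - sqrt (4 - \<alpha>))"
    using le a by (intro mult_right_mono) auto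
  also have "\<dots> = \<alpha>" using a by (simp add: algebra_simps)
  finally show ?thesis using le by simp
qed

section \<open>Edge coordinates\<close>

locale edge_scaling =
  fixes g :: "real \<Rightarrow> real" and s c L M R :: real
  assumes g_Lip: "lip_bound L g" and g_bound: "\<And>x. \<bar>g x\<bar> \<le> M" and g_supp: "\<And>x. \<bar>x\<bar> > R \<Longrightarrow> g x = 0"
    and s: "\<bar>s\<bar> = 1" and c: "0 < c" and R: "1 \<le> R" and Rc: "R * c \<le> 1 / 2"
begin

text \<open>The parameter \<open>c\<close> stands for N^(-a). \<open>F\<close> is \<open>f\<close>
  as a function of the distance from the edge 2 s, and \<open>h\<close> is the limiting profile,
  with h u = F (c u^2); \<open>\<delta>\<close> bounds the support in that distance.\<close>

definition f where "f x = g ((x - 2 * s) / c)"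
definition F where "F \<alpha> = g (- s * \<alpha> / c)"
definition h where "h u = g (- s * u\<^sup>2)"
definition \<delta> where "\<delta> = R * c"

lemma \<delta>_bounds: "0 < \<delta>" "\<delta> \<le> 1 / 2"
  using R c Rc by (auto simp: \<delta>_def)

lemma s_cases: "s = 1 \<or> s = -1"
  using s by (auto simp: abs_if split: if_splits)

lemma s_sq: "s * s = 1"
  using s_cases by auto

lemma g_meas [measurable]: "g \<in> borel_measurable borel"
  by (rule lip_bound_measurable[OF g_Lip])

lemma f_meas [measurable]: "f \<in> borel_measurable borel"
  and F_meas [measurable]: "F \<in> borel_measurable borel"
  and h_meas [measurable]: "h \<in> borel_measurable borel"
  unfolding f_def[abs_def] F_def[abs_def] h_def[abs_def] by measurable

lemma M_nonneg: "0 \<le> M"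
  using g_bound[of 0] by linarith

lemma F_Lip: "\<bar>F x - F y\<bar> \<le> L / c * \<bar>x - y\<bar>"
proof -
  have "\<bar>F x - F y\<bar> \<le> L * \<bar>- s * x / c - - s * y / c\<bar>"
    using g_Lip unfolding F_def lip_bound_def by blast
  also have "\<bar>- s * x / c - - s * y / c\<bar> = \<bar>x - y\<bar> / c"
    using s_cases c by (auto simp: diff_divide_distrib[symmetric] abs_minus_commute)
  finally show ?thesis by simp
qed

lemma f_Lip: "lip_bound (L / c) f"
  unfolding lip_bound_def
proof (intro allI)
  fix x y
  have "\<bar>f x - f y\<bar> \<le> L * \<bar>(x - 2 * s) / c - (y - 2 * s) / c\<bar>"
    using g_Lip unfolding f_def lip_bound_def by blast
  also have "\<bar>(x - 2 * s) / c - (y - 2 * s) / c\<bar> = \<bar>x - y\<bar> / c"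
    using c by (simp add: diff_divide_distrib[symmetric])
  finally show "\<bar>f x - f y\<bar> \<le> L / c * \<bar>x - y\<bar>" by simp
qed

lemma f_bound: "\<bar>f x\<bar> \<le> M" and F_bound: "\<bar>F x\<bar> \<le> M"
  by (simp_all add: f_def F_def g_bound)

lemma F_supp: "\<delta> < \<alpha> \<Longrightarrow> F \<alpha> = 0"
  unfolding F_def using s_cases c by (intro g_supp) (auto simp: \<delta>_def field_simps abs_mult)

lemma f_eq_F: "f (2 * s + (- s) * \<alpha>) = F \<alpha>"
  by (simp add: f_def F_def)

lemma f_edge: "\<bar>x\<bar> \<le> 2 \<Longrightarrow> \<bar>f x\<bar> \<le> M * edge s \<delta> x"
proof (cases "2 - \<delta> \<le> s * x")
  case False
  have "x = 2 * s + (- s) * (2 - s * x)"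
    using s_sq by (simp add: algebra_simps)
  then have "f x = F (2 - s * x)" using f_eq_F by metis
  then show ?thesis using False F_supp[of "2 - s * x"] M_nonneg by (simp add: edge_def)
qed (simp add: edge_def f_bound)

section \<open>Comparison of \<open>V_tr1\<close> with the seminorm\<close>

definition vden :: "real \<Rightarrow> real" where "vden \<alpha> = wgt (2 - \<alpha>)"

lemma vden_meas [measurable]: "vden \<in> borel_measurable borel"
  unfolding vden_def[abs_def] by measurable

lemma vden_nonneg: "0 \<le> vden \<alpha>" by (simp add: vden_def wgt_nonneg)

lemma vden_eq: "0 \<le> \<alpha> \<Longrightarrow> \<alpha> \<le> 4 \<Longrightarrow> vden \<alpha> = 1 / (sqrt \<alpha> * sqrt (4 - \<alpha>))"
proof -
  assume "0 \<le> \<alpha>" "\<alpha> \<le> 4"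
  moreover have "4 - (2 - \<alpha>)\<^sup>2 = \<alpha> * (4 - \<alpha>)" by (simp add: power2_eq_square algebra_simps)
  ultimately show ?thesis by (simp add: vden_def wgt_def hgt_def real_sqrt_mult)
qed

lemma vden_zero: "\<alpha> < 0 \<or> 4 < \<alpha> \<Longrightarrow> vden \<alpha> = 0"
  by (auto simp: vden_def wgt_def)

lemma vden_integrable: "integrable lborel vden"
  using lborel_integrable_real_affine[OF wgt_integrable, of "-1" 2] by (simp add: vden_def[abs_def])

lemma wgt_shift: "wgt (2 * s + (- s) * \<alpha>) = vden \<alpha>"
  using s_cases wgt_minus[of "2 - \<alpha>"] by (auto simp: vden_def)

definition Q :: "real \<times> real \<Rightarrow> real" where
  "Q p = (F (fst p) - F (snd p))\<^sup>2 / (fst p - snd p)\<^sup>2"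

text \<open>The integrand of \<open>V_tr1\<close> in edge coordinates, where 4 - x y becomes 2
  (\<alpha> + \<beta>) - \<alpha> \<beta>.\<close>

definition A1 :: "real \<times> real \<Rightarrow> real" where
  "A1 p = Q p * (vden (fst p) * vden (snd p) * (2 * (fst p + snd p) - fst p * snd p))"

text \<open>The integrand of the seminorm of \<open>h\<close>, folded to the positive quadrant as
  shown in \<open>H_half_A0\<close>. Near the corner \<open>A1\<close> is close to half of it, since
  each sqrt (4 - \<alpha>) is close to 2; this turns 1 / (4 \<pi>^2) into 1 / (8 \<pi>^2).\<close>

definition A0 :: "real \<times> real \<Rightarrow> real" where
  "A0 p = indicator ({0<..} \<times> {0<..}) p * (Q p * ((fst p + snd p) / sqrt (fst p * snd p)))"

lemma quadrant_sets [measurable]: "({0<..} \<times> {0<..} :: (real \<times> real) set) \<in> sets borel"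
  by (intro borel_open open_Times) auto

lemma Q_meas [measurable]: "Q \<in> borel_measurable borel"
  and A1_meas [measurable]: "A1 \<in> borel_measurable borel"
  and A0_meas [measurable]: "A0 \<in> borel_measurable borel"
proof -
  show [measurable]: "Q \<in> borel_measurable borel" unfolding Q_def[abs_def] by measurable
  show "A1 \<in> borel_measurable borel" "A0 \<in> borel_measurable borel"
    unfolding A1_def[abs_def] A0_def[abs_def] by measurable
qed

lemma V_tr1_A1: "integrable lborel A1" "V_tr1 f = 1 / (4 * pi\<^sup>2) * (LINT p|lborel. A1 p)"
proof -
  let ?k = "\<lambda>p. (f (fst p) - f (snd p))\<^sup>2 * (wgt (fst p) * wgt (snd p)) * ((4 - fst p * snd p) / (fst p - snd p)\<^sup>2)"
  have i: "integrable lborel ?k"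
  proof (rule Bochner_Integration.integrable_bound)
    show "integrable lborel (\<lambda>p. 8 * (L / c)\<^sup>2 * (wgt (fst p) * wgt (snd p)))"
      using wgt_wgt_integrable by (rule integrable_mult_right)
    have "\<bar>?k p\<bar> \<le> \<bar>8 * (L / c)\<^sup>2 * (wgt (fst p) * wgt (snd p))\<bar>" for p
    proof -
      have "\<bar>?k p\<bar> = (f (fst p) - f (snd p))\<^sup>2 * (wgt (fst p) * wgt (snd p)) * \<bar>(4 - fst p * snd p) / (fst p - snd p)\<^sup>2\<bar>"
        using wgt_nonneg[of "fst p"] wgt_nonneg[of "snd p"]
        by (simp only: abs_mult abs_of_nonneg zero_le_power2 mult_nonneg_nonneg)
      also have "\<dots> \<le> 8 * (L / c)\<^sup>2 * (wgt (fst p) * wgt (snd p))"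
        by (rule V_tr1_integrand_bound[OF f_Lip])
      finally show ?thesis by linarith
    qed
    then show "AE p in lborel. norm (?k p) \<le> norm (8 * (L / c)\<^sup>2 * (wgt (fst p) * wgt (snd p)))" by simp
  qed measurable
  have k: "?k ((2 * s, 2 * s) + (- s) *\<^sub>R p) = A1 p" for p
  proof -
    obtain \<alpha> \<beta> where p: "p = (\<alpha>, \<beta>)" by (cases p)
    have "4 - (2 * s + (- s) * \<alpha>) * (2 * s + (- s) * \<beta>) = 2 * (\<alpha> + \<beta>) - \<alpha> * \<beta>"
      using s_cases by (auto simp: algebra_simps)
    moreover have "((2 * s + (- s) * \<alpha>) - (2 * s + (- s) * \<beta>))\<^sup>2 = (\<alpha> - \<beta>)\<^sup>2"
      using s_cases by (auto simp: power2_eq_square algebra_simps)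
    ultimately show ?thesis
      unfolding p fst_add snd_add fst_scaleR snd_scaleR fst_conv snd_conv real_scaleR_def f_eq_F wgt_shift A1_def Q_def
      by simp
  qed
  have k_meas: "?k \<in> borel_measurable borel" by measurable
  have "\<bar>- s\<bar> = 1" using s by simp
  note aff = integral_lborel_affine_pair[OF k_meas this, of "2 * s", unfolded k]
  show "integrable lborel A1" using aff(2) i by simp
  show "V_tr1 f = 1 / (4 * pi\<^sup>2) * (LINT p|lborel. A1 p)"
    unfolding V_tr1_eq aff(1) ..
qed

text \<open>\<open>\<psi>\<close> and \<open>\<phi>\<close> build the majorant of |A1 - A0 / 2|. One
  of the two points must lie in the support and carries \<open>\<phi>\<close>, of mass 2 sqrt
  \<delta>, the source of the error rate; the other ranges over the half-line and carries
  \<open>\<psi>\<close>, whose mass does not depend on \<open>c\<close>.\<close>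

definition \<psi> :: "real \<Rightarrow> real" where
  "\<psi> \<beta> = vden \<beta> + indicator {4..} \<beta> * (1 / (\<beta> * sqrt \<beta>))"

definition \<phi> :: "real \<Rightarrow> real" where
  "\<phi> \<alpha> = indicator {0..\<delta>} \<alpha> * (1 / sqrt \<alpha>)"

lemma \<psi>_integrable: "integrable lborel \<psi>"
  unfolding \<psi>_def[abs_def]
  by (rule Bochner_Integration.integrable_add[OF vden_integrable integrable.intros[OF inverse_three_halves_integral]])

lemma \<psi>_nonneg: "0 \<le> \<psi> \<beta>"
  by (simp add: \<psi>_def vden_nonneg indicator_def)

lemma \<phi>_integral: "has_bochner_integral lborel \<phi> (2 * sqrt \<delta>)"
proof -
  have "has_bochner_integral lborel (\<lambda>\<alpha>. indicator {0..\<delta>} \<alpha> * (1 / sqrt \<alpha>)) (2 * sqrt \<delta> - 2 * sqrt 0)"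
  proof (rule FTC_interior_nonneg)
    show "((\<lambda>x. 2 * sqrt x) has_real_derivative 1 / sqrt x) (at x)" if "0 < x" "x < \<delta>" for x
      using that by (auto intro!: derivative_eq_intros simp: field_simps)
  qed (use \<delta>_bounds in \<open>auto intro!: continuous_intros\<close>)
  then show ?thesis by (simp add: \<phi>_def[abs_def])
qed

definition K where "K = 9 * (M\<^sup>2 + L\<^sup>2 * R\<^sup>2)"

lemma K_nonneg: "0 \<le> K" by (simp add: K_def)

text \<open>The bound is scale invariant. If \<beta> < 2 \<delta>, then \<alpha> + \<beta> \<le> 3
  \<delta> and the Lipschitz constant L / c meets \<delta> = R c. Otherwise F \<beta> = 0 and
  \<alpha> + \<beta> \<le> 3 (\<beta> - \<alpha>). Both cases explain the 9 in
  \<open>K\<close>.\<close>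

lemma Q_bound:
  assumes "0 < \<alpha>" "\<alpha> \<le> \<delta>" "0 < \<beta>" "\<alpha> \<noteq> \<beta>"
  shows "Q (\<alpha>, \<beta>) * (\<alpha> + \<beta>)\<^sup>2 \<le> K"
proof -
  have d: "0 < (\<alpha> - \<beta>)\<^sup>2" using assms by simp
  show ?thesis
  proof (cases "\<beta> < 2 * \<delta>")
    case True
    have "(F \<alpha> - F \<beta>)\<^sup>2 \<le> (L / c)\<^sup>2 * (\<alpha> - \<beta>)\<^sup>2"
      using power_mono[OF F_Lip[of \<alpha> \<beta>] abs_ge_zero, of 2] by (simp only: power_mult_distrib power2_abs)
    then have "Q (\<alpha>, \<beta>) \<le> (L / c)\<^sup>2"
      unfolding Q_def fst_conv snd_conv using d by (simp only: pos_divide_le_eq)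
    moreover have "(\<alpha> + \<beta>)\<^sup>2 \<le> (3 * \<delta>)\<^sup>2" using assms True by (intro power_mono) auto
    ultimately have "Q (\<alpha>, \<beta>) * (\<alpha> + \<beta>)\<^sup>2 \<le> (L / c)\<^sup>2 * (3 * \<delta>)\<^sup>2"
      by (intro mult_mono) auto
    also have "\<dots> = 9 * (L\<^sup>2 * R\<^sup>2)"
      using c by (simp add: \<delta>_def power_mult_distrib power_divide)
    finally show ?thesis by (simp add: K_def) (use zero_le_power2[of M] in linarith)
  next
    case False
    then have "F \<beta> = 0" using \<delta>_bounds by (intro F_supp) auto
    then have "(F \<alpha> - F \<beta>)\<^sup>2 \<le> M\<^sup>2"
      using power_mono[OF F_bound[of \<alpha>] abs_ge_zero, of 2] by simp
    then have "Q (\<alpha>, \<beta>) \<le> M\<^sup>2 / (\<alpha> - \<beta>)\<^sup>2"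
      unfolding Q_def fst_conv snd_conv using d by (intro divide_right_mono) auto
    moreover have "(\<alpha> + \<beta>)\<^sup>2 \<le> (3 * (\<beta> - \<alpha>))\<^sup>2" using assms False by (intro power_mono) auto
    ultimately have "Q (\<alpha>, \<beta>) * (\<alpha> + \<beta>)\<^sup>2 \<le> M\<^sup>2 / (\<alpha> - \<beta>)\<^sup>2 * (3 * (\<beta> - \<alpha>))\<^sup>2"
      by (intro mult_mono) auto
    also have "\<dots> = 9 * M\<^sup>2"
    proof -
      have "(3 * (\<beta> - \<alpha>))\<^sup>2 = 9 * (\<alpha> - \<beta>)\<^sup>2" by (simp add: power2_eq_square algebra_simps)
      then show ?thesis using d by simp
    qed
    finally have "Q (\<alpha>, \<beta>) * (\<alpha> + \<beta>)\<^sup>2 \<le> 9 * M\<^sup>2" .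
    also have "9 * M\<^sup>2 \<le> K"
      unfolding K_def by (intro mult_left_mono) auto
    finally show ?thesis .
  qed
qed

lemma Q_nonneg: "0 \<le> Q p" by (simp add: Q_def)

text \<open>Over a common denominator the leading terms cancel and the numerator is of order
  (\<alpha> + \<beta>)^2, because 4 - sqrt ((4 - \<alpha>)(4 - \<beta>)) \<le> \<alpha> + \<beta>.
  This square is what \<open>Q_bound\<close> absorbs.\<close>

lemma diff_bound_near:
  assumes \<alpha>: "0 < \<alpha>" "\<alpha> \<le> \<delta>" and \<beta>: "0 < \<beta>" "\<beta> < 4" and ne: "\<alpha> \<noteq> \<beta>"
  shows "\<bar>A1 (\<alpha>, \<beta>) - A0 (\<alpha>, \<beta>) / 2\<bar> \<le> K * (1 / sqrt \<alpha> * vden \<beta>)"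
proof -
  let ?a = "sqrt \<alpha>" and ?b = "sqrt \<beta>" and ?c = "sqrt (4 - \<alpha>)" and ?d = "sqrt (4 - \<beta>)"
  have a4: "\<alpha> \<le> 1 / 2" using \<alpha> \<delta>_bounds by linarith
  have pos: "0 < ?a" "0 < ?b" "0 < ?c" "0 < ?d" using \<alpha> \<beta> a4 by auto
  have c1: "1 \<le> ?c" using a4 by simp
  have A1e: "A1 (\<alpha>, \<beta>) = Q (\<alpha>, \<beta>) * ((2 * (\<alpha> + \<beta>) - \<alpha> * \<beta>) / (?a * ?b * ?c * ?d))"
    using \<alpha> \<beta> a4 by (simp add: A1_def vden_eq)
  have A0e: "A0 (\<alpha>, \<beta>) / 2 = Q (\<alpha>, \<beta>) * ((\<alpha> + \<beta>) / 2 * (?c * ?d) / (?a * ?b * ?c * ?d))"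
    using \<alpha> \<beta> pos by (simp add: A0_def real_sqrt_mult)
  define n where "n = (2 * (\<alpha> + \<beta>) - \<alpha> * \<beta>) - (\<alpha> + \<beta>) / 2 * (?c * ?d)"
  have cd: "(?c * ?d)\<^sup>2 = 16 - 4 * (\<alpha> + \<beta>) + \<alpha> * \<beta>"
    using \<beta> a4 by (simp add: power_mult_distrib algebra_simps)
  have cd4: "?c * ?d \<le> 4"
  proof -
    have "?c * ?d \<le> 2 * 2"
    proof (rule mult_mono)
      show "?c \<le> 2" using real_sqrt_le_mono[of "4 - \<alpha>" 4] \<alpha> by simp
      show "?d \<le> 2" using real_sqrt_le_mono[of "4 - \<beta>" 4] \<beta> by simp
    qed (use pos in auto)
    then show ?thesis by simp
  qed
  have "4 * (4 - ?c * ?d) \<le> (4 + ?c * ?d) * (4 - ?c * ?d)"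
    using cd4 pos by (intro mult_right_mono) auto
  also have "\<dots> = 4 * (\<alpha> + \<beta>) - \<alpha> * \<beta>"
    using cd by (simp add: power2_eq_square algebra_simps)
  also have "\<dots> \<le> 4 * (\<alpha> + \<beta>)" using \<alpha> \<beta> by simp
  finally have d4: "4 - ?c * ?d \<le> \<alpha> + \<beta>" by simp
  have n_eq: "n = (\<alpha> + \<beta>) / 2 * (4 - ?c * ?d) - \<alpha> * \<beta>"
    by (simp add: n_def algebra_simps)
  have n1: "(\<alpha> + \<beta>) / 2 * (4 - ?c * ?d) \<le> (\<alpha> + \<beta>) / 2 * (\<alpha> + \<beta>)"
    using d4 \<alpha> \<beta> by (intro mult_left_mono) auto
  have n2: "0 \<le> (\<alpha> + \<beta>) / 2 * (4 - ?c * ?d)" using cd4 \<alpha> \<beta> by simp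
  have n3: "0 \<le> \<alpha> * \<beta>" "\<alpha> * \<beta> \<le> (\<alpha> + \<beta>)\<^sup>2" "(\<alpha> + \<beta>) / 2 * (\<alpha> + \<beta>) \<le> (\<alpha> + \<beta>)\<^sup>2"
    using \<alpha> \<beta> by (auto simp: power2_eq_square algebra_simps)
  have n: "\<bar>n\<bar> \<le> (\<alpha> + \<beta>)\<^sup>2"
    unfolding n_eq by (rule abs_leI) (use n1 n2 n3 in linarith)+
  have "A1 (\<alpha>, \<beta>) - A0 (\<alpha>, \<beta>) / 2 = Q (\<alpha>, \<beta>) * (n / (?a * ?b * ?c * ?d))"
    unfolding A1e A0e n_def by (simp add: diff_divide_distrib right_diff_distrib)
  then have "\<bar>A1 (\<alpha>, \<beta>) - A0 (\<alpha>, \<beta>) / 2\<bar> = Q (\<alpha>, \<beta>) * (\<bar>n\<bar> / (?a * ?b * ?c * ?d))"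
    using pos Q_nonneg[of "(\<alpha>, \<beta>)"] by (simp add: abs_mult abs_divide)
  also have "\<dots> \<le> Q (\<alpha>, \<beta>) * ((\<alpha> + \<beta>)\<^sup>2 / (?a * ?b * 1 * ?d))"
    using n pos c1 Q_nonneg by (intro mult_left_mono frac_le mult_mono mult_pos_pos mult_nonneg_nonneg) auto
  also have "\<dots> = Q (\<alpha>, \<beta>) * (\<alpha> + \<beta>)\<^sup>2 * (1 / ?a * vden \<beta>)"
    using \<beta> by (simp add: vden_eq)
  also have "\<dots> \<le> K * (1 / ?a * vden \<beta>)"
    using Q_bound[OF \<alpha> \<beta>(1) ne] pos vden_nonneg[of \<beta>] by (intro mult_right_mono) auto
  finally show ?thesis .
qed

text \<open>Beyond the spectrum \<open>A1\<close> vanishes, and \<open>A0\<close> decays like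
  \<beta>^(-3/2).\<close>

lemma diff_bound_far:
  assumes \<alpha>: "0 < \<alpha>" "\<alpha> \<le> \<delta>" and \<beta>: "4 < \<beta>"
  shows "\<bar>A1 (\<alpha>, \<beta>) - A0 (\<alpha>, \<beta>) / 2\<bar> \<le> K * (1 / sqrt \<alpha> * (1 / (\<beta> * sqrt \<beta>)))"
proof -
  have ne: "\<alpha> \<noteq> \<beta>" "0 < \<beta>" using assms \<delta>_bounds by auto
  have p: "0 < sqrt \<alpha>" "0 < sqrt \<beta>" "0 < \<alpha> + \<beta>" using assms ne by auto
  have "A1 (\<alpha>, \<beta>) = 0" using vden_zero[of \<beta>] \<beta> by (simp add: A1_def)
  then have "\<bar>A1 (\<alpha>, \<beta>) - A0 (\<alpha>, \<beta>) / 2\<bar> = Q (\<alpha>, \<beta>) * ((\<alpha> + \<beta>) / (2 * (sqrt \<alpha> * sqrt \<beta>)))"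
    using p ne \<alpha> Q_nonneg[of "(\<alpha>, \<beta>)"] by (simp add: A0_def real_sqrt_mult abs_mult)
  also have "\<dots> = Q (\<alpha>, \<beta>) * (\<alpha> + \<beta>)\<^sup>2 * (1 / (2 * (\<alpha> + \<beta>) * (sqrt \<alpha> * sqrt \<beta>)))"
  proof -
    have "t / (2 * q) = t\<^sup>2 * (1 / (2 * t * q))" if "0 < t" for t q :: real
      using that by (simp add: power2_eq_square)
    from this[OF p(3)] show ?thesis by (simp only: mult.assoc)
  qed
  also have "\<dots> \<le> K * (1 / (\<beta> * (sqrt \<alpha> * sqrt \<beta>)))"
    using Q_bound[OF \<alpha> ne(2,1)] p ne \<alpha> K_nonneg
    by (intro mult_mono frac_le mult_right_mono mult_pos_pos) auto
  finally show ?thesis by (simp add: mult_ac)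
qed

lemma A_symmetric: "A1 (\<beta>, \<alpha>) = A1 (\<alpha>, \<beta>)" "A0 (\<beta>, \<alpha>) = A0 (\<alpha>, \<beta>)"
  by (auto simp: A1_def A0_def Q_def power2_commute mult_ac add_ac indicator_def)

lemma diff_bound:
  assumes "\<alpha> \<noteq> \<beta>" "\<alpha> \<noteq> 0" "\<beta> \<noteq> 0" "\<alpha> \<noteq> 4" "\<beta> \<noteq> 4"
  shows "\<bar>A1 (\<alpha>, \<beta>) - A0 (\<alpha>, \<beta>) / 2\<bar> \<le> K * (\<phi> \<alpha> * \<psi> \<beta>) + K * (\<psi> \<alpha> * \<phi> \<beta>)"
proof -
  have \<phi>0: "0 \<le> \<phi> x" for x by (simp add: \<phi>_def indicator_def)
  have nn: "0 \<le> K * (\<phi> \<alpha> * \<psi> \<beta>)" "0 \<le> K * (\<psi> \<alpha> * \<phi> \<beta>)"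
    using K_nonneg \<phi>0 \<psi>_nonneg by simp_all
  have main: "\<bar>A1 (x, y) - A0 (x, y) / 2\<bar> \<le> K * (\<phi> x * \<psi> y)"
    if "0 < x" "x \<le> \<delta>" "0 < y" "x \<noteq> y" "y \<noteq> 4" for x y
  proof (cases "y < 4")
    case True
    have "\<bar>A1 (x, y) - A0 (x, y) / 2\<bar> \<le> K * (1 / sqrt x * vden y)"
      using diff_bound_near[OF that(1,2,3) True that(4)] .
    also have "\<dots> = K * (\<phi> x * \<psi> y)" using that True by (simp add: \<phi>_def \<psi>_def)
    finally show ?thesis .
  next
    case False
    then have y: "4 < y" using that by simp
    have "\<bar>A1 (x, y) - A0 (x, y) / 2\<bar> \<le> K * (1 / sqrt x * (1 / (y * sqrt y)))"
      using diff_bound_far[OF that(1,2) y] .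
    also have "\<dots> = K * (\<phi> x * \<psi> y)" using that y by (simp add: \<phi>_def \<psi>_def vden_zero)
    finally show ?thesis .
  qed
  show ?thesis
  proof (cases "0 < \<alpha> \<and> 0 < \<beta>")
    case False
    then have "A1 (\<alpha>, \<beta>) = 0" "A0 (\<alpha>, \<beta>) = 0"
      using assms vden_zero[of \<alpha>] vden_zero[of \<beta>] by (auto simp: A1_def A0_def indicator_def)
    then show ?thesis using nn by simp
  next
    case True
    consider "\<alpha> \<le> \<delta>" | "\<beta> \<le> \<delta>" | "\<delta> < \<alpha>" "\<delta> < \<beta>" by linarith
    then show ?thesis
    proof cases
      case 1
      then show ?thesis using main[of \<alpha> \<beta>] True assms nn(2) by simp
    next
      case 2
      then show ?thesis using main[of \<beta> \<alpha>] True assms nn(1) by (simp add: A_symmetric mult.commute[of "\<phi> \<beta>"])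
    next
      case 3
      then have "A1 (\<alpha>, \<beta>) = 0" "A0 (\<alpha>, \<beta>) = 0"
        by (simp_all add: A1_def A0_def Q_def F_supp)
      then show ?thesis using nn by simp
    qed
  qed
qed

text \<open>Finiteness of the seminorm is an outcome of the comparison: \<open>A1\<close> is
  integrable because \<open>f\<close> is Lipschitz, and so is the difference by its
  majorant.\<close>

lemma A0_integral:
  shows "integrable lborel A0"
    and "\<bar>(LINT p|lborel. A1 p) - (LINT p|lborel. A0 p) / 2\<bar> \<le> 4 * K * (LINT x|lborel. \<psi> x) * sqrt \<delta>"
proof -
  have \<phi>i: "integrable lborel \<phi>" "(LINT x|lborel. \<phi> x) = 2 * sqrt \<delta>"
    using \<phi>_integral by (auto simp: has_bochner_integral_iff)
  note p1 = integral_product[OF \<phi>i(1) \<psi>_integrable, unfolded case_prod_unfold]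
  note p2 = integral_product[OF \<psi>_integrable \<phi>i(1), unfolded case_prod_unfold]
  let ?D = "\<lambda>p. K * (\<phi> (fst p) * \<psi> (snd p)) + K * (\<psi> (fst p) * \<phi> (snd p))"
  have Di: "integrable lborel ?D" using p1(1) p2(1) by simp
  have ae: "AE p in lborel. \<bar>A1 p - A0 p / 2\<bar> \<le> ?D p"
    using AE_generic_pair[of 0] AE_generic_pair[of 4]
  proof eventually_elim
    case (elim p)
    then show ?case using diff_bound[of "fst p" "snd p"] by simp
  qed
  have dm: "(\<lambda>p. A1 p - A0 p / 2) \<in> borel_measurable lborel" by measurable
  have di: "integrable lborel (\<lambda>p. A1 p - A0 p / 2)"
    by (rule Bochner_Integration.integrable_bound[OF Di dm])
      (use ae in eventually_elim, simp)
  have "A0 = (\<lambda>p. 2 * (A1 p - (A1 p - A0 p / 2)))" by (simp add: fun_eq_iff)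
  then show A0i: "integrable lborel A0"
    using integrable_mult_right[OF Bochner_Integration.integrable_diff[OF V_tr1_A1(1) di], of 2] by simp
  have "\<bar>LINT p|lborel. A1 p - A0 p / 2\<bar> \<le> (LINT p|lborel. ?D p)"
    by (rule abs_integral_le[OF dm Di ae])
  also have "\<dots> = K * (2 * sqrt \<delta> * (LINT x|lborel. \<psi> x)) + K * ((LINT x|lborel. \<psi> x) * (2 * sqrt \<delta>))"
    using p1 p2 \<phi>i(2) by simp
  finally show "\<bar>(LINT p|lborel. A1 p) - (LINT p|lborel. A0 p) / 2\<bar> \<le> 4 * K * (LINT x|lborel. \<psi> x) * sqrt \<delta>"
    using V_tr1_A1(1) A0i by (simp add: mult_ac)
qed

end

lemma integral_eq_if_nn_integral_eq:
  fixes f :: "'a \<Rightarrow> real" and g :: "'b \<Rightarrow> real"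
  assumes "f \<in> borel_measurable M" "g \<in> borel_measurable N" "\<And>x. 0 \<le> f x" "\<And>x. 0 \<le> g x"
    and "(\<integral>\<^sup>+x. ennreal (f x) \<partial>M) = (\<integral>\<^sup>+x. ennreal (g x) \<partial>N)"
  shows "(LINT x|M. f x) = (LINT x|N. g x)"
  using assms by (simp add: integral_eq_nn_integral)

context edge_scaling
begin

lemma h_root: "0 \<le> \<alpha> \<Longrightarrow> h (sqrt (\<alpha> / c)) = F \<alpha>" "0 \<le> \<alpha> \<Longrightarrow> h (- sqrt (\<alpha> / c)) = F \<alpha>"
  using c by (simp_all add: h_def F_def)

text \<open>Folding both variables collects the four points (\<plusminus>a, \<plusminus>b) with a^2
  = \<alpha>/c and b^2 = \<beta>/c. With D the squared difference of \<open>F\<close>, they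
  contribute 2 D (1 / (a - b)^2 + 1 / (a + b)^2) = 4 D (a^2 + b^2) / (a^2 - b^2)^2, and the Jacobian
  1 / (4 c sqrt (\<alpha> \<beta>)) makes this \<open>A0\<close>; the powers of \<open>c\<close>
  cancel.\<close>

lemma H_half_A0: "(H_half_norm h)\<^sup>2 = (LINT p|lborel. A0 p)"
proof -
  define \<phi> where "\<phi> p = ((h (fst p) - h (snd p)) / (fst p - snd p))\<^sup>2" for p :: "real \<times> real"
  define k where "k t = ennreal (1 / (2 * sqrt (c * t))) * indicator {0<..} t" for t :: real
  have [measurable]: "\<phi> \<in> borel_measurable borel" unfolding \<phi>_def[abs_def] by measurable
  have [measurable]: "k \<in> borel_measurable borel" unfolding k_def[abs_def] by measurable
  have \<phi>_pair [measurable]: "(\<lambda>p. ennreal (\<phi> p)) \<in> borel_measurable (lborel \<Otimes>\<^sub>M lborel)"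
    unfolding lborel_prod by measurable
  have A0_pair [measurable]: "(\<lambda>p. ennreal (A0 p)) \<in> borel_measurable (lborel \<Otimes>\<^sub>M lborel)"
    unfolding lborel_prod by measurable
  have [measurable]: "(\<lambda>u. \<phi> (u, v)) \<in> borel_measurable borel" for v
    unfolding \<phi>_def by measurable
  define f1 where "f1 v = (\<integral>\<^sup>+u. ennreal (\<phi> (u, v)) \<partial>lborel)" for v
  have [measurable]: "f1 \<in> borel_measurable borel"
    using lborel.borel_measurable_nn_integral_fst[of "\<lambda>(v, u). ennreal (\<phi> (u, v))" lborel]
      measurable_compose[OF measurable_pair_swap'[of lborel lborel] \<phi>_pair]
    by (simp add: f1_def[abs_def] case_prod_unfold comp_def)
  let ?r = "\<lambda>t. sqrt (t / c)"
  have pointwise: "(ennreal (\<phi> (?r \<alpha>, ?r \<beta>)) + ennreal (\<phi> (?r \<alpha>, - ?r \<beta>)) +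
      (ennreal (\<phi> (- ?r \<alpha>, ?r \<beta>)) + ennreal (\<phi> (- ?r \<alpha>, - ?r \<beta>)))) * k \<alpha> * k \<beta> = ennreal (A0 (\<alpha>, \<beta>))" for \<alpha> \<beta>
  proof (cases "0 < \<alpha> \<and> 0 < \<beta>")
    case False
    then have "k \<alpha> * k \<beta> = 0" by (auto simp: k_def)
    moreover have "A0 (\<alpha>, \<beta>) = 0" using False by (auto simp: A0_def)
    ultimately show ?thesis by (metis ennreal_0 mult.assoc mult_zero_right)
  next
    case True
    then have \<alpha>: "0 < \<alpha>" and \<beta>: "0 < \<beta>" by auto
    define a b where "a = ?r \<alpha>" and "b = ?r \<beta>"
    have ab: "a\<^sup>2 = \<alpha> / c" "b\<^sup>2 = \<beta> / c" "0 < a" "0 < b"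
      using \<alpha> \<beta> c by (simp_all add: a_def b_def)
    have ha: "h a = F \<alpha>" "h (- a) = F \<alpha>" "h b = F \<beta>" "h (- b) = F \<beta>"
      using h_root[of \<alpha>] h_root[of \<beta>] \<alpha> \<beta> by (simp_all add: a_def b_def)
    have kk: "1 / (2 * sqrt (c * \<alpha>)) * (1 / (2 * sqrt (c * \<beta>))) = 1 / (4 * c * sqrt (\<alpha> * \<beta>))"
      using c by (simp add: real_sqrt_mult)
    have "(\<phi> (a, b) + \<phi> (a, - b) + (\<phi> (- a, b) + \<phi> (- a, - b))) * (1 / (4 * c * sqrt (\<alpha> * \<beta>))) = A0 (\<alpha>, \<beta>)"
    proof (cases "\<alpha> = \<beta>")
      case True
      then show ?thesis by (simp add: \<phi>_def ha A0_def Q_def)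
    next
      case False
      then have "a\<^sup>2 \<noteq> b\<^sup>2" using ab c by simp
      then have ne: "a - b \<noteq> 0" "a + b \<noteq> 0" using ab by auto
      let ?\<Delta> = "(F \<alpha> - F \<beta>)\<^sup>2"
      have 1: "\<phi> (a, b) + \<phi> (a, - b) + (\<phi> (- a, b) + \<phi> (- a, - b)) = 2 * (?\<Delta> / (a - b)\<^sup>2 + ?\<Delta> / (a + b)\<^sup>2)"
        by (simp add: \<phi>_def ha power_divide power2_commute) (simp add: power2_eq_square algebra_simps)
      have 2: "?\<Delta> / (a - b)\<^sup>2 + ?\<Delta> / (a + b)\<^sup>2 = ?\<Delta> * (2 * (a\<^sup>2 + b\<^sup>2)) / (a\<^sup>2 - b\<^sup>2)\<^sup>2"
      proof -
        have "?\<Delta> / (a - b)\<^sup>2 + ?\<Delta> / (a + b)\<^sup>2 = (?\<Delta> * (a + b)\<^sup>2 + ?\<Delta> * (a - b)\<^sup>2) / ((a - b)\<^sup>2 * (a + b)\<^sup>2)"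
          using ne by (simp add: add_frac_eq)
        also have "(a - b)\<^sup>2 * (a + b)\<^sup>2 = (a\<^sup>2 - b\<^sup>2)\<^sup>2"
          by (simp add: power2_eq_square algebra_simps)
        also have "?\<Delta> * (a + b)\<^sup>2 + ?\<Delta> * (a - b)\<^sup>2 = ?\<Delta> * (2 * (a\<^sup>2 + b\<^sup>2))"
          by (simp add: power2_sum power2_diff algebra_simps)
        finally show ?thesis .
      qed
      have 3: "2 * (D * (2 * (\<alpha> / c + \<beta> / c)) / (\<alpha> / c - \<beta> / c)\<^sup>2) * (1 / (4 * c * r)) = D / (\<alpha> - \<beta>)\<^sup>2 * ((\<alpha> + \<beta>) / r)"
        for D r :: real
      proof -
        have "\<alpha> / c + \<beta> / c = (\<alpha> + \<beta>) / c" "(\<alpha> / c - \<beta> / c)\<^sup>2 = (\<alpha> - \<beta>)\<^sup>2 / c\<^sup>2"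
          by (simp_all add: add_divide_distrib diff_divide_distrib[symmetric] power_divide)
        moreover have "2 * (D * (2 * (t / c)) / (w / c\<^sup>2)) * (1 / (4 * c * r)) = D / w * (t / r)" for t w
          using c by (simp add: power2_eq_square)
        ultimately show ?thesis by (simp only:)
      qed
      show ?thesis
        unfolding 1 2 ab(1,2) 3 using \<alpha> \<beta> by (simp add: A0_def Q_def)
    qed
    moreover have "0 \<le> \<phi> p" for p by (simp add: \<phi>_def)
    ultimately have "ennreal (A0 (\<alpha>, \<beta>)) = (ennreal (\<phi> (a, b)) + ennreal (\<phi> (a, - b)) +
      (ennreal (\<phi> (- a, b)) + ennreal (\<phi> (- a, - b)))) * ennreal (1 / (2 * sqrt (c * \<alpha>)) * (1 / (2 * sqrt (c * \<beta>))))"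
      unfolding kk by (metis (no_types, lifting) add_nonneg_nonneg ennreal_mult' ennreal_plus)
    also have "ennreal (1 / (2 * sqrt (c * \<alpha>)) * (1 / (2 * sqrt (c * \<beta>)))) = k \<alpha> * k \<beta>"
      using \<alpha> \<beta> c by (subst ennreal_mult) (auto simp: k_def)
    finally show ?thesis by (simp add: a_def b_def mult.assoc)
  qed
  have inner: "(f1 (?r \<beta>) + f1 (- ?r \<beta>)) * k \<beta> = (\<integral>\<^sup>+\<alpha>. ennreal (A0 (\<alpha>, \<beta>)) \<partial>lborel)" for \<beta>
  proof -
    have "f1 (?r \<beta>) + f1 (- ?r \<beta>) = (\<integral>\<^sup>+u. ennreal (\<phi> (u, ?r \<beta>)) + ennreal (\<phi> (u, - ?r \<beta>)) \<partial>lborel)"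
      unfolding f1_def by (rule nn_integral_add[symmetric]) measurable
    also have "\<dots> = (\<integral>\<^sup>+\<alpha>. (ennreal (\<phi> (?r \<alpha>, ?r \<beta>)) + ennreal (\<phi> (?r \<alpha>, - ?r \<beta>)) +
      (ennreal (\<phi> (- ?r \<alpha>, ?r \<beta>)) + ennreal (\<phi> (- ?r \<alpha>, - ?r \<beta>)))) * ennreal (1 / (2 * sqrt (c * \<alpha>))) * indicator {0<..} \<alpha> \<partial>lborel)"
      by (rule nn_integral_fold_sqrt[OF _ c]) measurable
    finally have "(f1 (?r \<beta>) + f1 (- ?r \<beta>)) * k \<beta> = (\<integral>\<^sup>+\<alpha>. (ennreal (\<phi> (?r \<alpha>, ?r \<beta>)) + ennreal (\<phi> (?r \<alpha>, - ?r \<beta>)) +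
      (ennreal (\<phi> (- ?r \<alpha>, ?r \<beta>)) + ennreal (\<phi> (- ?r \<alpha>, - ?r \<beta>)))) * k \<alpha> \<partial>lborel) * k \<beta>"
      by (simp add: k_def mult.assoc)
    also have "\<dots> = (\<integral>\<^sup>+\<alpha>. (ennreal (\<phi> (?r \<alpha>, ?r \<beta>)) + ennreal (\<phi> (?r \<alpha>, - ?r \<beta>)) +
      (ennreal (\<phi> (- ?r \<alpha>, ?r \<beta>)) + ennreal (\<phi> (- ?r \<alpha>, - ?r \<beta>)))) * k \<alpha> * k \<beta> \<partial>lborel)"
      by (rule nn_integral_multc[symmetric]) (unfold \<phi>_def, measurable)
    finally show ?thesis unfolding pointwise .
  qed
  have "(\<integral>\<^sup>+p. ennreal (\<phi> p) \<partial>lborel) = (\<integral>\<^sup>+v. f1 v \<partial>lborel)"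
    unfolding f1_def using lborel_pair.nn_integral_snd[OF \<phi>_pair] by (simp add: lborel_prod)
  also have "\<dots> = (\<integral>\<^sup>+\<beta>. (f1 (?r \<beta>) + f1 (- ?r \<beta>)) * k \<beta> \<partial>lborel)"
    using nn_integral_fold_sqrt[OF _ c, of f1] by (simp add: k_def mult.assoc)
  also have "\<dots> = (\<integral>\<^sup>+p. ennreal (A0 p) \<partial>lborel)"
    unfolding inner using lborel_pair.nn_integral_snd[OF A0_pair] by (simp add: lborel_prod)
  finally have nn: "(\<integral>\<^sup>+p. ennreal (\<phi> p) \<partial>lborel) = (\<integral>\<^sup>+p. ennreal (A0 p) \<partial>lborel)" .
  have "(LINT p|lborel. \<phi> p) = (LINT p|lborel. A0 p)"
    by (rule integral_eq_if_nn_integral_eq[OF _ _ _ _ nn])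
      (auto simp: \<phi>_def A0_def Q_nonneg indicator_def)
  moreover have "(H_half_norm h)\<^sup>2 = (LINT p|lborel. \<phi> p)"
    unfolding H_half_norm_def case_prod_unfold \<phi>_def by (simp add: integral_nonneg_AE)
  ultimately show ?thesis by simp
qed

lemma V_tr1_estimate:
  "\<bar>V_tr1 f - (H_half_norm h)\<^sup>2 / (8 * pi\<^sup>2)\<bar> \<le> K * (LINT x|lborel. \<psi> x) * sqrt \<delta>"
proof -
  let ?D = "(LINT p|lborel. A1 p) - (LINT p|lborel. A0 p) / 2"
  have "V_tr1 f - (H_half_norm h)\<^sup>2 / (8 * pi\<^sup>2) = 1 / (4 * pi\<^sup>2) * ?D"
    unfolding V_tr1_A1(2) H_half_A0 by (simp add: field_simps)
  then have "\<bar>V_tr1 f - (H_half_norm h)\<^sup>2 / (8 * pi\<^sup>2)\<bar> = 1 / (4 * pi\<^sup>2) * \<bar>?D\<bar>"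
    by (simp add: abs_mult)
  also have "\<dots> \<le> 1 / 4 * (4 * K * (LINT x|lborel. \<psi> x) * sqrt \<delta>)"
    using A0_integral(2) pi_sq_ge by (intro mult_mono frac_le) auto
  finally show ?thesis by simp
qed

section \<open>\<open>V_d1\<close> and the weighted norm of the profile\<close>

definition B0 :: "real \<Rightarrow> real" where "B0 \<alpha> = indicator {0<..} \<alpha> * ((F \<alpha>)\<^sup>2 * sqrt \<alpha>)"

lemma B0_meas [measurable]: "B0 \<in> borel_measurable borel"
  unfolding B0_def[abs_def] by measurable

lemma B0_bound: "\<bar>B0 \<alpha>\<bar> \<le> M\<^sup>2 * sqrt \<delta> * indicator {0..\<delta>} \<alpha>"
proof (cases "0 < \<alpha> \<and> \<alpha> \<le> \<delta>")
  case True
  have "(F \<alpha>)\<^sup>2 \<le> M\<^sup>2" using power_mono[OF F_bound[of \<alpha>] abs_ge_zero, of 2] by simp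
  then have "(F \<alpha>)\<^sup>2 * sqrt \<alpha> \<le> M\<^sup>2 * sqrt \<delta>" using True by (intro mult_mono) auto
  then show ?thesis using True by (simp add: B0_def)
next
  case False
  then have "B0 \<alpha> = 0" using F_supp[of \<alpha>] by (auto simp: B0_def)
  then show ?thesis using \<delta>_bounds by (simp add: indicator_def)
qed

lemma edge_indicator_integrable: "integrable lborel (\<lambda>\<alpha>. C * indicator {0..\<delta>} \<alpha> :: real)"
  by (simp add: emeasure_lborel_Icc_eq)

lemma B0_integral: "integrable lborel B0" "\<bar>LINT \<alpha>|lborel. B0 \<alpha>\<bar> \<le> M\<^sup>2 * sqrt \<delta> * \<delta>"
proof -
  show "integrable lborel B0"
    by (rule Bochner_Integration.integrable_bound[OF edge_indicator_integrable[of "M\<^sup>2 * sqrt \<delta>"]])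
      (use B0_bound in \<open>auto intro: order_trans[OF _ abs_ge_self]\<close>)
  have "\<bar>LINT \<alpha>|lborel. B0 \<alpha>\<bar> \<le> (LINT \<alpha>|lborel. M\<^sup>2 * sqrt \<delta> * indicator {0..\<delta>} \<alpha>)"
    by (rule abs_integral_le[OF _ edge_indicator_integrable]) (use B0_bound in auto)
  then show "\<bar>LINT \<alpha>|lborel. B0 \<alpha>\<bar> \<le> M\<^sup>2 * sqrt \<delta> * \<delta>" using \<delta>_bounds by simp
qed

lemma L2_B0: "(L2_norm (\<lambda>x. h x * x))\<^sup>2 = 1 / (c * sqrt c) * (LINT \<alpha>|lborel. B0 \<alpha>)"
proof -
  have "(\<integral>\<^sup>+u. ennreal ((h u * u)\<^sup>2) \<partial>lborel) = (\<integral>\<^sup>+\<alpha>. (ennreal ((h (sqrt (\<alpha> / c)) * sqrt (\<alpha> / c))\<^sup>2) +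
      ennreal ((h (- sqrt (\<alpha> / c)) * - sqrt (\<alpha> / c))\<^sup>2)) * ennreal (1 / (2 * sqrt (c * \<alpha>))) * indicator {0<..} \<alpha> \<partial>lborel)"
    by (rule nn_integral_fold_sqrt[OF _ c]) measurable
  also have "\<dots> = (\<integral>\<^sup>+\<alpha>. ennreal (1 / (c * sqrt c) * B0 \<alpha>) \<partial>lborel)"
  proof (intro nn_integral_cong)
    fix \<alpha> :: real
    show "(ennreal ((h (sqrt (\<alpha> / c)) * sqrt (\<alpha> / c))\<^sup>2) +
      ennreal ((h (- sqrt (\<alpha> / c)) * - sqrt (\<alpha> / c))\<^sup>2)) * ennreal (1 / (2 * sqrt (c * \<alpha>))) * indicator {0<..} \<alpha> =
      ennreal (1 / (c * sqrt c) * B0 \<alpha>)"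
    proof (cases "0 < \<alpha>")
      case True
      have e: "(h (sqrt (\<alpha> / c)) * sqrt (\<alpha> / c))\<^sup>2 = (F \<alpha>)\<^sup>2 * (\<alpha> / c)"
        "(h (- sqrt (\<alpha> / c)) * - sqrt (\<alpha> / c))\<^sup>2 = (F \<alpha>)\<^sup>2 * (\<alpha> / c)"
        using True c h_root[of \<alpha>] by (simp_all add: power_mult_distrib)
      have "((F \<alpha>)\<^sup>2 * (\<alpha> / c) + (F \<alpha>)\<^sup>2 * (\<alpha> / c)) * (1 / (2 * sqrt (c * \<alpha>))) = (F \<alpha>)\<^sup>2 * (\<alpha> / sqrt \<alpha>) / (c * sqrt c)"
        using c by (simp add: real_sqrt_mult mult_ac)
      also have "\<alpha> / sqrt \<alpha> = sqrt \<alpha>" using True by (simp add: real_div_sqrt)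
      finally have r: "((F \<alpha>)\<^sup>2 * (\<alpha> / c) + (F \<alpha>)\<^sup>2 * (\<alpha> / c)) * (1 / (2 * sqrt (c * \<alpha>))) = 1 / (c * sqrt c) * B0 \<alpha>"
        using True by (simp add: B0_def)
      have nn: "0 \<le> (F \<alpha>)\<^sup>2 * (\<alpha> / c)" "0 \<le> 1 / (2 * sqrt (c * \<alpha>))" using True c by simp_all
      have "(ennreal X + ennreal X) * ennreal Y = ennreal ((X + X) * Y)" if "0 \<le> X" "0 \<le> Y" for X Y
        using that by (simp add: ennreal_mult ennreal_plus[symmetric] del: ennreal_plus)
      from this[OF nn] show ?thesis
        unfolding e using True r by simp
    qed (simp add: B0_def)
  qed
  finally have nn: "(\<integral>\<^sup>+u. ennreal ((h u * u)\<^sup>2) \<partial>lborel) = (\<integral>\<^sup>+\<alpha>. ennreal (1 / (c * sqrt c) * B0 \<alpha>) \<partial>lborel)" .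
  have "(LINT u|lborel. (h u * u)\<^sup>2) = (LINT \<alpha>|lborel. 1 / (c * sqrt c) * B0 \<alpha>)"
    by (rule integral_eq_if_nn_integral_eq[OF _ _ _ _ nn]) (use c in \<open>auto simp: B0_def indicator_def\<close>)
  then show ?thesis by (simp add: L2_norm_sq)
qed

text \<open>The weight sqrt (\<alpha> (4 - \<alpha>)) is 2 sqrt \<alpha> up to a relative error of
  order \<alpha>, hence of order \<delta> on the support.\<close>

lemma avg_sc_sq_estimate:
  "\<bar>avg_sc (\<lambda>x. (f x)\<^sup>2) - (LINT \<alpha>|lborel. B0 \<alpha>) / pi\<bar> \<le> M\<^sup>2 * sqrt \<delta> * \<delta>\<^sup>2"
proof -
  let ?G = "\<lambda>\<alpha>. (F \<alpha>)\<^sup>2 * (indicator {0..4} \<alpha> * (sqrt \<alpha> * sqrt (4 - \<alpha>)))"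
  have "(LINT x|lborel. (f x)\<^sup>2 * (chi x * hgt x)) = (LINT \<alpha>|lborel. ?G \<alpha>)"
    using s by (subst lborel_integral_real_affine[where c = "- s" and t = "2 * s"])
      (auto simp: f_eq_F[simplified] hgt_shift[OF s_cases, simplified])
  then have avg: "avg_sc (\<lambda>x. (f x)\<^sup>2) = 1 / (2 * pi) * (LINT \<alpha>|lborel. ?G \<alpha>)"
    by (simp add: avg_sc_eq)
  have G_meas: "?G \<in> borel_measurable lborel" by measurable
  have pt: "\<bar>?G \<alpha> - 2 * B0 \<alpha>\<bar> \<le> M\<^sup>2 * sqrt \<delta> * \<delta> * indicator {0..\<delta>} \<alpha>" for \<alpha>
  proof (cases "0 < \<alpha> \<and> \<alpha> \<le> \<delta>")
    case True
    then have a: "0 \<le> \<alpha>" "\<alpha> \<le> 4" using \<delta>_bounds by auto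
    have "?G \<alpha> - 2 * B0 \<alpha> = (F \<alpha>)\<^sup>2 * sqrt \<alpha> * (sqrt (4 - \<alpha>) - 2)"
      using True a by (simp add: B0_def right_diff_distrib)
    then have "\<bar>?G \<alpha> - 2 * B0 \<alpha>\<bar> = (F \<alpha>)\<^sup>2 * sqrt \<alpha> * \<bar>sqrt (4 - \<alpha>) - 2\<bar>"
      using a by (simp add: abs_mult)
    also have "\<dots> \<le> M\<^sup>2 * sqrt \<delta> * \<delta>"
    proof (intro mult_mono)
      show "(F \<alpha>)\<^sup>2 \<le> M\<^sup>2" using power_mono[OF F_bound[of \<alpha>] abs_ge_zero, of 2] by simp
      show "\<bar>sqrt (4 - \<alpha>) - 2\<bar> \<le> \<delta>" using sqrt_four_minus[OF a] True by linarith
    qed (use True \<delta>_bounds in auto)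
    finally show ?thesis using True by simp
  next
    case False
    then have "?G \<alpha> = 0" "B0 \<alpha> = 0" using F_supp[of \<alpha>] by (auto simp: B0_def indicator_def)
    moreover have "0 \<le> M\<^sup>2 * sqrt \<delta> * \<delta> * indicator {0..\<delta>} \<alpha>" using \<delta>_bounds by simp
    ultimately show ?thesis by (simp only: mult_zero_right diff_self abs_zero)
  qed
  have "\<bar>LINT \<alpha>|lborel. ?G \<alpha> - 2 * B0 \<alpha>\<bar> \<le> (LINT \<alpha>|lborel. M\<^sup>2 * sqrt \<delta> * \<delta> * indicator {0..\<delta>} \<alpha>)"
    by (rule abs_integral_le[OF _ edge_indicator_integrable]) (use pt G_meas in auto)
  also have "\<dots> = M\<^sup>2 * sqrt \<delta> * \<delta>\<^sup>2" using \<delta>_bounds by (simp add: power2_eq_square)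
  finally have d: "\<bar>LINT \<alpha>|lborel. ?G \<alpha> - 2 * B0 \<alpha>\<bar> \<le> M\<^sup>2 * sqrt \<delta> * \<delta>\<^sup>2" .
  have di: "integrable lborel (\<lambda>\<alpha>. ?G \<alpha> - 2 * B0 \<alpha>)"
    by (rule Bochner_Integration.integrable_bound[OF edge_indicator_integrable[of "M\<^sup>2 * sqrt \<delta> * \<delta>"]])
      (use pt G_meas in \<open>auto intro: order_trans[OF _ abs_ge_self]\<close>)
  have Gi: "integrable lborel ?G"
    using Bochner_Integration.integrable_add[OF di integrable_mult_right[OF B0_integral(1), of 2]] by simp
  have "(LINT \<alpha>|lborel. ?G \<alpha> - 2 * B0 \<alpha>) = (LINT \<alpha>|lborel. ?G \<alpha>) - 2 * (LINT \<alpha>|lborel. B0 \<alpha>)"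
    using Gi B0_integral(1) by simp
  then have "avg_sc (\<lambda>x. (f x)\<^sup>2) - (LINT \<alpha>|lborel. B0 \<alpha>) / pi = 1 / (2 * pi) * (LINT \<alpha>|lborel. ?G \<alpha> - 2 * B0 \<alpha>)"
    unfolding avg by (simp add: right_diff_distrib)
  then have "\<bar>avg_sc (\<lambda>x. (f x)\<^sup>2) - (LINT \<alpha>|lborel. B0 \<alpha>) / pi\<bar> = 1 / (2 * pi) * \<bar>LINT \<alpha>|lborel. ?G \<alpha> - 2 * B0 \<alpha>\<bar>"
    by (simp add: abs_mult)
  also have "\<dots> \<le> 1 * (M\<^sup>2 * sqrt \<delta> * \<delta>\<^sup>2)"
    using d pi_ge_two by (intro mult_mono) auto
  finally show ?thesis by simp
qed

end

section \<open>The density at the edge\<close>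

text \<open>Partial fractions over the real factorization of u^4 + 1 into \<open>p\<close> and
  \<open>q\<close>. The two arctangents, rather than a single combined one, keep the primitive
  smooth on the whole line, with value 0 at 0.\<close>

lemma quartic_integral:
  "(\<integral>\<^sup>+u. ennreal (u\<^sup>2 / (u ^ 4 + 1)) * indicator {0<..} u \<partial>lborel) = ennreal (pi / (2 * sqrt 2))"
proof -
  define r :: real where "r = sqrt 2"
  have r: "r * r = 2" "0 < r" by (simp_all add: r_def)
  define p q where "p u = u\<^sup>2 - r * u + 1" and "q u = u\<^sup>2 + r * u + 1" for u :: real
  have pq: "p u * q u = u ^ 4 + 1" for u
  proof -
    have "p u * q u = u ^ 4 + (2 - r * r) * u\<^sup>2 + 1"
      unfolding p_def q_def by (simp add: power2_eq_square power4_eq_xxxx algebra_simps)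
    then show ?thesis using r(1) by simp
  qed
  have p2: "2 * p u = 1 + (r * u - 1)\<^sup>2" and q2: "2 * q u = 1 + (r * u + 1)\<^sup>2" for u
  proof -
    have "1 + (r * u - 1)\<^sup>2 = (r * r) * u\<^sup>2 - 2 * r * u + 2" "1 + (r * u + 1)\<^sup>2 = (r * r) * u\<^sup>2 + 2 * r * u + 2"
      by (simp_all add: power2_eq_square algebra_simps)
    then show "2 * p u = 1 + (r * u - 1)\<^sup>2" "2 * q u = 1 + (r * u + 1)\<^sup>2"
      unfolding r(1) p_def q_def by simp_all
  qed
  have pos: "0 < p u" "0 < q u" for u
    using p2[of u] q2[of u] zero_le_power2[of "r * u - 1"] zero_le_power2[of "r * u + 1"] by linarith+
  define H where "H u = 1 / (4 * r) * (ln (p u) - ln (q u)) + 1 / (2 * r) * (arctan (r * u + 1) + arctan (r * u - 1))" for u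
  have D: "(H has_real_derivative u\<^sup>2 / (u ^ 4 + 1)) (at u)" for u
  proof -
    have dp: "(p has_real_derivative 2 * u - r) (at u)" and dq: "(q has_real_derivative 2 * u + r) (at u)"
      unfolding p_def[abs_def] q_def[abs_def] by (auto intro!: derivative_eq_intros)
    have l: "((\<lambda>u. r * u + 1) has_real_derivative r) (at u)" "((\<lambda>u. r * u - 1) has_real_derivative r) (at u)"
      by (auto intro!: derivative_eq_intros)
    have "(H has_real_derivative 1 / (4 * r) * (1 / p u * (2 * u - r) - 1 / q u * (2 * u + r)) +
        1 / (2 * r) * (inverse (1 + (r * u + 1)\<^sup>2) * r + inverse (1 + (r * u - 1)\<^sup>2) * r)) (at u)"
      unfolding H_def[abs_def]
      by (intro DERIV_add DERIV_diff DERIV_cmult DERIV_chain2[OF DERIV_ln_divide dp] DERIV_chain2[OF DERIV_ln_divide dq]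
          DERIV_chain2[OF DERIV_arctan l(1)] DERIV_chain2[OF DERIV_arctan l(2)] pos)
    moreover have "1 / (4 * r) * (1 / p u * (2 * u - r) - 1 / q u * (2 * u + r)) +
        1 / (2 * r) * (inverse (1 + (r * u + 1)\<^sup>2) * r + inverse (1 + (r * u - 1)\<^sup>2) * r) = u\<^sup>2 / (p u * q u)"
    proof -
      have "1 / (4 * r) * (1 / p u * (2 * u - r) - 1 / q u * (2 * u + r)) + 1 / (2 * r) * (inverse (2 * q u) * r + inverse (2 * p u) * r)
         = (((2 * u - r) * q u - (2 * u + r) * p u) + r * (p u + q u)) / (4 * r * (p u * q u))"
        using pos[of u] r(2) by (simp add: field_simps)
      also have "((2 * u - r) * q u - (2 * u + r) * p u) + r * (p u + q u) = 4 * r * u\<^sup>2"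
        unfolding p_def q_def by (simp add: power2_eq_square algebra_simps)
      finally show ?thesis using r(2) unfolding p2 q2 by simp
    qed
    ultimately show ?thesis by (simp add: pq)
  qed
  have "(\<integral>\<^sup>+u. ennreal (u\<^sup>2 / (u ^ 4 + 1)) * indicator {0..} u \<partial>lborel) = ennreal (1 / (4 * r) * ln 1 + 1 / (2 * r) * (pi / 2 + pi / 2) - H 0)"
  proof (rule nn_integral_FTC_atLeast[OF _ D])
    have inv: "((\<lambda>u::real. 1 / u) \<longlongrightarrow> 0) at_top"
      by (rule tendsto_divide_0[OF tendsto_const filterlim_at_top_imp_at_infinity[OF filterlim_ident]])
    have "((\<lambda>u. (1 - r * (1 / u) + (1 / u)\<^sup>2) / (1 + r * (1 / u) + (1 / u)\<^sup>2)) \<longlongrightarrow> (1 - r * 0 + 0\<^sup>2) / (1 + r * 0 + 0\<^sup>2)) at_top"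
      by (intro tendsto_intros inv) auto
    then have "((\<lambda>u. ln ((1 - r * (1 / u) + (1 / u)\<^sup>2) / (1 + r * (1 / u) + (1 / u)\<^sup>2))) \<longlongrightarrow> ln 1) at_top"
      by (intro tendsto_ln) auto
    moreover have "\<forall>\<^sub>F u in at_top. ln ((1 - r * (1 / u) + (1 / u)\<^sup>2) / (1 + r * (1 / u) + (1 / u)\<^sup>2)) = ln (p u) - ln (q u)"
      using eventually_gt_at_top[of 0]
    proof eventually_elim
      case (elim u)
      have "1 - r * (1 / u) + (1 / u)\<^sup>2 = p u / u\<^sup>2" "1 + r * (1 / u) + (1 / u)\<^sup>2 = q u / u\<^sup>2"
        using elim by (simp_all add: p_def q_def power2_eq_square field_simps)
      then show ?case using elim pos[of u] by (simp add: ln_div)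
    qed
    ultimately have a: "((\<lambda>u. ln (p u) - ln (q u)) \<longlongrightarrow> ln 1) at_top"
      by (rule Lim_transform_eventually)
    have lin: "filterlim (\<lambda>u. r * u) at_top at_top"
      by (rule filterlim_tendsto_pos_mult_at_top[OF tendsto_const r(2) filterlim_ident])
    have "filterlim (\<lambda>u. 1 + r * u) at_top at_top" "filterlim (\<lambda>u. -1 + r * u) at_top at_top"
      by (rule filterlim_tendsto_add_at_top[OF tendsto_const lin])+
    then have b: "((\<lambda>u. arctan (r * u + 1)) \<longlongrightarrow> pi / 2) at_top" "((\<lambda>u. arctan (r * u - 1)) \<longlongrightarrow> pi / 2) at_top"
      using filterlim_compose[OF tendsto_arctan_at_top] by (simp_all add: add.commute)
    show "(H \<longlongrightarrow> 1 / (4 * r) * ln 1 + 1 / (2 * r) * (pi / 2 + pi / 2)) at_top"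
      unfolding H_def[abs_def] by (intro tendsto_add tendsto_mult_left a b)
  qed auto
  moreover have "H 0 = 0" by (simp add: H_def p_def q_def arctan_minus)
  moreover have "(\<integral>\<^sup>+u. ennreal (u\<^sup>2 / (u ^ 4 + 1)) * indicator {0..} u \<partial>lborel) =
      (\<integral>\<^sup>+u. ennreal (u\<^sup>2 / (u ^ 4 + 1)) * indicator {0<..} u \<partial>lborel)"
    by (intro nn_integral_cong) (auto simp: indicator_def)
  ultimately show ?thesis by (simp add: r_def)
qed

text \<open>This is the integral for Im m with the density replaced by its edge asymptotics 2 sqrt
  \<alpha>; \<alpha> = \<eta> u^2 reduces it to \<open>quartic_integral\<close>.\<close>

lemma edge_resolvent_integral:
  assumes \<eta>: "0 < \<eta>"
  shows "has_bochner_integral lborel (\<lambda>\<alpha>. indicator {0<..} \<alpha> * (2 * sqrt \<alpha> / (\<alpha>\<^sup>2 + \<eta>\<^sup>2))) (sqrt 2 * pi / sqrt \<eta>)"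
proof (rule has_bochner_integral_nn_integral)
  let ?f = "\<lambda>u::real. ennreal (u\<^sup>2 / (u ^ 4 + 1))"
  have "ennreal (pi / (2 * sqrt 2)) = (\<integral>\<^sup>+u. ?f u * indicator {0<..} u \<partial>lborel)"
    by (rule quartic_integral[symmetric])
  also have "\<dots> = (\<integral>\<^sup>+t. ?f (sqrt (t / \<eta>)) * ennreal (1 / (2 * sqrt (\<eta> * t))) * indicator {0<..} t \<partial>lborel)"
    by (rule nn_integral_sqrt_substitution[OF _ \<eta>]) measurable
  also have "\<dots> = (\<integral>\<^sup>+t. ennreal (sqrt \<eta> / 4) * ennreal (indicator {0<..} t * (2 * sqrt t / (t\<^sup>2 + \<eta>\<^sup>2))) \<partial>lborel)"
  proof (intro nn_integral_cong)
    fix t :: real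
    show "?f (sqrt (t / \<eta>)) * ennreal (1 / (2 * sqrt (\<eta> * t))) * indicator {0<..} t =
        ennreal (sqrt \<eta> / 4) * ennreal (indicator {0<..} t * (2 * sqrt t / (t\<^sup>2 + \<eta>\<^sup>2)))"
    proof (cases "0 < t")
      case True
      have e: "(sqrt (t / \<eta>))\<^sup>2 = t / \<eta>" "(sqrt (t / \<eta>)) ^ 4 = t\<^sup>2 / \<eta>\<^sup>2"
      proof -
        show 1: "(sqrt (t / \<eta>))\<^sup>2 = t / \<eta>" using True \<eta> by simp
        have "(sqrt (t / \<eta>)) ^ 4 = ((sqrt (t / \<eta>))\<^sup>2)\<^sup>2" by (simp add: power_mult[symmetric])
        then show "(sqrt (t / \<eta>)) ^ 4 = t\<^sup>2 / \<eta>\<^sup>2" unfolding 1 by (simp add: power_divide)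
      qed
      have s: "t\<^sup>2 + \<eta>\<^sup>2 > 0" using True by (simp add: add_pos_nonneg)
      have "t / \<eta> / (t\<^sup>2 / \<eta>\<^sup>2 + 1) = t * \<eta> / (t\<^sup>2 + \<eta>\<^sup>2)"
        using \<eta> s by (simp add: divide_simps power2_eq_square)
      moreover have "t * \<eta> / S * (1 / (2 * sqrt (\<eta> * t))) = sqrt \<eta> / 4 * (2 * sqrt t / S)" for S
      proof -
        have "(A * A) * (B * B) / S * (1 / (2 * (B * A))) = B / 4 * (2 * A / S)" if "A \<noteq> 0" "B \<noteq> 0" for A B
          using that by simp
        moreover have "sqrt t \<noteq> 0" "sqrt \<eta> \<noteq> 0" and sq: "sqrt t * sqrt t = t" "sqrt \<eta> * sqrt \<eta> = \<eta>"
          using True \<eta> by simp_all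
        ultimately have "(sqrt t * sqrt t) * (sqrt \<eta> * sqrt \<eta>) / S * (1 / (2 * (sqrt \<eta> * sqrt t))) = sqrt \<eta> / 4 * (2 * sqrt t / S)"
          by blast
        then show ?thesis unfolding sq real_sqrt_mult .
      qed
      ultimately show ?thesis
        using True \<eta> s unfolding e by (simp add: ennreal_mult'[symmetric] ennreal_mult''[symmetric])
    qed simp
  qed
  also have "\<dots> = ennreal (sqrt \<eta> / 4) * (\<integral>\<^sup>+t. ennreal (indicator {0<..} t * (2 * sqrt t / (t\<^sup>2 + \<eta>\<^sup>2))) \<partial>lborel)"
    by (rule nn_integral_cmult) measurable
  finally have "ennreal (4 / sqrt \<eta>) * ennreal (pi / (2 * sqrt 2)) = ennreal (4 / sqrt \<eta>) * ennreal (sqrt \<eta> / 4) *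
      (\<integral>\<^sup>+t. ennreal (indicator {0<..} t * (2 * sqrt t / (t\<^sup>2 + \<eta>\<^sup>2))) \<partial>lborel)"
    by (simp add: mult.assoc)
  also have "ennreal (4 / sqrt \<eta>) * ennreal (sqrt \<eta> / 4) = 1"
    using \<eta> by (simp add: ennreal_mult'[symmetric])
  finally have "(\<integral>\<^sup>+t. ennreal (indicator {0<..} t * (2 * sqrt t / (t\<^sup>2 + \<eta>\<^sup>2))) \<partial>lborel) = ennreal (4 / sqrt \<eta> * (pi / (2 * sqrt 2)))"
    using \<eta> by (simp add: ennreal_mult'[symmetric])
  also have "4 / sqrt \<eta> * (pi / (2 * sqrt 2)) = sqrt 2 * pi / sqrt \<eta>"
  proof -
    have "4 / A * (pi / (2 * B)) = 2 / B * pi / A" for A B :: real by simp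
    moreover have "2 / sqrt 2 = sqrt (2 :: real)" by (rule real_div_sqrt) simp
    ultimately show ?thesis by (simp only:)
  qed
  finally show "(\<integral>\<^sup>+t. ennreal (indicator {0<..} t * (2 * sqrt t / (t\<^sup>2 + \<eta>\<^sup>2))) \<partial>lborel) = ennreal (sqrt 2 * pi / sqrt \<eta>)" .
qed (use \<eta> in \<open>auto simp: indicator_def\<close>)

lemma Im_m_sc_edge:
  assumes s: "s = 1 \<or> s = -1" and \<eta>: "0 < \<eta>"
  shows "Im (m_sc (Complex (2 * s) \<eta>)) = \<eta> / (2 * pi) *
    (LINT \<alpha>|lborel. indicator {0..4} \<alpha> * (sqrt \<alpha> * sqrt (4 - \<alpha>)) / (\<alpha>\<^sup>2 + \<eta>\<^sup>2))"
proof -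
  let ?z = "Complex (2 * s) \<eta>"
  let ?g = "\<lambda>x. complex_of_real (sqrt (4 - x\<^sup>2)) / (2 * of_real pi * (complex_of_real x - ?z))"
  have ne: "complex_of_real x - ?z \<noteq> 0" for x using \<eta> by (auto simp: complex_eq_iff)
  have "continuous_on {-2..2} ?g"
    by (intro continuous_intros) (use ne in auto)
  then have "integrable lborel (\<lambda>x. indicator {-2..2} x *\<^sub>R ?g x)"
    by (intro borel_integrable_compact) auto
  then have "Im (m_sc ?z) = (LINT x|lborel. Im (indicator {-2..2} x *\<^sub>R ?g x))"
    unfolding m_sc_def set_lebesgue_integral_def by (rule integral_Im[symmetric])
  also have "\<dots> = (LINT x|lborel. \<eta> / (2 * pi) * (chi x * hgt x / ((x - 2 * s)\<^sup>2 + \<eta>\<^sup>2)))"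
  proof (intro Bochner_Integration.integral_cong refl)
    fix x :: real
    have "?g x = of_real (sqrt (4 - x\<^sup>2) / (2 * pi)) * inverse (complex_of_real x - ?z)"
      by (simp add: divide_simps)
    then have "Im (?g x) = sqrt (4 - x\<^sup>2) / (2 * pi) * Im (inverse (complex_of_real x - ?z))"
      by (simp only: times_complex.sel Re_complex_of_real Im_complex_of_real)
    also have "Im (inverse (complex_of_real x - ?z)) = \<eta> / ((x - 2 * s)\<^sup>2 + \<eta>\<^sup>2)"
      by simp
    finally show "Im (indicator {-2..2} x *\<^sub>R ?g x) = \<eta> / (2 * pi) * (chi x * hgt x / ((x - 2 * s)\<^sup>2 + \<eta>\<^sup>2))"
      by (simp add: chi_def hgt_def)
  qed
  also have "\<dots> = \<eta> / (2 * pi) * (LINT x|lborel. chi x * hgt x / ((x - 2 * s)\<^sup>2 + \<eta>\<^sup>2))"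
    by (rule integral_mult_right_zero)
  also have "(LINT x|lborel. chi x * hgt x / ((x - 2 * s)\<^sup>2 + \<eta>\<^sup>2)) =
      (LINT \<alpha>|lborel. indicator {0..4} \<alpha> * (sqrt \<alpha> * sqrt (4 - \<alpha>)) / (\<alpha>\<^sup>2 + \<eta>\<^sup>2))"
  proof -
    have sq: "((2 * s + (- s) * \<alpha>) - 2 * s)\<^sup>2 = \<alpha>\<^sup>2" for \<alpha> using s by auto
    have "- s \<noteq> 0" "\<bar>- s\<bar> = 1" using s by auto
    then show ?thesis
      using lborel_integral_real_affine[of "- s" "\<lambda>x. chi x * hgt x / ((x - 2 * s)\<^sup>2 + \<eta>\<^sup>2)" "2 * s"]
      unfolding hgt_shift[OF s] sq by simp
  qed
  finally show ?thesis .
qed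

text \<open>The Stieltjes transform is not evaluated in closed form; its integral is compared with
  that of \<open>edge_resolvent_integral\<close>. The integrands differ by at most 1 / (2 sqrt
  \<alpha>) below 4 and 2 \<alpha>^(-3/2) above, each of mass 2, and the prefactor \<eta> / (2
  \<pi>) turns the total 4 into 2 \<eta> / \<pi>.\<close>

lemma Im_m_sc_edge_estimate:
  assumes s: "s = 1 \<or> s = -1" and \<eta>: "0 < \<eta>"
  shows "\<bar>Im (m_sc (Complex (2 * s) \<eta>)) - sqrt (\<eta> / 2)\<bar> \<le> 2 * \<eta> / pi"
proof -
  let ?G = "\<lambda>\<alpha>. indicator {0..4} \<alpha> * (sqrt \<alpha> * sqrt (4 - \<alpha>)) / (\<alpha>\<^sup>2 + \<eta>\<^sup>2)"
  let ?H = "\<lambda>\<alpha>. indicator {0<..} \<alpha> * (2 * sqrt \<alpha> / (\<alpha>\<^sup>2 + \<eta>\<^sup>2))"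
  have H: "integrable lborel ?H" "(LINT \<alpha>|lborel. ?H \<alpha>) = sqrt 2 * pi / sqrt \<eta>"
    using edge_resolvent_integral[OF \<eta>] by (auto simp: has_bochner_integral_iff)
  let ?a = "\<lambda>\<alpha>::real. indicator {0..4} \<alpha> * (1 / (2 * sqrt \<alpha>))" and ?b = "\<lambda>\<alpha>::real. indicator {4..} \<alpha> * (2 / (\<alpha> * sqrt \<alpha>))"
  have a: "has_bochner_integral lborel ?a 2"
  proof -
    have "has_bochner_integral lborel ?a (sqrt 4 - sqrt 0)"
    proof (rule FTC_interior_nonneg[where F = sqrt])
      show "(sqrt has_real_derivative 1 / (2 * sqrt x)) (at x)" if "0 < x" "x < 4" for x
        using that by (auto intro!: derivative_eq_intros simp: field_simps)
    qed (auto intro!: continuous_intros)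
    then show ?thesis by simp
  qed
  have b: "has_bochner_integral lborel ?b 2"
    using has_bochner_integral_mult_right[OF inverse_three_halves_integral, of 2] by (simp add: mult_ac)
  have ab: "integrable lborel (\<lambda>\<alpha>. ?a \<alpha> + ?b \<alpha>)" "(LINT \<alpha>|lborel. ?a \<alpha> + ?b \<alpha>) = 4"
    using has_bochner_integral_add[OF a b] by (auto simp: has_bochner_integral_iff)
  have pt: "\<bar>?G \<alpha> - ?H \<alpha>\<bar> \<le> ?a \<alpha> + ?b \<alpha>" for \<alpha>
  proof -
    consider "\<alpha> \<le> 0" | "0 < \<alpha>" "\<alpha> < 4" | "4 \<le> \<alpha>" by linarith
    then show ?thesis
    proof cases
      case 1
      then show ?thesis by (cases "\<alpha> = 0") (auto simp: indicator_def)
    next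
      case 2
      have d: "\<bar>sqrt (4 - \<alpha>) - 2\<bar> \<le> \<alpha> / 2" using 2 by (intro sqrt_four_minus) auto
      have "?G \<alpha> - ?H \<alpha> = sqrt \<alpha> * (sqrt (4 - \<alpha>) - 2) / (\<alpha>\<^sup>2 + \<eta>\<^sup>2)"
        using 2 by (simp add: diff_divide_distrib right_diff_distrib)
      then have "\<bar>?G \<alpha> - ?H \<alpha>\<bar> = sqrt \<alpha> * \<bar>sqrt (4 - \<alpha>) - 2\<bar> / (\<alpha>\<^sup>2 + \<eta>\<^sup>2)"
        using 2 by (simp add: abs_mult abs_divide)
      also have "\<dots> \<le> sqrt \<alpha> * (\<alpha> / 2) / \<alpha>\<^sup>2"
        using d 2 by (intro frac_le mult_left_mono) auto
      also have "\<dots> = 1 / (2 * sqrt \<alpha>)"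
      proof -
        have "\<alpha> = sqrt \<alpha> * sqrt \<alpha>" using 2 by simp
        then show ?thesis using 2 by (simp add: power2_eq_square field_simps)
      qed
      finally show ?thesis using 2 by simp
    next
      case 3
      have "?G \<alpha> = 0" using 3 by (cases "\<alpha> = 4") auto
      moreover have "?H \<alpha> = 2 * sqrt \<alpha> / (\<alpha>\<^sup>2 + \<eta>\<^sup>2)" "0 \<le> 2 * sqrt \<alpha> / (\<alpha>\<^sup>2 + \<eta>\<^sup>2)"
        using 3 by simp_all
      ultimately have "\<bar>?G \<alpha> - ?H \<alpha>\<bar> = 2 * sqrt \<alpha> / (\<alpha>\<^sup>2 + \<eta>\<^sup>2)"
        by (simp only:)
      also have "\<dots> \<le> 2 * sqrt \<alpha> / \<alpha>\<^sup>2" using 3 by (intro frac_le) auto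
      also have "\<dots> = 2 / (\<alpha> * sqrt \<alpha>)"
      proof -
        have "sqrt \<alpha> * sqrt \<alpha> = \<alpha>" using 3 by simp
        then show ?thesis using 3 by (simp add: power2_eq_square field_simps)
      qed
      also have "2 / (\<alpha> * sqrt \<alpha>) = ?b \<alpha>" using 3 by simp
      also have "?b \<alpha> \<le> ?a \<alpha> + ?b \<alpha>" by (simp add: indicator_def)
      finally show ?thesis .
    qed
  qed
  have meas: "(\<lambda>\<alpha>. ?G \<alpha> - ?H \<alpha>) \<in> borel_measurable lborel" by measurable
  have di: "integrable lborel (\<lambda>\<alpha>. ?G \<alpha> - ?H \<alpha>)"
    by (rule Bochner_Integration.integrable_bound[OF ab(1) meas])
      (use pt in \<open>intro AE_I2, unfold real_norm_def, blast intro: order_trans abs_ge_self\<close>)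
  have "\<bar>LINT \<alpha>|lborel. ?G \<alpha> - ?H \<alpha>\<bar> \<le> 4"
    using abs_integral_le[OF meas ab(1) AE_I2[OF pt]] ab(2) by simp
  moreover have "(LINT \<alpha>|lborel. ?G \<alpha> - ?H \<alpha>) = (LINT \<alpha>|lborel. ?G \<alpha>) - sqrt 2 * pi / sqrt \<eta>"
  proof -
    have "integrable lborel (\<lambda>\<alpha>. (?G \<alpha> - ?H \<alpha>) + ?H \<alpha>)" using di H(1) by (rule Bochner_Integration.integrable_add)
    then have "integrable lborel ?G" by simp
    then show ?thesis using H by simp
  qed
  ultimately have d: "\<bar>(LINT \<alpha>|lborel. ?G \<alpha>) - sqrt 2 * pi / sqrt \<eta>\<bar> \<le> 4" by simp
  have lead: "\<eta> / (2 * pi) * (sqrt 2 * pi / sqrt \<eta>) = sqrt (\<eta> / 2)"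
  proof -
    have "\<eta> = sqrt \<eta> * sqrt \<eta>" "2 = sqrt 2 * sqrt (2::real)" using \<eta> by simp_all
    then show ?thesis using \<eta> by (simp add: real_sqrt_divide field_simps)
  qed
  have "Im (m_sc (Complex (2 * s) \<eta>)) - sqrt (\<eta> / 2) = \<eta> / (2 * pi) * ((LINT \<alpha>|lborel. ?G \<alpha>) - sqrt 2 * pi / sqrt \<eta>)"
    unfolding Im_m_sc_edge[OF s \<eta>] lead[symmetric] by (simp add: right_diff_distrib)
  then have "\<bar>Im (m_sc (Complex (2 * s) \<eta>)) - sqrt (\<eta> / 2)\<bar> = \<eta> / (2 * pi) * \<bar>(LINT \<alpha>|lborel. ?G \<alpha>) - sqrt 2 * pi / sqrt \<eta>\<bar>"
    using \<eta> by (simp add: abs_mult)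
  also have "\<dots> \<le> \<eta> / (2 * pi) * 4" using d \<eta> by (intro mult_left_mono) auto
  finally show ?thesis by simp
qed

text \<open>The condition c \<le> 1/16 makes the error in Im m at most half of its leading term sqrt
  (c / 2), so the reciprocal is under control. The numbers 16 and 12 come from \<pi> < 4 and sqrt 2
  \<le> 3/2.\<close>

lemma C_scale_edge:
  assumes s: "s = 1 \<or> s = -1" and c: "c = real N powr (- a)" and N: "0 < N" and small: "c \<le> 1 / 16"
  shows "\<bar>C_scale a (2 * s) N - sqrt 2 * pi / (c * sqrt c)\<bar> \<le> 16 / c"
    and "\<bar>C_scale a (2 * s) N\<bar> \<le> 12 / (c * sqrt c)"
proof -
  have c0: "0 < c" using N by (simp add: c)
  define w where "w = sqrt (c / 2)"
  define m where "m = \<bar>Im (m_sc (Complex (2 * s) c))\<bar>"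
  have w0: "0 < w" using c0 by (simp add: w_def)
  have w2: "w\<^sup>2 = c / 2" using c0 by (simp add: w_def)
  have "2 * c / pi \<le> 2 * c / 2" using pi_ge_two c0 by (intro divide_left_mono) auto
  then have "\<bar>Im (m_sc (Complex (2 * s) c)) - w\<bar> \<le> c"
    using Im_m_sc_edge_estimate[OF s c0] by (simp add: w_def)
  then have mw: "\<bar>m - w\<bar> \<le> c" using w0 by (auto simp: m_def abs_if split: if_splits)
  have cw: "c \<le> w / 2"
  proof (rule power2_le_imp_le)
    have "c * c \<le> 1 / 16 * c" using small c0 by (intro mult_right_mono) auto
    then show "c\<^sup>2 \<le> (w / 2)\<^sup>2" unfolding power_divide w2 using c0 by (simp add: power2_eq_square)
  qed (use w0 in simp)
  then have m: "w / 2 \<le> m" using mw by linarith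
  have m0: "0 < m" using m w0 by linarith
  have Na: "real N powr a = 1 / c" using N by (simp add: c powr_minus_divide)
  have C: "C_scale a (2 * s) N = pi / (c * m)"
    by (simp add: C_scale_def rho_sc_def Na m_def flip: c)
  have lead: "sqrt 2 * pi / (c * sqrt c) = pi / (c * w)"
    using c0 by (simp add: w_def real_sqrt_divide)
  have "pi / (c * m) - pi / (c * w) = pi / c * ((w - m) / (m * w))"
    using m0 w0 c0 by (simp add: field_simps)
  then have "\<bar>C_scale a (2 * s) N - sqrt 2 * pi / (c * sqrt c)\<bar> = pi / c * (\<bar>m - w\<bar> / (m * w))"
    unfolding C lead using m0 w0 c0 by (simp add: abs_mult abs_minus_commute)
  also have "\<dots> \<le> 4 / c * (c / (w / 2 * w))"
    using mw m w0 m0 c0 pi_less_4 by (intro mult_mono frac_le divide_right_mono mult_right_mono mult_pos_pos) auto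
  also have "\<dots> = 4 / c * (c / (w\<^sup>2 / 2))" by (simp add: power2_eq_square)
  also have "\<dots> = 16 / c" unfolding w2 using c0 by simp
  finally show "\<bar>C_scale a (2 * s) N - sqrt 2 * pi / (c * sqrt c)\<bar> \<le> 16 / c" .
  have "\<bar>C_scale a (2 * s) N\<bar> = pi / (c * m)" unfolding C using m0 c0 by simp
  also have "\<dots> \<le> 4 / (c * (w / 2))"
    using m w0 c0 pi_less_4 by (intro frac_le mult_left_mono mult_pos_pos) auto
  also have "\<dots> = 8 * sqrt 2 / (c * sqrt c)"
    using c0 by (simp add: w_def real_sqrt_divide)
  also have "\<dots> \<le> 12 / (c * sqrt c)"
  proof (rule divide_right_mono)
    have "sqrt 2 \<le> 3 / 2" by (rule real_le_lsqrt) (auto simp: power2_eq_square)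
    then show "8 * sqrt 2 \<le> 12" by simp
  qed (use c0 in simp)
  finally show "\<bar>C_scale a (2 * s) N\<bar> \<le> 12 / (c * sqrt c)" .
qed

context edge_scaling
begin

section \<open>Assembly of the estimates\<close>

lemma edge_function: "0 < \<epsilon> \<Longrightarrow> \<epsilon> \<le> 1 \<Longrightarrow> edge_function f s \<delta> M \<epsilon>"
  using f_meas s \<delta>_bounds f_edge by unfold_locales auto

lemma sqrt_\<delta>: "sqrt \<delta> = sqrt R * sqrt c"
  by (simp add: \<delta>_def real_sqrt_mult)

lemma c_le_sqrt: "c \<le> 1 \<Longrightarrow> c \<le> sqrt c"
proof -
  assume "c \<le> 1"
  then have "sqrt c * sqrt c \<le> 1 * sqrt c" using c by (intro mult_right_mono) auto
  then show ?thesis using c by simp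
qed

lemma V_d1_estimate: "\<bar>V_d1 f - (LINT \<alpha>|lborel. B0 \<alpha>) / pi\<bar> \<le> 2 * M\<^sup>2 * sqrt \<delta> * \<delta>\<^sup>2"
proof -
  interpret edge_function f s \<delta> M 1 by (rule edge_function) auto
  have "\<bar>avg_sc f\<bar>\<^sup>2 \<le> (M * sqrt \<delta> * \<delta>)\<^sup>2" by (rule power_mono[OF avg_sc_bound]) simp
  also have "\<dots> = M\<^sup>2 * (sqrt \<delta> * sqrt \<delta>) * \<delta>\<^sup>2" by (simp add: power2_eq_square)
  also have "\<dots> \<le> M\<^sup>2 * (1 * sqrt \<delta>) * \<delta>\<^sup>2"
    using \<delta>_bounds by (intro mult_right_mono mult_left_mono) auto
  finally have "\<bar>(avg_sc f)\<^sup>2\<bar> \<le> M\<^sup>2 * sqrt \<delta> * \<delta>\<^sup>2" by simp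
  then show ?thesis
    using avg_sc_sq_estimate unfolding V_d1_def by linarith
qed

text \<open>Two errors are separated: that of \<open>V_d1\<close>, of order \<delta>^(5/2) against C
  of order c^(-3/2), and that of C, of order 1/c against a main term of order \<delta>^(3/2). The
  second has order sqrt c and dictates the rate; 40 = 24 + 16.\<close>

lemma C_V_d1_estimate:
  assumes C: "\<bar>C - sqrt 2 * pi / (c * sqrt c)\<bar> \<le> 16 / c" "\<bar>C\<bar> \<le> 12 / (c * sqrt c)" and "c \<le> 1"
  shows "\<bar>C * V_d1 f - sqrt 2 * (L2_norm (\<lambda>x. h x * x))\<^sup>2\<bar> \<le> 40 * M\<^sup>2 * sqrt R * R\<^sup>2 * sqrt c"
proof -
  define J where "J = (LINT \<alpha>|lborel. B0 \<alpha>)"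
  have sc: "0 < sqrt c" "sqrt c * sqrt c = c" using c by auto
  have J: "\<bar>J\<bar> \<le> M\<^sup>2 * sqrt \<delta> * \<delta>" using B0_integral(2) by (simp add: J_def)
  have "sqrt 2 * (L2_norm (\<lambda>x. h x * x))\<^sup>2 = sqrt 2 * pi / (c * sqrt c) * (J / pi)"
    unfolding L2_B0 J_def by simp
  then have "C * V_d1 f - sqrt 2 * (L2_norm (\<lambda>x. h x * x))\<^sup>2 =
      C * (V_d1 f - J / pi) + (C - sqrt 2 * pi / (c * sqrt c)) * (J / pi)"
    by (simp add: algebra_simps)
  also have "\<bar>\<dots>\<bar> \<le> \<bar>C\<bar> * \<bar>V_d1 f - J / pi\<bar> + \<bar>C - sqrt 2 * pi / (c * sqrt c)\<bar> * \<bar>J / pi\<bar>"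
    using abs_triangle_ineq[of "C * (V_d1 f - J / pi)"] by (simp only: abs_mult[symmetric])
  also have "\<dots> \<le> 12 / (c * sqrt c) * (2 * M\<^sup>2 * sqrt \<delta> * \<delta>\<^sup>2) + 16 / c * (M\<^sup>2 * sqrt \<delta> * \<delta>)"
  proof (intro add_mono mult_mono)
    show "\<bar>V_d1 f - J / pi\<bar> \<le> 2 * M\<^sup>2 * sqrt \<delta> * \<delta>\<^sup>2"
      unfolding J_def by (rule V_d1_estimate)
    have "\<bar>J / pi\<bar> \<le> \<bar>J\<bar> / 1"
      unfolding abs_divide using pi_ge_two by (intro frac_le) auto
    then show "\<bar>J / pi\<bar> \<le> M\<^sup>2 * sqrt \<delta> * \<delta>" using J by simp
  qed (use C c in auto)
  also have "\<dots> = 24 * M\<^sup>2 * sqrt R * R\<^sup>2 * c + 16 * M\<^sup>2 * sqrt R * R * sqrt c"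
    unfolding sqrt_\<delta> using c sc by (simp add: \<delta>_def power2_eq_square)
  also have "\<dots> \<le> 24 * M\<^sup>2 * sqrt R * R\<^sup>2 * sqrt c + 16 * M\<^sup>2 * sqrt R * R\<^sup>2 * sqrt c"
  proof (intro add_mono mult_left_mono mult_right_mono)
    show "c \<le> sqrt c" by (rule c_le_sqrt[OF \<open>c \<le> 1\<close>])
    show "R \<le> R\<^sup>2" using R by (simp add: power2_eq_square)
  qed (use R c in auto)
  also have "\<dots> = 40 * M\<^sup>2 * sqrt R * R\<^sup>2 * sqrt c" by simp
  finally show ?thesis .
qed

text \<open>Neither \<open>g\<close>, \<open>s\<close> nor \<open>c\<close> enters, directly or
  through \<open>K\<close> and \<open>\<psi>\<close>. Outside the locale the constant therefore
  depends on \<open>L\<close>, \<open>M\<close>, \<open>R\<close> and \<epsilon> alone and can be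
  fixed before N, \<sigma>, s and g.\<close>

definition err_const :: "real \<Rightarrow> real" where
  "err_const \<epsilon> = K * (LINT x|lborel. \<psi> x) * sqrt R + M\<^sup>2 * (16 / (min 1 (\<epsilon>\<^sup>2))\<^sup>2) * R +
    40 * M\<^sup>2 * sqrt R * R\<^sup>2 + 12 * M\<^sup>2 * (1 / (min 1 (\<epsilon>\<^sup>2))\<^sup>2 + 1) * R ^ 3 +
    M * (1 + 1 / min 1 (\<epsilon>\<^sup>2)) * sqrt R + M * sqrt R"

lemma edge_asymptotics:
  assumes \<epsilon>: "0 < \<epsilon>" "\<epsilon> \<le> 1" and \<sigma>: "-1 \<le> \<sigma>" "\<sigma> = 1 \<or> \<sigma> \<le> 1 - \<epsilon>"
    and N: "c = real N powr (- a)" "0 < N" "c \<le> 1 / 16"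
  shows "\<bar>V_tr1 f - (H_half_norm h)\<^sup>2 / (8 * pi\<^sup>2)\<bar> \<le> err_const \<epsilon> * sqrt c"
    and "\<bar>V_tr2 f \<sigma> - of_bool (\<sigma> = 1) * ((H_half_norm h)\<^sup>2 / (8 * pi\<^sup>2))\<bar> \<le> err_const \<epsilon> * sqrt c"
    and "\<bar>C_scale a (2 * s) N * V_d1 f - sqrt 2 * (L2_norm (\<lambda>x. h x * x))\<^sup>2\<bar> \<le> err_const \<epsilon> * sqrt c"
    and "\<bar>C_scale a (2 * s) N * V_d2 f \<sigma> - of_bool (\<sigma> = 1) * (sqrt 2 * (L2_norm (\<lambda>x. h x * x))\<^sup>2)\<bar> \<le> err_const \<epsilon> * sqrt c"
    and "\<bar>E_tr f \<sigma> - of_bool (\<sigma> = 1) * (- g 0 / 2)\<bar> \<le> err_const \<epsilon> * sqrt c"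
proof -
  interpret edge_function f s \<delta> M \<epsilon> by (rule edge_function[OF \<epsilon>])
  have c1: "c \<le> 1" using N(3) by simp
  have sc: "0 \<le> sqrt c" "sqrt c * sqrt c = c" using c by auto
  have \<psi>_int: "0 \<le> (LINT x|lborel. \<psi> x)" using \<psi>_nonneg by (intro integral_nonneg_AE) auto
  \<comment> \<open>The summands of \<open>err_const\<close>, one for each estimate; all are
    nonnegative, so each is dominated by the sum.\<close>
  let ?t = "[K * (LINT x|lborel. \<psi> x) * sqrt R, M\<^sup>2 * (16 / c\<epsilon>\<^sup>2) * R, 40 * M\<^sup>2 * sqrt R * R\<^sup>2,
    12 * M\<^sup>2 * (1 / c\<epsilon>\<^sup>2 + 1) * R ^ 3, M * (1 + 1 / c\<epsilon>) * sqrt R, M * sqrt R]"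
  have t0: "0 \<le> x" if "x \<in> set ?t" for x
    using that K_nonneg \<psi>_int M_nonneg R by (auto intro!: mult_nonneg_nonneg add_nonneg_nonneg)
  have err: "err_const \<epsilon> = sum_list ?t" by (simp add: err_const_def)
  have le: "x * sqrt c \<le> err_const \<epsilon> * sqrt c" if "x \<in> set ?t" for x
    unfolding err using member_le_sum_list[OF that] t0 sc(1) by (intro mult_right_mono) auto
  note CN = C_scale_edge[OF s_cases N]
  have "K * (LINT x|lborel. \<psi> x) * sqrt \<delta> = K * (LINT x|lborel. \<psi> x) * sqrt R * sqrt c"
    by (simp add: sqrt_\<delta>)
  also have "\<dots> \<le> err_const \<epsilon> * sqrt c" by (rule le) simp
  finally show 1: "\<bar>V_tr1 f - (H_half_norm h)\<^sup>2 / (8 * pi\<^sup>2)\<bar> \<le> err_const \<epsilon> * sqrt c"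
    using V_tr1_estimate by linarith
  have "40 * M\<^sup>2 * sqrt R * R\<^sup>2 * sqrt c \<le> err_const \<epsilon> * sqrt c" by (rule le) simp
  then show 3: "\<bar>C_scale a (2 * s) N * V_d1 f - sqrt 2 * (L2_norm (\<lambda>x. h x * x))\<^sup>2\<bar> \<le> err_const \<epsilon> * sqrt c"
    using C_V_d1_estimate[OF CN c1] by linarith
  show "\<bar>V_tr2 f \<sigma> - of_bool (\<sigma> = 1) * ((H_half_norm h)\<^sup>2 / (8 * pi\<^sup>2))\<bar> \<le> err_const \<epsilon> * sqrt c"
  proof (cases "\<sigma> = 1")
    case True
    then show ?thesis using 1 V_tr2_one[OF f_Lip f_bound] by simp
  next
    case False
    then have "\<bar>V_tr2 f \<sigma>\<bar> \<le> M\<^sup>2 * (16 / c\<epsilon>\<^sup>2) * \<delta>" using \<sigma> by (intro V_tr2_bound) auto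
    also have "\<dots> = M\<^sup>2 * (16 / c\<epsilon>\<^sup>2) * R * c" by (simp add: \<delta>_def)
    also have "\<dots> \<le> M\<^sup>2 * (16 / c\<epsilon>\<^sup>2) * R * sqrt c"
      using c_le_sqrt[OF c1] R by (intro mult_left_mono) auto
    also have "\<dots> \<le> err_const \<epsilon> * sqrt c" by (rule le) simp
    finally show ?thesis using False by simp
  qed
  show "\<bar>C_scale a (2 * s) N * V_d2 f \<sigma> - of_bool (\<sigma> = 1) * (sqrt 2 * (L2_norm (\<lambda>x. h x * x))\<^sup>2)\<bar> \<le> err_const \<epsilon> * sqrt c"
  proof (cases "\<sigma> = 1")
    case True
    then show ?thesis using 3 V_d2_one[OF f_Lip f_bound] by simp
  next
    case False
    let ?e = "M\<^sup>2 * (1 / c\<epsilon>\<^sup>2 + 1)"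
    have e0: "0 \<le> ?e" by (intro mult_nonneg_nonneg add_nonneg_nonneg) auto
    have "\<bar>V_d2 f \<sigma>\<bar> \<le> ?e * \<delta> ^ 3" using \<sigma> False by (intro V_d2_bound) auto
    then have "\<bar>C_scale a (2 * s) N * V_d2 f \<sigma>\<bar> \<le> 12 / (c * sqrt c) * (?e * \<delta> ^ 3)"
      unfolding abs_mult using CN(2) c by (intro mult_mono) auto
    also have "\<dots> = 12 * ?e * R ^ 3 * (c ^ 3 / (c * sqrt c))"
      by (simp only: \<delta>_def power_mult_distrib times_divide_eq_left times_divide_eq_right mult_ac)
    also have "c ^ 3 / (c * sqrt c) = c * sqrt c"
    proof -
      have "c ^ 3 = c * c * (sqrt c * sqrt c)" unfolding sc(2) by (simp add: power3_eq_cube)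
      also have "\<dots> = (c * sqrt c) * (c * sqrt c)" by (simp only: mult_ac)
      finally show ?thesis using c by (simp only:) simp
    qed
    also have "12 * ?e * R ^ 3 * (c * sqrt c) \<le> 12 * ?e * R ^ 3 * (1 * sqrt c)"
      using c c1 e0 R by (intro mult_left_mono mult_right_mono mult_nonneg_nonneg[OF mult_nonneg_nonneg[OF _ e0]]) auto
    also have "\<dots> = 12 * M\<^sup>2 * (1 / c\<epsilon>\<^sup>2 + 1) * R ^ 3 * sqrt c" by (simp only: mult_1 mult.assoc)
    also have "\<dots> \<le> err_const \<epsilon> * sqrt c" by (rule le) simp
    finally show ?thesis using False by simp
  qed
  show "\<bar>E_tr f \<sigma> - of_bool (\<sigma> = 1) * (- g 0 / 2)\<bar> \<le> err_const \<epsilon> * sqrt c"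
  proof (cases "\<sigma> = 1")
    case True
    \<comment> \<open>The opposite edge lies at scaled distance 4 / c, beyond the support, so one of
      f(2), f(-2) is g(0) and the other 0.\<close>
    have "R < 4 / c" using Rc c by (simp add: field_simps)
    then have "g (4 / c) = 0" "g (- (4 / c)) = 0" using R c by (auto intro!: g_supp)
    then have "f 2 + f (-2) = g 0"
      using s_cases by (auto simp: f_def)
    then have "E_tr f 1 - (- g 0 / 2) = avg_inv_sc f"
      using E_tr_one[OF f_Lip f_bound] by simp
    moreover have "\<bar>avg_inv_sc f\<bar> \<le> M * sqrt R * sqrt c"
      using avg_inv_sc_bound[OF f_meas f_edge M_nonneg] by (simp add: sqrt_\<delta>)
    moreover have "M * sqrt R * sqrt c \<le> err_const \<epsilon> * sqrt c" by (rule le) simp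
    ultimately show ?thesis using True by simp
  next
    case False
    then have "\<bar>E_tr f \<sigma>\<bar> \<le> M * (1 + 1 / c\<epsilon>) * sqrt \<delta>" using \<sigma> by (intro E_tr_bound) auto
    also have "\<dots> = M * (1 + 1 / c\<epsilon>) * sqrt R * sqrt c" by (simp add: sqrt_\<delta>)
    also have "\<dots> \<le> err_const \<epsilon> * sqrt c" by (rule le) simp
    finally show ?thesis using False by simp
  qed
qed

end

text \<open>The order of quantifiers expresses the uniformity of the implicit constants, and s = -1
  is the left edge. Continuity of \<open>g\<close> selects the representative of the Sobolev class
  for which g(0) is meaningful. The factors sqrt 2 and -1/2 stand where the English statement has
  1/\<pi> and 1/4; they are what the definitions of C_N and E_tr give.\<close>

theorem proposition2p10:
  fixes a \<epsilon> K R :: real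
  assumes "0 < a" and "a < 2/3" and "\<epsilon> > 0"
  shows "\<exists>C N0. \<forall>(N::nat) (\<sigma>::real) (s::real) (g::real \<Rightarrow> real).
    N \<ge> N0 \<longrightarrow> \<sigma> \<in> {-1..1} \<longrightarrow> (\<sigma> = 1 \<or> \<sigma> \<le> 1 - \<epsilon>) \<longrightarrow> s \<in> {1, -1} \<longrightarrow>
    g \<in> H2_0 \<longrightarrow> continuous_on UNIV g \<longrightarrow> H2_norm g \<le> K \<longrightarrow>
    compact (closure {x. g x \<noteq> 0}) \<longrightarrow> closure {x. g x \<noteq> 0} \<subseteq> {-R..R} \<longrightarrow>
    (let E = 2 * s;
         f = (\<lambda>x. g (real N powr a * (x - E)));
         err = C * real N powr (- a / 2)
     in
       \<bar>V_tr1 f - (H_half_norm (\<lambda>x. g (- s * x^2)))^2 / (8 * pi^2)\<bar> \<le> err \<and>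
       \<bar>V_tr2 f \<sigma> - of_bool (\<sigma> = 1) * ((H_half_norm (\<lambda>x. g (- s * x^2)))^2 / (8 * pi^2))\<bar> \<le> err \<and>
       \<bar>C_scale a E N * V_d1 f - sqrt 2 * (L2_norm (\<lambda>x. g (- s * x^2) * x))^2\<bar> \<le> err \<and>
       \<bar>C_scale a E N * V_d2 f \<sigma>
          - of_bool (\<sigma> = 1) * (sqrt 2 * (L2_norm (\<lambda>x. g (- s * x^2) * x))^2)\<bar> \<le> err \<and>
       \<bar>E_tr f \<sigma> - of_bool (\<sigma> = 1) * (- g 0 / 2)\<bar> \<le> err)"
proof -
  obtain L where L: "0 \<le> L" and Lip: "\<And>g. g \<in> H2 \<Longrightarrow> continuous_on UNIV g \<Longrightarrow> H2_norm g \<le> K \<Longrightarrow>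
      closure {x. g x \<noteq> 0} \<subseteq> {-R..R} \<Longrightarrow> lip_bound L g"
    using H2_Lipschitz[of K R] unfolding lip_bound_def by blast
  define r where "r = \<bar>R\<bar> + 1"
  \<comment> \<open>\<open>g\<close> vanishes at r + 1, and every point of the support is at
    distance at most 2 r + 1 from there.\<close>
  define M where "M = L * (2 * r + 1)"
  \<comment> \<open>Capping at 1 only enlarges the range \<sigma> \<le> 1 - e and makes it contain
    (-1, 0), from which -1 is approached.\<close>
  define e where "e = min \<epsilon> 1"
  have r: "1 \<le> r" by (simp add: r_def)
  have e: "0 < e" "e \<le> 1" using assms(3) by (auto simp: e_def)
  \<comment> \<open>From N0 on, 16 r \<le> N^a. This yields both r c \<le> 1/2, required by the
    locale, and c \<le> 1/16, required by \<open>C_scale_edge\<close>.\<close>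
  define N0 where "N0 = nat \<lceil>(16 * r) powr (1 / a)\<rceil>"
  show ?thesis
  proof (intro exI[of _ "edge_scaling.err_const L M r e"] exI[of _ N0] allI impI)
    fix N :: nat and \<sigma> s :: real and g :: "real \<Rightarrow> real"
    assume N: "N \<ge> N0" and \<sigma>: "\<sigma> \<in> {-1..1}" "\<sigma> = 1 \<or> \<sigma> \<le> 1 - \<epsilon>" and s: "s \<in> {1, -1}"
      and g: "g \<in> H2_0" "continuous_on UNIV g" "H2_norm g \<le> K"
        "compact (closure {x. g x \<noteq> 0})" "closure {x. g x \<noteq> 0} \<subseteq> {-R..R}"
    have g_Lip: "lip_bound L g" using g by (intro Lip) (auto simp: H2_0_def)
    have g_supp: "g x = 0" if "\<bar>x\<bar> > r" for x
      using g(5) closure_subset[of "{x. g x \<noteq> 0}"] that by (force simp: r_def)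
    have g_bound: "\<bar>g x\<bar> \<le> M" for x
    proof (cases "\<bar>x\<bar> > r")
      case True
      then show ?thesis using g_supp[OF True] L r by (simp add: M_def)
    next
      case False
      have "\<bar>g x - g (r + 1)\<bar> \<le> L * \<bar>x - (r + 1)\<bar>" using g_Lip by (simp add: lip_bound_def)
      also have "\<dots> \<le> L * (2 * r + 1)" using False L by (intro mult_left_mono) auto
      finally show ?thesis using g_supp[of "r + 1"] r by (simp add: M_def)
    qed
    define c where "c = real N powr (- a)"
    have big: "(16 * r) powr (1 / a) \<le> real N"
      using N real_nat_ceiling_ge[of "(16 * r) powr (1 / a)"] unfolding N0_def by linarith
    have "0 < (16 * r) powr (1 / a)" using r by simp
    then have N_pos: "0 < N" using big by (cases N) auto
    have "16 * r = ((16 * r) powr (1 / a)) powr a" using r assms(1) by (simp add: powr_powr)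
    also have "\<dots> \<le> real N powr a" using big assms(1) by (intro powr_mono2) auto
    finally have Na: "16 * r \<le> real N powr a" .
    have c_inv: "real N powr a = 1 / c" using N_pos by (simp add: c_def powr_minus_divide)
    have c0: "0 < c" using N_pos by (simp add: c_def)
    have rc: "16 * (r * c) \<le> 1" using Na c0 unfolding c_inv by (simp add: field_simps)
    have "1 * c \<le> r * c" using r c0 by (intro mult_right_mono) auto
    then have c_small: "c \<le> 1 / 16" using rc by simp
    have s': "\<bar>s\<bar> = 1" using s by auto
    have "edge_scaling g s c L M r"
      using g_Lip g_bound g_supp s' c0 r rc by unfold_locales auto
    then interpret edge_scaling g s c L M r .
    have f: "(\<lambda>x. g (real N powr a * (x - 2 * s))) = f"
      by (simp add: f_def fun_eq_iff c_inv)
    have h: "(\<lambda>x. g (- s * x^2)) = h" and hx: "(\<lambda>x. g (- s * x^2) * x) = (\<lambda>x. h x * x)"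
      by (simp_all add: h_def fun_eq_iff)
    have sqrt_c: "real N powr (- a / 2) = sqrt c"
      unfolding c_def by (simp add: powr_half_sqrt[symmetric] powr_powr)
    have \<sigma>': "-1 \<le> \<sigma>" "\<sigma> = 1 \<or> \<sigma> \<le> 1 - e" using \<sigma> by (auto simp: e_def)
    note est = edge_asymptotics[OF e \<sigma>' c_def N_pos c_small]
    show "let E = 2 * s;
         f = (\<lambda>x. g (real N powr a * (x - E)));
         err = edge_scaling.err_const L M r e * real N powr (- a / 2)
     in
       \<bar>V_tr1 f - (H_half_norm (\<lambda>x. g (- s * x^2)))^2 / (8 * pi^2)\<bar> \<le> err \<and>
       \<bar>V_tr2 f \<sigma> - of_bool (\<sigma> = 1) * ((H_half_norm (\<lambda>x. g (- s * x^2)))^2 / (8 * pi^2))\<bar> \<le> err \<and>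
       \<bar>C_scale a E N * V_d1 f - sqrt 2 * (L2_norm (\<lambda>x. g (- s * x^2) * x))^2\<bar> \<le> err \<and>
       \<bar>C_scale a E N * V_d2 f \<sigma>
          - of_bool (\<sigma> = 1) * (sqrt 2 * (L2_norm (\<lambda>x. g (- s * x^2) * x))^2)\<bar> \<le> err \<and>
       \<bar>E_tr f \<sigma> - of_bool (\<sigma> = 1) * (- g 0 / 2)\<bar> \<le> err"
      unfolding Let_def f h hx sqrt_c using est by (intro conjI)
  qed
qed

end
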